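(* Let $0<q<1$, $-1<s<0$, let $n\ge1$, and let $u_1,\dots,u_n>0$ satisfy $u_i\ne q u_j$ for all $i,j=1,\dots,n$. Then for any $\ell\ge1$ and any integers $x_1\ge x_2\ge\dots\ge x_\ell\ge 1$, the $q$-moment of the height function $\mathfrak h_n$ (at time $n$) of the stochastic dynamics with parameters $u_1,\dots,u_n$ started from the empty configuration is $$\mathbb E\prod_{i=1}^{\ell}q^{\mathfrak h_n(x_i)}=q^{\frac{\ell(\ell-1)}2}\oint_{\gamma[\bar{\mathbf u}|1]}\frac{dw_1}{2\pi \mathbf i}\cdots\oint_{\gamma[\bar{\mathbf u}|\ell]}\frac{dw_\ell}{2\pi \mathbf i}\prod_{1\le \alpha<\beta\le \ell}\frac{w_\alpha-w_\beta}{w_\alpha-qw_\beta}\prod_{i=1}^{\ell}\left(w_i^{-1}\left(\frac{1-sw_i}{1-s^{-1}w_i}\right)^{x_i-1}\prod_{j=1}^{n}\frac{1-qu_jw_i}{1-u_jw_i}\right).$$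
   Context: Stochastic vertex weights: for $u\ge0$, $g\in\mathbb Z_{\ge0}$, $L_u(g,0;g,0)=\frac{1-sq^gu}{1-su}$, $L_u(g,0;g-1,1)=\frac{-su+sq^gu}{1-su}$, $L_u(g,1;g,1)=\frac{-su+s^2q^g}{1-su}$, $L_u(g,1;g+1,0)=\frac{1-s^2q^g}{1-su}$, and $L_u(i_1,j_1;i_2,j_2)=0$ otherwise. For given $(i_1,j_1)\in\mathbb Z_{\ge0}\times\{0,1\}$ these are probability weights in $(i_2,j_2)$. Dynamics: a configuration is a collection of finitely many (identical) particles on $\{1,2,3,\dots\}$, described by occupation numbers $(m_x)_{x\ge1}$ (several particles per site allowed). At time $0$ there are no particles. During the step from time $t$ to time $t+1$ (with parameter $u=u_{t+1}$), the configuration $(m_x)$ is changed to $(m'_x)$ sequentially from left to right: put $h_1=1$ (one new particle enters from the left), and for $x=1,2,\dots$, given $m_x$ and $h_x$, choose $(m'_x,h_{x+1})$ with probability $L_u(m_x,h_x;m'_x,h_{x+1})$ (all choices independent); the update terminates almost surely. At time $n$ there are exactly $n$ particles. Equivalently, this is an ensemble of up-right paths in the quadrant in which one path enters each horizontal row from the left boundary, with vertex weights $L_{u_y}$ in row $y$. Height function: $\mathfrak h_n(x)=\sum_{y\ge x}m_y$ is the number of particles at locations $\ge x$ at time $n$. Contours: $\gamma[\bar{\mathbf u}]$ is a union of sufficiently small positively oriented circles around all the points $u_1^{-1},\dots,u_n^{-1}$, such that the interior of $\gamma[\bar{\mathbf u}]$ does not intersect $q^{\pm1}\gamma[\bar{\mathbf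 u}]$, and $s$ is outside $\gamma[\bar{\mathbf u}]$. Let $c_0$ be a sufficiently small positively oriented circle centered at $0$, and $r>q^{-1}$, such that $r^\ell c_0$ does not encircle $s$ and $r^\ell c_0$ does not intersect $q\gamma[\bar{\mathbf u}]$ (the circle is so small that $\gamma[\bar{\mathbf u}]$ and $q\gamma[\bar{\mathbf u}]$ lie outside $r^\ell c_0$). Set $\gamma[\bar{\mathbf u}|j]:=\gamma[\bar{\mathbf u}]\cup r^jc_0$, $j=1,\dots,\ell$. Here $R\gamma$ denotes the image of a contour $\gamma$ under multiplication by $R$. *)

theory Defs
  imports "HOL-Probability.Probability" "HOL-Complex_Analysis.Complex_Analysis"
begin

section \<open>Stochastic vertex weights\<close>

text \<open>\<open>L_weight q s u i1 j1 i2 j2\<close> is the weight \<open>L\<^sub>u(i1, j1; i2, j2)\<close>. The case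
  \<open>L\<^sub>u(g, 0; g - 1, 1)\<close> is guarded by \<open>i1 = Suc i2\<close> to avoid truncated subtraction; for \<open>g = 0\<close> its
  formula would give weight 0.\<close>

definition L_weight :: "real \<Rightarrow> real \<Rightarrow> real \<Rightarrow> nat \<Rightarrow> nat \<Rightarrow> nat \<Rightarrow> nat \<Rightarrow> real" where
  "L_weight q s u i1 j1 i2 j2 =
     (if j1 = 0 \<and> j2 = 0 \<and> i2 = i1 then (1 - s * q ^ i1 * u) / (1 - s * u)
      else if j1 = 0 \<and> j2 = 1 \<and> i1 = Suc i2 then (- s * u + s * q ^ i1 * u) / (1 - s * u)
      else if j1 = 1 \<and> j2 = 1 \<and> i2 = i1 then (- s * u + s\<^sup>2 * q ^ i1) / (1 - s * u)
      else if j1 = 1 \<and> j2 = 0 \<and> i2 = Suc i1 then (1 - s\<^sup>2 * q ^ i1) / (1 - s * u)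
      else 0)"

definition vertex_pmf :: "real \<Rightarrow> real \<Rightarrow> real \<Rightarrow> nat \<Rightarrow> nat \<Rightarrow> (nat \<times> nat) pmf" where
  "vertex_pmf q s u i1 j1 = embed_pmf (\<lambda>(i2, j2). L_weight q s u i1 j1 i2 j2)"

lemma pmf_vertex_pmf:
  assumes "0 < q" "q < 1" "-1 < s" "s < 0" "0 \<le> u" "j1 \<in> {0, 1}"
  shows "pmf (vertex_pmf q s u i1 j1) (i2, j2) = L_weight q s u i1 j1 i2 j2"
proof -
  have su: "s * u \<le> 0" using assms by (simp add: mult_nonpos_nonneg)
  have qi: "0 < q ^ i1" "q ^ i1 \<le> 1" using assms by (auto intro: power_le_one)
  have s2: "0 < s\<^sup>2" "s\<^sup>2 < 1" using assms by (auto simp: abs_square_less_1)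
  have s2q: "s\<^sup>2 * q ^ i1 \<le> 1" "0 \<le> s\<^sup>2 * q ^ i1"
    using s2 qi by (auto intro: mult_le_one)
  have suq: "s * q ^ i1 * u \<le> 0" "s * u \<le> s * q ^ i1 * u"
    using su qi mult_left_mono_neg[of "q ^ i1" 1 "s * u"] mult_nonpos_nonneg[OF su, of "q ^ i1"]
    by (simp_all add: mult.commute mult.left_commute)
  have nonneg: "0 \<le> L_weight q s u i1 j1 a b" for a b
    unfolding L_weight_def using su s2q suq by (auto intro!: divide_nonneg_nonneg)
  define A where "A = (if j1 = 0 then {(i1, 0), (i1 - 1, 1)} else {(i1, 1), (Suc i1, 0)} :: (nat \<times> nat) set)"
  have supp: "L_weight q s u i1 j1 a b = 0" if "(a, b) \<notin> A" for a b
    using that assms(6) unfolding A_def L_weight_def by (auto split: if_splits)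
  have sum1: "(\<Sum>(a, b)\<in>A. L_weight q s u i1 j1 a b) = 1"
    using assms(6) su unfolding A_def L_weight_def
    by (cases i1) (auto simp: add_divide_distrib[symmetric])
  have "(\<integral>\<^sup>+z. ennreal (case z of (a, b) \<Rightarrow> L_weight q s u i1 j1 a b) \<partial>count_space UNIV)
      = (\<integral>\<^sup>+z. ennreal (case z of (a, b) \<Rightarrow> L_weight q s u i1 j1 a b) \<partial>count_space A)"
    by (rule nn_integral_count_space_eq) (auto dest: supp)
  also have "\<dots> = (\<Sum>z\<in>A. ennreal (case z of (a, b) \<Rightarrow> L_weight q s u i1 j1 a b))"
    by (rule nn_integral_count_space_finite) (simp add: A_def)
  also have "\<dots> = 1"
    using sum1 by (subst sum_ennreal) (auto simp: nonneg)
  finally show ?thesis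
    unfolding vertex_pmf_def by (subst pmf_embed_pmf) (auto simp: nonneg)
qed

section \<open>The dynamics\<close>

text \<open>Configurations are functions \<open>m :: nat \<Rightarrow> nat\<close>, with \<open>m x\<close> the occupation number of site
  \<open>x \<ge> 1\<close>; the value at 0 plays no role. \<open>sweep q s u m h x\<close> is the part of an update that processes
  the sites \<open>x, x + 1, \<dots>\<close> when \<open>h\<close> is the number of particles arriving at \<open>x\<close> from the left. It stops
  once nothing arrives and no particle remains at a site \<open>\<ge> x\<close>: all later vertices are then
  \<open>(0,0;0,0)\<close>, which has weight 1. Almost sure termination is losslessness of the resulting
  \<open>spmf\<close> (\<open>lossless_dynamics\<close> below).\<close>

partial_function (spmf) sweep ::
  "real \<Rightarrow> real \<Rightarrow> real \<Rightarrow> (nat \<Rightarrow> nat) \<Rightarrow> nat \<Rightarrow> nat \<Rightarrow> (nat \<Rightarrow> nat) spmf" where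
  "sweep q s u m h x =
     (if h = 0 \<and> (\<forall>y\<ge>x. m y = 0) then return_spmf m
      else bind_spmf (spmf_of_pmf (vertex_pmf q s u (m x) h))
             (\<lambda>(g', h'). sweep q s u (m(x := g')) h' (Suc x)))"

text \<open>\<open>dynamics q s u n\<close> is the law of the configuration at time \<open>n\<close>; the step from time \<open>t\<close> to
  \<open>t + 1\<close> uses the parameter \<open>u (t + 1)\<close>, and one particle enters from the left at each step.\<close>

primrec dynamics :: "real \<Rightarrow> real \<Rightarrow> (nat \<Rightarrow> real) \<Rightarrow> nat \<Rightarrow> (nat \<Rightarrow> nat) spmf" where
  "dynamics q s u 0 = return_spmf (\<lambda>_. 0)"
| "dynamics q s u (Suc t) = bind_spmf (dynamics q s u t) (\<lambda>m. sweep q s (u (Suc t)) m 1 1)"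

text \<open>The index set is finite for every configuration in the support of \<open>dynamics\<close>
  (\<open>finite_support_dynamics\<close> below).\<close>

definition height :: "(nat \<Rightarrow> nat) \<Rightarrow> nat \<Rightarrow> nat" where
  "height m x = (\<Sum>y | x \<le> y \<and> m y \<noteq> 0. m y)"

lemma set_vertex_pmf:
  assumes "0 < q" "q < 1" "-1 < s" "s < 0" "0 \<le> u" "j1 \<in> {0, 1}"
    and "(i2, j2) \<in> set_pmf (vertex_pmf q s u i1 j1)"
  shows "j2 \<in> {0, 1}"
  using assms(7) pmf_vertex_pmf[OF assms(1-6), of i1 i2 j2]
  by (auto simp: set_pmf_iff L_weight_def split: if_splits)

lemma lossless_sweep_step:
  assumes "0 < q" "q < 1" "-1 < s" "s < 0" "0 \<le> u" "h \<in> {0, 1}"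
    and "\<And>g' h'. h' \<in> {0, 1} \<Longrightarrow> lossless_spmf (sweep q s u (m(x := g')) h' (Suc x))"
  shows "lossless_spmf (sweep q s u m h x)"
  by (subst sweep.simps)
     (auto simp: split_beta intro!: assms(7) dest: set_vertex_pmf[OF assms(1-6)])

lemma lossless_sweep_tail:
  assumes par: "0 < q" "q < 1" "-1 < s" "s < 0" "0 \<le> u"
    and zero: "\<forall>y\<ge>x. m y = 0" and h: "h \<in> {0, 1}"
  shows "lossless_spmf (sweep q s u m h x)"
proof -
  define a where "a = (- s * u + s\<^sup>2) / (1 - s * u)"
  have su: "s * u \<le> 0" using par by (simp add: mult_nonpos_nonneg)
  have s2: "s\<^sup>2 < 1" using par by (auto simp: abs_square_less_1)
  have a: "0 \<le> a"
    unfolding a_def using su zero_le_power2[of s] by (intro divide_nonneg_nonneg) linarith+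
  have a': "a < 1"
    unfolding a_def using su s2 by (subst divide_less_eq_1) linarith
  have w0: "weight_spmf (sweep q s u m 0 x) = 1" if "\<forall>y\<ge>x. m y = 0" for m x
  proof -
    have "sweep q s u m 0 x = return_spmf m" by (subst sweep.simps) (use that in simp)
    then show ?thesis by simp
  qed
  have w1: "1 - a ^ k \<le> weight_spmf (sweep q s u m 1 x)" if "\<forall>y\<ge>x. m y = 0" for k m x
    using that
  proof (induction k arbitrary: m x)
    case (Suc k)
    have p: "pmf (vertex_pmf q s u 0 1) (i, j) = L_weight q s u 0 1 i j" for i j
      by (rule pmf_vertex_pmf[OF par]) simp
    have sup: "set_pmf (vertex_pmf q s u 0 1) \<subseteq> {(0, 1), (1, 0)}"
      by (auto simp: set_pmf_iff p L_weight_def simp del: One_nat_def split: if_splits)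
    have pa: "L_weight q s u 0 1 0 1 = a" "L_weight q s u 0 1 1 0 = 1 - a"
      using su by (auto simp: L_weight_def a_def field_simps)
    have "sweep q s u m 1 x = bind_spmf (spmf_of_pmf (vertex_pmf q s u 0 1))
            (\<lambda>z. sweep q s u (m(x := fst z)) (snd z) (Suc x))"
      by (subst sweep.simps) (use Suc.prems in \<open>simp add: case_prod_unfold\<close>)
    then have "weight_spmf (sweep q s u m 1 x) =
      measure_pmf.expectation (vertex_pmf q s u 0 1)
        (\<lambda>z. weight_spmf (sweep q s u (m(x := fst z)) (snd z) (Suc x)))"
      by (simp only: weight_bind_spmf measure_spmf_spmf_of_pmf o_def)
    also have "\<dots> = a * weight_spmf (sweep q s u (m(x := 0)) 1 (Suc x))
                  + (1 - a) * weight_spmf (sweep q s u (m(x := 1)) 0 (Suc x))"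
      by (subst integral_measure_pmf[of "{(0,1),(1,0)}"]) (use sup in \<open>auto simp: p pa simp del: One_nat_def\<close>)
    also have "\<dots> \<ge> a * (1 - a ^ k) + (1 - a) * 1"
    proof (intro add_mono mult_left_mono)
      show "1 - a ^ k \<le> weight_spmf (sweep q s u (m(x := 0)) 1 (Suc x))"
        by (rule Suc.IH) (use Suc.prems in simp)
      show "1 \<le> weight_spmf (sweep q s u (m(x := 1)) 0 (Suc x))"
        using w0[of "Suc x" "m(x := 1)"] Suc.prems by simp
    qed (use a a' in auto)
    finally show ?case by (simp add: algebra_simps)
  qed simp
  have "(\<lambda>k. 1 - a ^ k) \<longlonglongrightarrow> 1 - 0"
    using a a' by (intro tendsto_intros LIMSEQ_power_zero) auto
  then have "1 \<le> weight_spmf (sweep q s u m 1 x)"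
    using LIMSEQ_le_const2[of "\<lambda>k. 1 - a ^ k" 1 "weight_spmf (sweep q s u m 1 x)"] w1[OF zero] by auto
  then show ?thesis
    using h w0[OF zero] weight_spmf_le_1[of "sweep q s u m 1 x"]
    by (auto simp: lossless_spmf_def)
qed

lemma lossless_sweep:
  assumes par: "0 < q" "q < 1" "-1 < s" "s < 0" "0 \<le> u"
    and fin: "finite {y. m y \<noteq> 0}" and h: "h \<in> {0, 1}"
  shows "lossless_spmf (sweep q s u m h x)"
proof -
  have *: "lossless_spmf (sweep q s u m h x)"
    if "\<forall>y\<ge>x + d. m y = 0" "h \<in> {0, 1}" for d m h x
    using that
  proof (induction d arbitrary: m h x)
    case 0
    then show ?case using lossless_sweep_tail[OF par] by simp
  next
    case (Suc d)
    show ?case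
      by (rule lossless_sweep_step[OF par Suc.prems(2)], rule Suc.IH) (use Suc.prems(1) in auto)
  qed
  obtain N where "\<forall>y. m y \<noteq> 0 \<longrightarrow> y < N"
    using fin by (auto simp: finite_nat_set_iff_bounded)
  then show ?thesis using *[of x N m h] h by (metis le_add2 le_trans not_less)
qed

lemma finite_support_sweep:
  assumes "m' \<in> set_spmf (sweep q s u m h x)" "finite {y. m y \<noteq> 0}"
  shows "finite {y. m' y \<noteq> 0}"
proof -
  have "\<forall>q s u m h x. finite {y. m y \<noteq> 0} \<longrightarrow> set_spmf (sweep q s u m h x) \<subseteq> {m'. finite {y. m' y \<noteq> 0}}"
  proof (induction rule: sweep.fixp_induct)
    case 1
    show ?case by simp
  next
    case 2
    show ?case by simp
  next
    case (3 f)
    have "finite {y. (m(x := g)) y \<noteq> 0}" if "finite {y. m y \<noteq> 0}" for m :: "nat \<Rightarrow> nat" and x g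
      by (rule finite_subset[OF _ finite.insertI[OF that, of x]]) auto
    note upd = this
    have "set_spmf (spmf_of_pmf p \<bind> (\<lambda>(g', h'). f q s u (m(x := g')) h' (Suc x)))
        \<subseteq> {m'. finite {y. m' y \<noteq> 0}}"
      if m: "finite {y. m y \<noteq> 0}" for p q s u m x
    proof
      fix m'
      assume "m' \<in> set_spmf (spmf_of_pmf p \<bind> (\<lambda>(g', h'). f q s u (m(x := g')) h' (Suc x)))"
      then obtain g h where "m' \<in> set_spmf (f q s u (m(x := g)) h (Suc x))"
        by (auto simp: set_bind_spmf simp del: bind_spmf_of_pmf)
      then show "m' \<in> {m'. finite {y. m' y \<noteq> 0}}"
        using 3 upd[OF m] by blast
    qed
    then show ?case by (simp del: bind_spmf_of_pmf)
  qed
  then show ?thesis using assms by blast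
qed
lemma finite_support_dynamics:
  "m \<in> set_spmf (dynamics q s u n) \<Longrightarrow> finite {y. m y \<noteq> 0}"
  by (induction n arbitrary: m) (auto simp: set_bind_spmf dest: finite_support_sweep)

lemma lossless_dynamics:
  assumes "0 < q" "q < 1" "-1 < s" "s < 0" "\<And>t. t \<in> {1..n} \<Longrightarrow> 0 \<le> u t"
  shows "lossless_spmf (dynamics q s u n)"
  using assms(5)
  by (induction n) (auto intro!: lossless_sweep[OF assms(1-4)] dest: finite_support_dynamics)

section \<open>Contours\<close>

text \<open>A contour is a finite union of positively oriented circles, given as a set of pairs
  \<open>(centre, radius)\<close>. \<open>circles_image\<close> is the contour as a point set, \<open>circles_hull\<close> the contour
  together with its interior, and \<open>dilate R\<close> (for \<open>R > 0\<close>) the image under multiplication by \<open>R\<close>.\<close>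

type_synonym circles = "(complex \<times> real) set"

definition circles_image :: "circles \<Rightarrow> complex set" where
  "circles_image \<Gamma> = (\<Union>(p, \<rho>)\<in>\<Gamma>. sphere p \<rho>)"

definition circles_hull :: "circles \<Rightarrow> complex set" where
  "circles_hull \<Gamma> = (\<Union>(p, \<rho>)\<in>\<Gamma>. cball p \<rho>)"

definition dilate :: "real \<Rightarrow> circles \<Rightarrow> circles" where
  "dilate R \<Gamma> = (\<lambda>(p, \<rho>). (of_real R * p, R * \<rho>)) ` \<Gamma>"

text \<open>\<open>oint\<close> includes the factor \<open>1/(2\<pi>\<i>)\<close>.\<close>

definition oint :: "circles \<Rightarrow> (complex \<Rightarrow> complex) \<Rightarrow> complex" where
  "oint \<Gamma> f = (\<Sum>(p, \<rho>)\<in>\<Gamma>. contour_integral (circlepath p \<rho>) f) / (2 * of_real pi * \<i>)"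

text \<open>\<open>iterated_oint \<Gamma> [j\<^sub>1, \<dots>, j\<^sub>k] F w\<close> integrates \<open>F\<close> over the coordinates \<open>j\<^sub>1\<close> (outermost) to
  \<open>j\<^sub>k\<close> (innermost), coordinate \<open>j\<close> running over \<open>\<Gamma> j\<close>; the other coordinates are those of \<open>w\<close>.\<close>

fun iterated_oint ::
  "(nat \<Rightarrow> circles) \<Rightarrow> nat list \<Rightarrow> ((nat \<Rightarrow> complex) \<Rightarrow> complex) \<Rightarrow> (nat \<Rightarrow> complex) \<Rightarrow> complex" where
  "iterated_oint \<Gamma> [] F w = F w"
| "iterated_oint \<Gamma> (j # js) F w = oint (\<Gamma> j) (\<lambda>z. iterated_oint \<Gamma> js F (w(j := z)))"

definition inverse_points :: "nat \<Rightarrow> (nat \<Rightarrow> real) \<Rightarrow> complex set" where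
  "inverse_points n u = (\<lambda>i. of_real (inverse (u i))) ` {1..n}"

text \<open>The union of circles around the points \<open>1/u\<^sub>i\<close>. The \<open>u\<^sub>i\<close> need not be distinct: there is one
  circle, of radius \<open>\<rho> p\<close>, for each distinct point \<open>p\<close>.\<close>

definition u_contour :: "nat \<Rightarrow> (nat \<Rightarrow> real) \<Rightarrow> (complex \<Rightarrow> real) \<Rightarrow> circles" where
  "u_contour n u \<rho> = (\<lambda>p. (p, \<rho> p)) ` inverse_points n u"

text \<open>\<open>u_contour_ext n u \<rho> c r j\<close> adds the circle \<open>r\<^sup>j c\<^sub>0\<close>, where \<open>c\<^sub>0\<close> has centre 0 and radius \<open>c\<close>.\<close>

definition u_contour_ext ::
  "nat \<Rightarrow> (nat \<Rightarrow> real) \<Rightarrow> (complex \<Rightarrow> real) \<Rightarrow> real \<Rightarrow> real \<Rightarrow> nat \<Rightarrow> circles" where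
  "u_contour_ext n u \<rho> c r j = u_contour n u \<rho> \<union> dilate (r ^ j) {(0, c)}"

text \<open>``Sufficiently small'' is made explicit. The closed discs around distinct points are disjoint,
  so that each circle encloses exactly one of them; the other conditions are those relating the
  contours, their \<open>q\<close>-multiples, \<open>s\<close> and 0. Closed discs are used for interiors so that no circle
  touches another one tangentially or passes through \<open>s\<close>, which would make the integrand singular.\<close>

definition admissible_contours ::
  "real \<Rightarrow> real \<Rightarrow> nat \<Rightarrow> (nat \<Rightarrow> real) \<Rightarrow> nat \<Rightarrow> (complex \<Rightarrow> real) \<Rightarrow> real \<Rightarrow> real \<Rightarrow> bool" where
  "admissible_contours q s n u l \<rho> c r \<longleftrightarrow>
     (\<forall>p\<in>inverse_points n u. 0 < \<rho> p) \<and>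
     pairwise (\<lambda>p p'. disjnt (cball p (\<rho> p)) (cball p' (\<rho> p'))) (inverse_points n u) \<and>
     disjnt (circles_hull (u_contour n u \<rho>)) (circles_image (dilate q (u_contour n u \<rho>))) \<and>
     disjnt (circles_hull (u_contour n u \<rho>)) (circles_image (dilate (inverse q) (u_contour n u \<rho>))) \<and>
     of_real s \<notin> circles_hull (u_contour n u \<rho>) \<and>
     0 < c \<and> inverse q < r \<and>
     of_real s \<notin> circles_hull (dilate (r ^ l) {(0, c)}) \<and>
     disjnt (circles_image (u_contour n u \<rho>)) (circles_hull (dilate (r ^ l) {(0, c)})) \<and>
     disjnt (circles_image (dilate q (u_contour n u \<rho>))) (circles_hull (dilate (r ^ l) {(0, c)}))"

lemma cball_sphere_disjnt:
  fixes a b :: complex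
  assumes "x + y < dist a b"
  shows "disjnt (cball a x) (cball b y)" "disjnt (cball a x) (sphere b y)" "disjnt (sphere a x) (cball b y)"
proof -
  show "disjnt (cball a x) (cball b y)"
    unfolding disjnt_iff using assms by (smt (verit) dist_commute dist_triangle mem_cball)
  then show "disjnt (cball a x) (sphere b y)" "disjnt (sphere a x) (cball b y)"
    by (auto simp: disjnt_iff)
qed
lemma admissible_contours_exist:
  assumes q: "0 < q" "q < 1" and s: "s < 0"
    and u: "\<And>i. i \<in> {1..n} \<Longrightarrow> 0 < u i"
    and uq: "\<And>i j. i \<in> {1..n} \<Longrightarrow> j \<in> {1..n} \<Longrightarrow> u i \<noteq> q * u j"
  shows "\<exists>\<rho> c r. admissible_contours q s n u l \<rho> c r"
proof -
  define P where "P = inverse_points n u"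
  define D where "D = insert (- s) (norm ` P \<union> (\<lambda>(p, p'). dist p (of_real q * p')) ` (P \<times> P)
    \<union> (\<lambda>(p, p'). dist p p') ` {z \<in> P \<times> P. fst z \<noteq> snd z})"
  define d where "d = Min D"
  have Pu: "\<exists>i\<in>{1..n}. p = of_real (inverse (u i))" if "p \<in> P" for p
    using that by (auto simp: P_def inverse_points_def)
  have "finite P" by (simp add: P_def inverse_points_def)
  then have fin: "finite D" by (simp add: D_def)
  have ne: "p \<noteq> of_real q * p'" if pP: "p \<in> P" "p' \<in> P" for p p'
  proof
    assume eq: "p = of_real q * p'"
    obtain i j where ij: "i \<in> {1..n}" "p = of_real (inverse (u i))"
        "j \<in> {1..n}" "p' = of_real (inverse (u j))"
      using Pu[OF pP(1)] Pu[OF pP(2)] by blast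
    have "complex_of_real (inverse (u i)) = of_real (q * inverse (u j))"
      using eq unfolding ij(2,4) of_real_mult .
    then have "inverse (u i) = q * inverse (u j)"
      by (simp only: of_real_eq_iff)
    then have "u j = q * u i" using u[OF ij(1)] u[OF ij(3)] by (simp add: field_simps)
    with uq[OF ij(3,1)] show False by blast
  qed
  have nz: "p \<noteq> 0" if "p \<in> P" for p
    using Pu[OF that] u by fastforce
  have "\<forall>x\<in>D. 0 < x" using s ne nz by (auto simp: D_def)
  then have d: "0 < d" using fin by (auto simp: d_def D_def)
  have dle: "d \<le> x" if "x \<in> D" for x using fin that by (simp add: d_def)
  have d1: "d \<le> - s" by (rule dle) (simp add: D_def)
  have d2: "d \<le> norm p" if "p \<in> P" for p by (rule dle) (use that in \<open>simp add: D_def\<close>)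
  have d3: "d \<le> dist p (of_real q * p')" if "p \<in> P" "p' \<in> P" for p p'
    by (rule dle) (use that in \<open>force simp: D_def\<close>)
  have d4: "d \<le> dist p p'" if "p \<in> P" "p' \<in> P" "p \<noteq> p'" for p p'
    by (rule dle) (use that in \<open>force simp: D_def\<close>)
  have d5: "d / q \<le> dist p (of_real (inverse q) * p')" if "p \<in> P" "p' \<in> P" for p p'
  proof -
    have "p - of_real (inverse q) * p' = - (of_real (inverse q) * (p' - of_real q * p))"
      using q by (simp add: field_simps)
    then have "dist p (of_real (inverse q) * p') = dist p' (of_real q * p) / q"
      using q by (simp only: dist_norm norm_minus_cancel norm_mult norm_of_real) (simp add: field_simps)
    with d3[OF that(2,1)] q show ?thesis by (simp add: divide_right_mono)
  qed
  have d6: "d \<le> dist p (of_real s)" if pP: "p \<in> P" for p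
  proof -
    obtain i where i: "i \<in> {1..n}" "p = of_real (inverse (u i))" using Pu[OF pP] by blast
    have "dist p (of_real s) = \<bar>inverse (u i) - s\<bar>"
      unfolding i(2) by (metis dist_of_real dist_real_def)
    moreover have "0 < inverse (u i)" using u[OF i(1)] by simp
    ultimately show ?thesis using d1 s by linarith
  qed
  define e where "e = d / 3"
  define r where "r = 2 / q"
  define c where "c = q * e / r ^ l"
  have e: "0 < e" using d by (simp add: e_def)
  have r: "0 < r" "inverse q < r" using q by (simp_all add: r_def field_simps)
  have c: "0 < c" "r ^ l * c = q * e" using q e r by (simp_all add: c_def)
  have qe: "q * e < e" using q e by simp
  have eq: "e + q * e < d" using qe d unfolding e_def by linarith
  have eq': "e + inverse q * e < d / q"
    using divide_strict_right_mono[OF eq q(1)] q by (simp add: field_simps)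
  have uc: "u_contour n u (\<lambda>_. e) = (\<lambda>p. (p, e)) ` P"
    by (simp add: u_contour_def P_def)
  have sets:
    "circles_hull ((\<lambda>p. (p, e)) ` P) = (\<Union>p\<in>P. cball p e)"
    "circles_image ((\<lambda>p. (p, e)) ` P) = (\<Union>p\<in>P. sphere p e)"
    "circles_image (dilate R ((\<lambda>p. (p, e)) ` P)) = (\<Union>p\<in>P. sphere (of_real R * p) (R * e))"
    "circles_hull (dilate (r ^ l) {(0, c)}) = cball 0 (q * e)" for R
    by (simp_all add: circles_hull_def circles_image_def dilate_def c(2))
  have "admissible_contours q s n u l (\<lambda>_. e) c r"
    unfolding admissible_contours_def uc P_def[symmetric] sets
  proof (intro conjI)
    show "pairwise (\<lambda>p p'. disjnt (cball p e) (cball p' e)) P"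
    proof (rule pairwiseI)
      fix p p' assume "p \<in> P" "p' \<in> P" "p \<noteq> p'"
      then show "disjnt (cball p e) (cball p' e)"
        using d4[of p p'] d by (intro cball_sphere_disjnt) (simp add: e_def)
    qed
    have "disjnt (cball p e) (sphere (of_real q * p') (q * e))" if "p \<in> P" "p' \<in> P" for p p'
      using d3[OF that] eq by (intro cball_sphere_disjnt) simp
    then show "disjnt (\<Union>p\<in>P. cball p e) (\<Union>p\<in>P. sphere (of_real q * p) (q * e))"
      unfolding disjnt_iff by blast
    have "disjnt (cball p e) (sphere (of_real (inverse q) * p') (inverse q * e))"
      if "p \<in> P" "p' \<in> P" for p p'
      by (rule cball_sphere_disjnt) (rule less_le_trans[OF eq' d5[OF that]])
    then show "disjnt (\<Union>p\<in>P. cball p e) (\<Union>p\<in>P. sphere (of_real (inverse q) * p) (inverse q * e))"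
      unfolding disjnt_iff by blast
    show "of_real s \<notin> (\<Union>p\<in>P. cball p e)"
    proof
      assume "of_real s \<in> (\<Union>p\<in>P. cball p e)"
      then obtain p where "p \<in> P" "dist p (of_real s) \<le> e" by auto
      with d6[of p] d show False by (simp add: e_def)
    qed
    have "q * e < - s" using d1 qe d unfolding e_def by linarith
    then show "of_real s \<notin> cball (0 :: complex) (q * e)" using s by simp
    have "disjnt (sphere p e) (cball 0 (q * e))" if "p \<in> P" for p
      using d2[OF that] eq by (intro cball_sphere_disjnt) simp
    then show "disjnt (\<Union>p\<in>P. sphere p e) (cball 0 (q * e))"
      unfolding disjnt_iff by blast
    have "disjnt (sphere (of_real q * p) (q * e)) (cball 0 (q * e))" if "p \<in> P" for p
    proof (rule cball_sphere_disjnt)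
      have "q * (e + e) < q * d" using q d by (intro mult_strict_left_mono) (simp_all add: e_def)
      then have "q * e + q * e < q * d" by (simp only: distrib_left)
      also have "\<dots> \<le> dist (of_real q * p) 0"
        using d2[OF that] q by (simp add: norm_mult)
      finally show "q * e + q * e < dist (of_real q * p) 0" .
    qed
    then show "disjnt (\<Union>p\<in>P. sphere (of_real q * p) (q * e)) (cball 0 (q * e))"
      unfolding disjnt_iff by blast
  qed (use e c(1) r(2) in auto)
  then show ?thesis by blast
qed

end

theory Submission
  imports Defs
begin

text \<open>Write \<open>Q\<^sub>t(x) = q ^ h\<^sub>t(x)\<close> for the height \<open>h\<^sub>t\<close> at time \<open>t\<close>. The idea is to find enough
  relations between the moments of the \<open>Q\<^sub>t(x)\<close> at two consecutive times to determine them, and to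
  check that the contour integrals satisfy the same relations.

  Consider the step from \<open>t\<close> to \<open>t + 1\<close> with parameter \<open>v = u\<^sub>t\<^sub>+\<^sub>1\<close>, and let \<open>b\<^sub>x\<close>, either 0 or 1, be
  the number of particles that arrive at \<open>x\<close> from the left, so that \<open>Q\<^sub>t\<^sub>+\<^sub>1(x) = q ^ b\<^sub>x Q\<^sub>t(x)\<close>.

  \<^item> Vertex relation (\<open>sweep_vertex_relation\<close>): given the old configuration and the update to the
    left of \<open>x\<close>, the conditional expectation of
    \<open>(1 - s v) Q\<^sub>t\<^sub>+\<^sub>1(x + 1) + (s v - s\<^sup>2) Q\<^sub>t\<^sub>+\<^sub>1(x)\<close> is
    \<open>(1 - q s v) Q\<^sub>t(x + 1) + (q s v - s\<^sup>2) Q\<^sub>t(x)\<close>. This holds because the vertex weights are affine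
    in \<open>q ^ m\<^sub>x = Q\<^sub>t(x) / Q\<^sub>t(x + 1)\<close>.
  \<^item> Equal points: \<open>(Q\<^sub>t\<^sub>+\<^sub>1(x) - Q\<^sub>t(x)) (Q\<^sub>t\<^sub>+\<^sub>1(x) - q Q\<^sub>t(x)) = 0\<close>, because \<open>b\<^sub>x\<close> is 0 or 1.
  \<^item> Boundary: \<open>Q\<^sub>t\<^sub>+\<^sub>1(1) = q Q\<^sub>t(1)\<close>, because one particle enters.

  Take points \<open>x\<^sub>1 \<ge> \<dots> \<ge> x\<^sub>l\<close>, the first \<open>k\<close> of them at time \<open>t\<close> and the others at time \<open>t + 1\<close>.
  Applied to the first point at time \<open>t + 1\<close>, these relations express the moment by moments in
  which the positions at time \<open>t + 1\<close> have a smaller sum, so they determine the moments at time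
  \<open>t + 1\<close> from those at time \<open>t\<close> (\<open>two_time_moment_eq\<close>).

  On the side of the integrals, the point \<open>(x, t)\<close> corresponds to the function \<open>point_fun q s u x t\<close>
  of one variable, and each relation has a counterpart.

  \<^item> The vertex relation is an identity between these functions (\<open>vertex_relation_point_fun\<close>).
  \<^item> For equal points in the variables \<open>w\<^sub>i\<close> and \<open>w\<^sub>i\<^sub>+\<^sub>1\<close>, the combination of the functions contains
    the factor \<open>w\<^sub>i - q w\<^sub>i\<^sub>+\<^sub>1\<close>. It cancels the pole of the kernel and leaves an antisymmetric
    integrand; the contours of the two variables can then be identified, and the integral vanishes
    (\<open>nested_integral_equal_points\<close>).
  \<^item> For the boundary relation, the integrand is \<open>O(w\<^sub>l ^ -2)\<close> at infinity, so its residues in \<open>w\<^sub>l\<close>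
    sum to 0. Those outside the contour lie at \<open>w\<^sub>\<alpha> / q\<close> with \<open>w\<^sub>\<alpha>\<close> on a circle around some
    \<open>1 / u\<^sub>j\<close>. After taking such a residue, the factor of the last variable cancels all poles of the
    integrand in \<open>w\<^sub>\<alpha>\<close> inside these circles, so the integral over \<open>w\<^sub>\<alpha>\<close> vanishes
    (\<open>nested_integral_boundary\<close>).

  At time 0 only the residues at the origin contribute; they give the inverse of the prefactor
  (\<open>nested_integral_time_0\<close>).

  For the boundary relation the points \<open>w\<^sub>\<alpha> / q\<close> have to be distinct. Therefore the argument uses
  circles around the \<open>1 / u\<^sub>j\<close> whose radii strictly increase with the index of the variable. The
  centre is the only pole inside such a circle, so the integral does not depend on the radii
  (\<open>iterated_integrand_radius_independent\<close>).\<close>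

section \<open>Expectations of the dynamics\<close>

lemma integral_bind_spmf:
  fixes f :: "'b \<Rightarrow> real"
  assumes "\<And>y. \<bar>f y\<bar> \<le> B"
  shows "(\<integral>y. f y \<partial>measure_spmf (bind_spmf p k)) =
    (\<integral>x. (\<integral>y. f y \<partial>measure_spmf (k x)) \<partial>measure_spmf p)"
  unfolding measure_spmf_bind
  by (subst integral_bind[where K="count_space UNIV" and B=B and B'=1])
     (use assms in \<open>auto simp: o_def measure_spmf.emeasure_space_le_1 space_subprob_algebra\<close>, unfold_locales)

lemma integrable_spmf_bounded:
  fixes f :: "'b \<Rightarrow> real"
  assumes "\<And>y. \<bar>f y\<bar> \<le> B"
  shows "integrable (measure_spmf p) f"
  using assms by (intro measure_spmf.integrable_const_bound[where B=B]) auto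

lemma integral_spmf_cong:
  fixes f :: "'b \<Rightarrow> real"
  assumes "\<And>y. y \<in> set_spmf p \<Longrightarrow> f y = g y"
  shows "(\<integral>y. f y \<partial>measure_spmf p) = (\<integral>y. g y \<partial>measure_spmf p)"
  using assms by (intro integral_cong_AE) auto

lemma integral_spmf_const:
  assumes "lossless_spmf p"
  shows "(\<integral>y. c \<partial>measure_spmf p) = (c::real)"
  using assms by (simp add: lossless_spmf_def weight_spmf_def)

locale vertex_params =
  fixes q s u :: real
  assumes q: "0 < q" "q < 1" and s: "-1 < s" "s < 0" and u: "0 < u"
begin

lemma su_neg: "s * u < 0" using s u by (simp add: mult_neg_pos)

lemma pmf_vertex: "h \<in> {0,1} \<Longrightarrow> pmf (vertex_pmf q s u g h) (g', h') = L_weight q s u g h g' h'"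
  using pmf_vertex_pmf q s u by (metis less_imp_le)

lemma set_vertex:
  assumes "h \<in> {0,1}" "(g', h') \<in> set_pmf (vertex_pmf q s u g h)"
  shows "h' \<in> {0,1}" "g' + h' = g + h"
  using assms(2) pmf_vertex[OF assms(1)] assms(1)
  by (auto simp: set_pmf_iff L_weight_def split: if_splits)

lemma vertex_0_0: "vertex_pmf q s u 0 0 = return_pmf (0, 0)"
proof -
  have "set_pmf (vertex_pmf q s u 0 0) \<subseteq> {(0, 0)}"
    using set_vertex[of 0 _ _ 0] by fastforce
  then show ?thesis by (metis set_pmf_subset_singleton)
qed

text \<open>The stopping rule of \<open>sweep\<close> is harmless: at an empty site that no particle reaches, the vertex
  returns \<open>(0, 0)\<close> surely. So the recursion also holds in the stopped case, and no case distinction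
  is needed below.\<close>

lemma sweep_step:
  "sweep q s u m h x =
     bind_spmf (spmf_of_pmf (vertex_pmf q s u (m x) h)) (\<lambda>z. sweep q s u (m(x := fst z)) (snd z) (Suc x))"
proof (cases "h = 0 \<and> (\<forall>y\<ge>x. m y = 0)")
  case True
  then have "m(x := 0) = m" by auto
  with True have "sweep q s u m h x = return_spmf m"
      "sweep q s u (m(x := 0)) 0 (Suc x) = return_spmf m"
    by (subst sweep.simps, simp)+
  with True show ?thesis by (simp add: vertex_0_0)
next
  case False
  then show ?thesis by (subst sweep.simps) (auto simp: case_prod_unfold)
qed

lemma expectation_vertex:
  fixes F :: "nat \<times> nat \<Rightarrow> real"
  assumes "h \<in> {0,1}"
  shows "(\<integral>z. F z \<partial>measure_pmf (vertex_pmf q s u g h)) =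
    (if h = 0 then L_weight q s u g 0 g 0 * F (g, 0) + L_weight q s u g 0 (g - 1) 1 * F (g - 1, 1)
     else L_weight q s u g 1 g 1 * F (g, 1) + L_weight q s u g 1 (Suc g) 0 * F (Suc g, 0))"
proof -
  let ?A = "if h = 0 then {(g, 0), (g - 1, 1)} else {(g, 1), (Suc g, 0)}"
  have "a \<in> ?A" if "a \<in> set_pmf (vertex_pmf q s u g h)" for a
    using set_vertex[OF assms, of "fst a" "snd a" g] that assms by (cases a) auto
  then have "(\<integral>z. F z \<partial>measure_pmf (vertex_pmf q s u g h)) =
      (\<Sum>a\<in>?A. pmf (vertex_pmf q s u g h) a *\<^sub>R F a)"
    by (intro integral_measure_pmf) auto
  then show ?thesis using assms by (auto simp: pmf_vertex)
qed

lemma lossless: "finite {y. m y \<noteq> 0} \<Longrightarrow> h \<in> {0,1} \<Longrightarrow> lossless_spmf (sweep q s u m h x)"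
  using lossless_sweep q s u by (metis less_imp_le)

lemma integral_sweep_step:
  fixes \<Phi> :: "(nat \<Rightarrow> nat) \<Rightarrow> real"
  assumes "\<And>m. \<bar>\<Phi> m\<bar> \<le> B" "h \<in> {0, 1}"
  shows "(\<integral>m'. \<Phi> m' \<partial>measure_spmf (sweep q s u m h x)) =
    (\<integral>z. (\<integral>m'. \<Phi> m' \<partial>measure_spmf (sweep q s u (m(x := fst z)) (snd z) (Suc x)))
      \<partial>measure_pmf (vertex_pmf q s u (m x) h))"
  by (subst sweep_step, subst integral_bind_spmf[OF assms(1)]) (simp add: measure_spmf_spmf_of_pmf)

end

lemma finite_support_upd:
  "finite {y. m y \<noteq> (0::nat)} \<Longrightarrow> finite {y. (m(x := g)) y \<noteq> 0}"
  by (rule finite_subset[of _ "insert x {y. m y \<noteq> 0}"]) auto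

lemma height_Suc:
  assumes "finite {y. m y \<noteq> 0}"
  shows "height m x = m x + height m (Suc x)"
proof -
  have fin: "finite {y. Suc x \<le> y \<and> m y \<noteq> 0}" using assms by (rule rev_finite_subset) auto
  show ?thesis
  proof (cases "m x = 0")
    case True
    then have "{y. x \<le> y \<and> m y \<noteq> 0} = {y. Suc x \<le> y \<and> m y \<noteq> 0}"
      by (auto simp: Suc_le_eq le_less)
    then show ?thesis using True by (simp add: height_def)
  next
    case False
    then have "{y. x \<le> y \<and> m y \<noteq> 0} = insert x {y. Suc x \<le> y \<and> m y \<noteq> 0}"
      by (auto simp: Suc_le_eq le_less)
    then show ?thesis using fin by (simp add: height_def)
  qed
qed

lemma height_upd_below: "x < y \<Longrightarrow> height (m(x := g)) y = height m y"
  unfolding height_def by (rule sum.cong) auto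

text \<open>A vertex conserves particles: those in transit, \<open>h\<close> before it and \<open>h'\<close> after it, complete the
  balance.\<close>

lemma height_upd:
  assumes "finite {y. m y \<noteq> 0}" "y \<le> x" "g' + h' = m x + h"
  shows "height (m(x := g')) y + h' = height m y + h"
  using assms(2)
proof (induction rule: inc_induct)
  case base
  show ?case
    using height_Suc[OF assms(1), of x] height_Suc[OF finite_support_upd[OF assms(1)], of x g' x] assms(3)
      height_upd_below[of x "Suc x" m g'] by (simp only: fun_upd_same lessI)
next
  case (step k)
  then show ?case
    using height_Suc[OF assms(1), of k] height_Suc[OF finite_support_upd[OF assms(1)], of x g' k]
    by (simp del: fun_upd_apply add: fun_upd_other)
qed

text \<open>Conservation of particles: whatever arrives at \<open>x\<close> ends up to the right of \<open>y\<close>. Consequently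
  all heights at positions \<open>\<le> x\<close> are known when the sweep reaches \<open>x\<close>.\<close>

lemma height_sweep:
  assumes "m' \<in> set_spmf (sweep q s u m h x)" "vertex_params q s u"
    and "finite {y. m y \<noteq> 0}" "h \<in> {0, 1}" "y \<le> x"
  shows "height m' y = height m y + h"
proof -
  have "\<forall>q s u m h x. vertex_params q s u \<and> finite {y. m y \<noteq> 0} \<and> h \<in> {0, 1} \<longrightarrow>
    (\<forall>m'\<in>set_spmf (sweep q s u m h x). \<forall>y\<le>x. height m' y = height m y + h)"
  proof (induction rule: sweep.fixp_induct)
    case 1
    show ?case by simp
  next
    case 2
    show ?case by simp
  next
    case (3 f)
    have "height m' y = height m y + h"
      if m: "vertex_params q s u" "finite {y. m y \<noteq> 0}" "h \<in> {0, 1}" and y: "y \<le> x"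
        and m': "m' \<in> set_spmf (spmf_of_pmf (vertex_pmf q s u (m x) h) \<bind>
          (\<lambda>(g', h'). f q s u (m(x := g')) h' (Suc x)))"
      for q s u m h x m' y
    proof -
      interpret vertex_params q s u by fact
      obtain g' h' where gh: "(g', h') \<in> set_pmf (vertex_pmf q s u (m x) h)"
          "m' \<in> set_spmf (f q s u (m(x := g')) h' (Suc x))"
        using m' by (auto simp: set_bind_spmf simp del: bind_spmf_of_pmf)
      have "height m' y = height (m(x := g')) y + h'"
        using 3[rule_format, of q s u "m(x := g')" h' m' "Suc x" y] gh m(1) finite_support_upd[OF m(2)]
          set_vertex(1)[OF m(3) gh(1)] y by auto
      also have "\<dots> = height m y + h"
        by (rule height_upd[OF m(2) y set_vertex(2)[OF m(3) gh(1)]])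
      finally show ?thesis .
    qed
    note * = this
    show ?case
      by (intro allI impI ballI, elim conjE, split if_split_asm) (simp, rule *)
  qed
  then show ?thesis using assms by blast
qed

lemma abs_prod_power_le_1:
  assumes "0 \<le> q" "q \<le> (1::real)"
  shows "\<bar>\<Prod>i\<in>I. q ^ k i\<bar> \<le> 1"
proof -
  have "0 \<le> (\<Prod>i\<in>I. q ^ k i)" using assms by (intro prod_nonneg) auto
  moreover have "(\<Prod>i\<in>I. q ^ k i) \<le> 1" using assms by (intro prod_le_1) (auto intro: power_le_one)
  ultimately show ?thesis by simp
qed

context vertex_params
begin

text \<open>The vertex relation when the sweep is at \<open>x\<close>. The probability that a particle moves on to \<open>x + 1\<close>
  is affine both in \<open>h\<close> and in \<open>q ^ m x\<close>, which is the ratio of the values at \<open>x\<close> and \<open>x + 1\<close> of \<open>q\<close> to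
  the power of the height.\<close>

lemma expectation_height_Suc:
  assumes "finite {y. m y \<noteq> 0}" "h \<in> {0, 1}"
  shows "(1 - s * u) * (\<integral>m'. q ^ height m' (Suc x) \<partial>measure_spmf (sweep q s u m h x)) +
      (s * u - s\<^sup>2) * q ^ (height m x + h) =
    (1 - q * s * u) * q ^ height m (Suc x) + (q * s * u - s\<^sup>2) * q ^ height m x"
proof -
  have b: "\<bar>q ^ k\<bar> \<le> 1" for k using q by (simp add: power_le_one)
  have inner: "(\<integral>m'. q ^ height m' (Suc x) \<partial>measure_spmf (sweep q s u (m(x := g')) h' (Suc x)))
      = q ^ (height m (Suc x) + h')" if "h' \<in> {0,1}" for g' h'
  proof -
    have "(\<integral>m'. q ^ height m' (Suc x) \<partial>measure_spmf (sweep q s u (m(x := g')) (h') (Suc x)))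
      = (\<integral>m'. q ^ (height m (Suc x) + h') \<partial>measure_spmf (sweep q s u (m(x := g')) (h') (Suc x)))"
      by (rule integral_spmf_cong)
         (use height_sweep vertex_params_axioms finite_support_upd[OF assms(1)] that in
           \<open>force simp: height_upd_below\<close>)
    also have "\<dots> = q ^ (height m (Suc x) + h')"
      by (rule integral_spmf_const) (use lossless finite_support_upd[OF assms(1)] that in blast)
    finally show ?thesis .
  qed
  have nz: "1 - s * u \<noteq> 0" using su_neg by simp
  have hx: "q ^ height m x = q ^ m x * q ^ height m (Suc x)"
    using height_Suc[OF assms(1), of x] by (simp add: power_add)
  define g where "g = m x"
  define a where "a = q ^ g"
  define b where "b = q ^ height m (Suc x)"
  have "(1 - s * u) * (\<integral>m'. q ^ height m' (Suc x) \<partial>measure_spmf (sweep q s u m h x)) =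
     (if h = 0 then (1 - s * a * u) * b + (- s * u + s * a * u) * (q * b)
      else (- s * u + s\<^sup>2 * a) * (q * b) + (1 - s\<^sup>2 * a) * b)"
  proof -
    have "g = 0 \<Longrightarrow> a = 1" by (simp add: a_def)
    moreover have "L_weight q s u g 0 (g - 1) 1 = (- s * u + s * q ^ g * u) / (1 - s * u)"
      by (cases g) (auto simp: L_weight_def)
    ultimately show ?thesis using assms(2) nz
    by (subst integral_sweep_step[OF b assms(2)], subst expectation_vertex[OF assms(2)])
       (auto simp: inner L_weight_def power_add distrib_left simp del: One_nat_def simp flip: g_def b_def a_def)
  qed
  then show ?thesis using assms(2)
    unfolding hx power_add g_def[symmetric] a_def[symmetric] b_def[symmetric]
    by (auto simp: algebra_simps power2_eq_square)
qed

text \<open>The vertex relation for a sweep that starts further left. The factors at positions \<open>\<le> x\<close> are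
  determined before the vertex at \<open>x\<close> is sampled, so they behave like constants; the old heights at
  \<open>x\<close> and \<open>x + 1\<close> are not affected by updates to the left of \<open>x\<close>.\<close>

lemma sweep_vertex_relation:
  assumes "finite {y. m y \<noteq> 0}" "h \<in> {0, 1}" "x0 \<le> x" "\<And>i. i \<in> I \<Longrightarrow> y i \<le> x"
  shows "(\<integral>m'. (\<Prod>i\<in>I. q ^ height m' (y i)) *
        ((1 - s * u) * q ^ height m' (Suc x) + (s * u - s\<^sup>2) * q ^ height m' x)
        \<partial>measure_spmf (sweep q s u m h x0)) =
    (\<integral>m'. (\<Prod>i\<in>I. q ^ height m' (y i)) \<partial>measure_spmf (sweep q s u m h x0)) *
      ((1 - q * s * u) * q ^ height m (Suc x) + (q * s * u - s\<^sup>2) * q ^ height m x)"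
  using assms(3,1,2)
proof (induction arbitrary: m h rule: inc_induct)
  case base
  define Y where "Y = (\<Prod>i\<in>I. q ^ (height m (y i) + h))"
  have Y: "(\<Prod>i\<in>I. q ^ height m' (y i)) = Y" if "m' \<in> set_spmf (sweep q s u m h x)" for m'
    unfolding Y_def using height_sweep[OF that vertex_params_axioms base assms(4)] by simp
  have b: "\<bar>q ^ k\<bar> \<le> 1" for k using q by (simp add: power_le_one)
  have ll: "lossless_spmf (sweep q s u m h x)" by (rule lossless[OF base])
  have "(\<integral>m'. (\<Prod>i\<in>I. q ^ height m' (y i)) *
        ((1 - s * u) * q ^ height m' (Suc x) + (s * u - s\<^sup>2) * q ^ height m' x)
        \<partial>measure_spmf (sweep q s u m h x)) = 
      (\<integral>m'. Y * (1 - s * u) * q ^ height m' (Suc x) + Y * (s * u - s\<^sup>2) * q ^ (height m x + h)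
        \<partial>measure_spmf (sweep q s u m h x))"
    by (rule integral_spmf_cong)
       (simp add: Y height_sweep[OF _ vertex_params_axioms base order_refl] algebra_simps)
  also have "\<dots> = Y * ((1 - s * u) * (\<integral>m'. q ^ height m' (Suc x) \<partial>measure_spmf (sweep q s u m h x)) +
      (s * u - s\<^sup>2) * q ^ (height m x + h))"
    by (subst Bochner_Integration.integral_add)
       (auto simp: integral_spmf_const[OF ll] integrable_spmf_bounded[OF b] distrib_left mult.assoc
         simp del: lebesgue_integral_const integral_const intro!: integrable_mult_right)
  also have "\<dots> = Y * ((1 - q * s * u) * q ^ height m (Suc x) + (q * s * u - s\<^sup>2) * q ^ height m x)"
    by (simp only: expectation_height_Suc[OF base])
  also have "Y = (\<integral>m'. (\<Prod>i\<in>I. q ^ height m' (y i)) \<partial>measure_spmf (sweep q s u m h x))"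
    using integral_spmf_const[OF ll, of Y] integral_spmf_cong[of _ "\<lambda>m'. \<Prod>i\<in>I. q ^ height m' (y i)" "\<lambda>_. Y"] Y
    by simp
  finally show ?case .
next
  case (step k)
  have b: "\<bar>q ^ k\<bar> \<le> 1" for k using q by (simp add: power_le_one)
  define c where "c = \<bar>1 - s * u\<bar> * 1 + \<bar>s * u - s\<^sup>2\<bar> * 1"
  have b1: "\<bar>(\<Prod>i\<in>I. q ^ height m' (y i))\<bar> \<le> 1" for m'
    using q by (intro abs_prod_power_le_1) auto
  have b2: "\<bar>(\<Prod>i\<in>I. q ^ height m' (y i)) *
        ((1 - s * u) * q ^ height m' (Suc x) + (s * u - s\<^sup>2) * q ^ height m' x)\<bar> \<le> 1 * c" for m'
    unfolding abs_mult c_def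
    by (intro mult_mono b1 order.trans[OF abs_triangle_ineq] add_mono) (auto simp: abs_mult mult_left_le b[simplified])
  have IH_upd: "(\<integral>m'. (\<Prod>i\<in>I. q ^ height m' (y i)) *
        ((1 - s * u) * q ^ height m' (Suc x) + (s * u - s\<^sup>2) * q ^ height m' x)
        \<partial>measure_spmf (sweep q s u (m(k := g')) (h') (Suc k))) =
    (\<integral>m'. (\<Prod>i\<in>I. q ^ height m' (y i)) \<partial>measure_spmf (sweep q s u (m(k := g')) (h') (Suc k))) *
      ((1 - q * s * u) * q ^ height m (Suc x) + (q * s * u - s\<^sup>2) * q ^ height m x)"
    if "h' \<in> {0,1}" for g' h'
    using step.IH[OF finite_support_upd[OF step.prems(1)] that] step.hyps
    by (simp add: height_upd_below del: fun_upd_apply)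
  show ?case using step.prems(2)
    by (auto simp add: integral_sweep_step[OF b1 step.prems(2)] integral_sweep_step[OF b2 step.prems(2)]
        expectation_vertex[OF step.prems(2)] distrib_right
        mult.assoc IH_upd simp del: fun_upd_apply fun_upd_triv One_nat_def)
qed

end


lemma height_sweep_increment:
  assumes "vertex_params q s u" "x0 \<le> x" "finite {y. m y \<noteq> 0}" "h \<in> {0, 1}"
    and "m' \<in> set_spmf (sweep q s u m h x0)"
  shows "height m' x = height m x \<or> height m' x = Suc (height m x)"
proof -
  interpret vertex_params q s u by fact
  show ?thesis using assms(2-5)
  proof (induction arbitrary: m h rule: inc_induct)
    case base
    then show ?case using height_sweep[OF base(3) vertex_params_axioms base(1,2) order_refl] by auto
  next
    case (step k)
    obtain g' h' where gh: "(g', h') \<in> set_pmf (vertex_pmf q s u (m k) h)"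
        "m' \<in> set_spmf (sweep q s u (m(k := g')) h' (Suc k))"
      using step.prems(3) by (subst (asm) sweep_step) (auto simp: set_bind_spmf simp del: bind_spmf_of_pmf)
    show ?case
      using step.IH[OF finite_support_upd[OF step.prems(1)] set_vertex(1)[OF step.prems(2) gh(1)] gh(2)]
        height_upd_below[OF step.hyps(2), of m g'] by (simp del: fun_upd_apply)
  qed
qed

text \<open>The first \<open>k\<close> factors are taken at time \<open>t\<close>, the others at time \<open>t + 1\<close>.\<close>

definition two_time_moment ::
  "real \<Rightarrow> real \<Rightarrow> (nat \<Rightarrow> real) \<Rightarrow> nat \<Rightarrow> nat \<Rightarrow> (nat \<Rightarrow> nat) \<Rightarrow> nat \<Rightarrow> real" where
  "two_time_moment q s u t l X k =
    (\<integral>m. (\<Prod>i=1..k. q ^ height m (X i)) *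
      (\<integral>m'. (\<Prod>i=Suc k..l. q ^ height m' (X i)) \<partial>measure_spmf (sweep q s (u (Suc t)) m 1 1))
     \<partial>measure_spmf (dynamics q s u t))"

context
  fixes q s :: real and u :: "nat \<Rightarrow> real" and t :: nat
  assumes par: "vertex_params q s (u (Suc t))"
begin

interpretation vertex_params q s "u (Suc t)" by (rule par)

lemma fin_dyn: "m \<in> set_spmf (dynamics q s u t) \<Longrightarrow> finite {y. m y \<noteq> 0}"
  by (rule finite_support_dynamics)

lemma abs_moment_le_1: "\<bar>\<Prod>i\<in>I. q ^ k i\<bar> \<le> 1"
  using q by (intro abs_prod_power_le_1) auto

lemma abs_sweep_integral_le:
  fixes f :: "_ \<Rightarrow> real"
  assumes "\<And>m. \<bar>f m\<bar> \<le> 1"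
  shows "\<bar>\<integral>m'. f m' \<partial>measure_spmf p\<bar> \<le> 1"
proof -
  have "\<bar>\<integral>m'. f m' \<partial>measure_spmf p\<bar> \<le> (\<integral>m'. \<bar>f m'\<bar> \<partial>measure_spmf p)"
    by (rule integral_abs_bound)
  also have "\<dots> \<le> (\<integral>m'. 1 \<partial>measure_spmf p)"
    using assms by (intro integral_mono integrable_spmf_bounded[where B=1]) auto
  also have "\<dots> \<le> 1" using weight_spmf_le_1[of p] by (simp add: weight_spmf_def)
  finally show ?thesis .
qed

lemma integrable_two_time:
  "integrable (measure_spmf (dynamics q s u t)) (\<lambda>m. (\<Prod>i\<in>I. q ^ height m (X i)) *
      (\<integral>m'. (\<Prod>i\<in>J. q ^ height m' (Y i)) \<partial>measure_spmf (sweep q s (u (Suc t)) m 1 1)))"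
  by (rule integrable_spmf_bounded[where B="1 * 1"], unfold abs_mult,
      intro mult_mono abs_moment_le_1 abs_sweep_integral_le) auto

lemma two_time_moment_0:
  "two_time_moment q s u t l X 0 =
    (\<integral>m. (\<Prod>i=1..l. q ^ height m (X i)) \<partial>measure_spmf (dynamics q s u (Suc t)))"
  by (simp add: two_time_moment_def integral_bind_spmf[OF abs_moment_le_1])

lemma two_time_moment_top:
  "two_time_moment q s u t l X l =
    (\<integral>m. (\<Prod>i=1..l. q ^ height m (X i)) \<partial>measure_spmf (dynamics q s u t))"
  unfolding two_time_moment_def
  by (rule integral_spmf_cong)
     (use lossless fin_dyn in \<open>auto simp: lossless_spmf_def weight_spmf_def simp del: One_nat_def\<close>)

lemma two_time_moment_equal_points:
  assumes "Suc (Suc k) \<le> l" "X (Suc k) = X (Suc (Suc k))" "1 \<le> X (Suc k)"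
  shows "two_time_moment q s u t l X k =
    (1 + q) * two_time_moment q s u t l X (Suc k) - q * two_time_moment q s u t l X (Suc (Suc k))"
proof -
  let ?x = "X (Suc k)"
  let ?R = "\<lambda>m. (\<Prod>i=Suc (Suc (Suc k))..l. q ^ height m (X i))"
  let ?P = "\<lambda>m. (\<Prod>i=1..k. q ^ height m (X i))"
  let ?sw = "\<lambda>m. measure_spmf (sweep q s (u (Suc t)) m 1 1)"
  have split: "(\<Prod>i=Suc k..l. q ^ height m (X i)) = q ^ height m ?x * (q ^ height m ?x * ?R m)"
    "(\<Prod>i=Suc (Suc k)..l. q ^ height m (X i)) = q ^ height m ?x * ?R m"
    "(\<Prod>i=1..Suc k. q ^ height m (X i)) = ?P m * q ^ height m ?x"
    "(\<Prod>i=1..Suc (Suc k). q ^ height m (X i)) = ?P m * q ^ height m ?x * q ^ height m ?x" for m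
    using assms(1,2) by (simp_all add: prod.atLeast_Suc_atMost)
  have "?P m * (\<integral>m'. (\<Prod>i=Suc k..l. q ^ height m' (X i)) \<partial>?sw m) =
     (1 + q) * ((\<Prod>i=1..Suc k. q ^ height m (X i)) * (\<integral>m'. (\<Prod>i=Suc (Suc k)..l. q ^ height m' (X i)) \<partial>?sw m))
     - q * ((\<Prod>i=1..Suc (Suc k). q ^ height m (X i)) * (\<integral>m'. ?R m' \<partial>?sw m))"
    if m: "m \<in> set_spmf (dynamics q s u t)" for m
  proof -
    let ?Q = "q ^ height m ?x"
    have "(\<integral>m'. (\<Prod>i=Suc k..l. q ^ height m' (X i)) \<partial>?sw m) =
      (\<integral>m'. (1 + q) * ?Q * (\<Prod>i=Suc (Suc k)..l. q ^ height m' (X i)) - q * ?Q\<^sup>2 * ?R m' \<partial>?sw m)"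
    proof (rule integral_spmf_cong)
      fix m' assume "m' \<in> set_spmf (sweep q s (u (Suc t)) m 1 1)"
      then have "height m' ?x = height m ?x \<or> height m' ?x = Suc (height m ?x)"
        using height_sweep_increment[OF par assms(3) fin_dyn[OF m], of 1] by simp
      then show "(\<Prod>i=Suc k..l. q ^ height m' (X i)) =
          (1 + q) * ?Q * (\<Prod>i=Suc (Suc k)..l. q ^ height m' (X i)) - q * ?Q\<^sup>2 * ?R m'"
        unfolding split by (auto simp: algebra_simps power2_eq_square)
    qed
    also have "\<dots> = (1 + q) * ?Q * (\<integral>m'. (\<Prod>i=Suc (Suc k)..l. q ^ height m' (X i)) \<partial>?sw m)
        - q * ?Q\<^sup>2 * (\<integral>m'. ?R m' \<partial>?sw m)"
      by (subst Bochner_Integration.integral_diff)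
         (auto intro!: integrable_mult_right integrable_spmf_bounded[OF abs_moment_le_1])
    finally have eq: "(\<integral>m'. (\<Prod>i=Suc k..l. q ^ height m' (X i)) \<partial>?sw m) =
      (1 + q) * ?Q * (\<integral>m'. (\<Prod>i=Suc (Suc k)..l. q ^ height m' (X i)) \<partial>?sw m)
        - q * ?Q\<^sup>2 * (\<integral>m'. ?R m' \<partial>?sw m)" .
    show ?thesis unfolding eq split(3,4) by (simp add: algebra_simps power2_eq_square del: prod.cl_ivl_Suc)
  qed
  then have "two_time_moment q s u t l X k = (\<integral>m. (1 + q) * ((\<Prod>i=1..Suc k. q ^ height m (X i)) *
       (\<integral>m'. (\<Prod>i=Suc (Suc k)..l. q ^ height m' (X i)) \<partial>?sw m))
     - q * ((\<Prod>i=1..Suc (Suc k). q ^ height m (X i)) * (\<integral>m'. ?R m' \<partial>?sw m))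
     \<partial>measure_spmf (dynamics q s u t))"
    unfolding two_time_moment_def by (rule integral_spmf_cong)
  also have "\<dots> = (1 + q) * two_time_moment q s u t l X (Suc k) - q * two_time_moment q s u t l X (Suc (Suc k))"
    unfolding two_time_moment_def
    by (subst Bochner_Integration.integral_diff)
       (auto intro!: integrable_mult_right integrable_two_time simp del: prod.cl_ivl_Suc One_nat_def)
  finally show ?thesis .
qed

lemma two_time_moment_vertex:
  assumes "Suc k \<le> l" "X (Suc k) = Suc x" "1 \<le> x" "\<And>i. Suc k < i \<Longrightarrow> i \<le> l \<Longrightarrow> X i \<le> x"
  defines "v \<equiv> u (Suc t)" and "Y \<equiv> X(Suc k := x)"
  shows "(1 - s * v) * two_time_moment q s u t l X k + (s * v - s\<^sup>2) * two_time_moment q s u t l Y k =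
    (1 - q * s * v) * two_time_moment q s u t l X (Suc k) +
    (q * s * v - s\<^sup>2) * two_time_moment q s u t l Y (Suc k)"
proof -
  let ?I = "{Suc (Suc k)..l}"
  let ?R = "\<lambda>m. (\<Prod>i\<in>?I. q ^ height m (X i))"
  let ?P = "\<lambda>m. (\<Prod>i=1..k. q ^ height m (X i))"
  let ?sw = "\<lambda>m. measure_spmf (sweep q s v m 1 1)"
  let ?D = "measure_spmf (dynamics q s u t)"
  have PY: "(\<Prod>i=1..k. q ^ height m (Y i)) = ?P m" for m
    by (rule prod.cong) (auto simp: Y_def)
  have RY: "(\<Prod>i\<in>?I. q ^ height m (Y i)) = ?R m" for m
    by (rule prod.cong) (auto simp: Y_def)
  have split: "(\<Prod>i=Suc k..l. q ^ height m (X i)) = q ^ height m (Suc x) * ?R m"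
    "(\<Prod>i=Suc k..l. q ^ height m (Y i)) = q ^ height m x * ?R m"
    "(\<Prod>i=1..Suc k. q ^ height m (X i)) = ?P m * q ^ height m (Suc x)"
    "(\<Prod>i=1..Suc k. q ^ height m (Y i)) = ?P m * q ^ height m x" for m
    using assms(1,2) PY RY by (simp_all add: prod.atLeast_Suc_atMost Y_def del: fun_upd_apply add: fun_upd_same)
  have inner: "(1 - s * v) * (\<integral>m'. (\<Prod>i=Suc k..l. q ^ height m' (X i)) \<partial>?sw m) +
      (s * v - s\<^sup>2) * (\<integral>m'. (\<Prod>i=Suc k..l. q ^ height m' (Y i)) \<partial>?sw m) =
      (\<integral>m'. ?R m' \<partial>?sw m) * ((1 - q * s * v) * q ^ height m (Suc x) + (q * s * v - s\<^sup>2) * q ^ height m x)"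
    if m: "m \<in> set_spmf (dynamics q s u t)" for m
  proof -
    have "(1 - s * v) * (\<integral>m'. (\<Prod>i=Suc k..l. q ^ height m' (X i)) \<partial>?sw m) +
      (s * v - s\<^sup>2) * (\<integral>m'. (\<Prod>i=Suc k..l. q ^ height m' (Y i)) \<partial>?sw m) =
      (\<integral>m'. (1 - s * v) * (\<Prod>i=Suc k..l. q ^ height m' (X i)) +
         (s * v - s\<^sup>2) * (\<Prod>i=Suc k..l. q ^ height m' (Y i)) \<partial>?sw m)"
      by (subst Bochner_Integration.integral_add)
         (auto intro!: integrable_mult_right integrable_spmf_bounded[OF abs_moment_le_1])
    also have "\<dots> = (\<integral>m'. ?R m' * ((1 - s * v) * q ^ height m' (Suc x) + (s * v - s\<^sup>2) * q ^ height m' x) \<partial>?sw m)"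
      unfolding split by (simp add: algebra_simps)
    also have "\<dots> = (\<integral>m'. ?R m' \<partial>?sw m) *
        ((1 - q * s * v) * q ^ height m (Suc x) + (q * s * v - s\<^sup>2) * q ^ height m x)"
      unfolding v_def using assms(3,4) by (intro sweep_vertex_relation[OF fin_dyn[OF m]]) auto
    finally show ?thesis .
  qed
  have "(1 - s * v) * two_time_moment q s u t l X k + (s * v - s\<^sup>2) * two_time_moment q s u t l Y k =
    (\<integral>m. (1 - s * v) * (?P m * (\<integral>m'. (\<Prod>i=Suc k..l. q ^ height m' (X i)) \<partial>?sw m)) +
      (s * v - s\<^sup>2) * (?P m * (\<integral>m'. (\<Prod>i=Suc k..l. q ^ height m' (Y i)) \<partial>?sw m)) \<partial>?D)"
    unfolding two_time_moment_def PY v_def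
    by (subst Bochner_Integration.integral_add) (auto intro!: integrable_mult_right integrable_two_time simp del: One_nat_def)
  also have "\<dots> = (\<integral>m. (1 - q * s * v) * ((\<Prod>i=1..Suc k. q ^ height m (X i)) * (\<integral>m'. ?R m' \<partial>?sw m)) +
     (q * s * v - s\<^sup>2) * ((\<Prod>i=1..Suc k. q ^ height m (Y i)) * (\<integral>m'. ?R m' \<partial>?sw m)) \<partial>?D)"
  proof (rule integral_spmf_cong)
    fix m assume m: "m \<in> set_spmf (dynamics q s u t)"
    show "(1 - s * v) * (?P m * (\<integral>m'. (\<Prod>i=Suc k..l. q ^ height m' (X i)) \<partial>?sw m)) +
      (s * v - s\<^sup>2) * (?P m * (\<integral>m'. (\<Prod>i=Suc k..l. q ^ height m' (Y i)) \<partial>?sw m)) =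
      (1 - q * s * v) * ((\<Prod>i=1..Suc k. q ^ height m (X i)) * (\<integral>m'. ?R m' \<partial>?sw m)) +
      (q * s * v - s\<^sup>2) * ((\<Prod>i=1..Suc k. q ^ height m (Y i)) * (\<integral>m'. ?R m' \<partial>?sw m))"
      using arg_cong[OF inner[OF m], of "\<lambda>z. ?P m * z"] unfolding split(3,4)
      by (simp only: distrib_left distrib_right mult.assoc mult.commute mult.left_commute)
  qed
  also have "\<dots> = (1 - q * s * v) * two_time_moment q s u t l X (Suc k) +
    (q * s * v - s\<^sup>2) * two_time_moment q s u t l Y (Suc k)"
    unfolding two_time_moment_def RY v_def
    by (subst Bochner_Integration.integral_add)
       (auto intro!: integrable_mult_right integrable_two_time simp del: prod.cl_ivl_Suc One_nat_def)
  finally show ?thesis .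
qed

lemma two_time_moment_boundary:
  assumes "X (Suc k) = 1"
  shows "two_time_moment q s u t (Suc k) X k = q * two_time_moment q s u t (Suc k) X (Suc k)"
proof -
  let ?sw = "\<lambda>m. sweep q s (u (Suc t)) m 1 1"
  have "(\<integral>m'. q ^ height m' 1 \<partial>measure_spmf (?sw m)) = q * q ^ height m 1"
    if m: "m \<in> set_spmf (dynamics q s u t)" for m
  proof -
    have "(\<integral>m'. q ^ height m' 1 \<partial>measure_spmf (?sw m)) = (\<integral>m'. q * q ^ height m 1 \<partial>measure_spmf (?sw m))"
      by (rule integral_spmf_cong) (use height_sweep[OF _ par fin_dyn[OF m]] in simp)
    also have "\<dots> = q * q ^ height m 1"
      by (rule integral_spmf_const, rule lossless) (use fin_dyn[OF m] in auto)
    finally show ?thesis .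
  qed
  then have "two_time_moment q s u t (Suc k) X k =
      (\<integral>m. (\<Prod>i=1..k. q ^ height m (X i)) * (q * q ^ height m 1) \<partial>measure_spmf (dynamics q s u t))"
    unfolding two_time_moment_def by (intro integral_spmf_cong) (simp add: assms)
  also have "\<dots> = (\<integral>m. q * (\<Prod>i=1..Suc k. q ^ height m (X i)) \<partial>measure_spmf (dynamics q s u t))"
    by (rule integral_spmf_cong) (simp add: assms mult_ac)
  also have "\<dots> = q * two_time_moment q s u t (Suc k) X (Suc k)"
    unfolding two_time_moment_top by simp
  finally show ?thesis .
qed

end

section \<open>Iterated integrals over circles\<close>

text \<open>The factor \<open>1/(2\<pi>\<i>)\<close> is included, as in \<open>oint\<close>.\<close>

definition circ :: "complex \<Rightarrow> real \<Rightarrow> (complex \<Rightarrow> complex) \<Rightarrow> complex" where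
  "circ p \<rho> f = contour_integral (circlepath p \<rho>) f / (2 * of_real pi * \<i>)"

lemma oint_eq_sum_circ: "oint \<Gamma> f = (\<Sum>(p, \<rho>)\<in>\<Gamma>. circ p \<rho> f)"
  by (simp add: oint_def circ_def sum_divide_distrib case_prod_unfold)

lemma circ_cong:
  assumes "0 \<le> \<rho>" "\<And>z. z \<in> sphere p \<rho> \<Longrightarrow> f z = g z"
  shows "circ p \<rho> f = circ p \<rho> g"
  unfolding circ_def using assms by (auto intro!: contour_integral_cong arg_cong2[of _ _ _ _ "(/)"])

lemma circ_linear:
  assumes "0 \<le> \<rho>" "continuous_on (sphere p \<rho>) f" "continuous_on (sphere p \<rho>) g"
  shows "circ p \<rho> (\<lambda>z. a * f z + b * g z) = a * circ p \<rho> f + b * circ p \<rho> g"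
proof -
  have "f contour_integrable_on circlepath p \<rho>" "g contour_integrable_on circlepath p \<rho>"
    using assms by (auto intro!: contour_integrable_continuous_circlepath)
  then have "contour_integral (circlepath p \<rho>) (\<lambda>z. a * f z + b * g z) =
     a * contour_integral (circlepath p \<rho>) f + b * contour_integral (circlepath p \<rho>) g"
    by (simp add: contour_integral_add contour_integral_lmul contour_integrable_lmul)
  then show ?thesis by (simp add: circ_def add_divide_distrib)
qed

lemma circ_sum_linear:
  assumes "0 \<le> \<rho>" "\<And>i. i \<in> I \<Longrightarrow> continuous_on (sphere p \<rho>) (f i)"
  shows "circ p \<rho> (\<lambda>z. \<Sum>i\<in>I. f i z) = (\<Sum>i\<in>I. circ p \<rho> (f i))"
proof -
  have "circ p \<rho> (\<lambda>z. 0) = 0" by (simp add: circ_def)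
  from this assms(2) show ?thesis
  proof (induction I rule: infinite_finite_induct)
    case (insert x F)
    have "circ p \<rho> (\<lambda>z. 1 * f x z + 1 * (\<Sum>i\<in>F. f i z)) = 1 * circ p \<rho> (f x) + 1 * circ p \<rho> (\<lambda>z. \<Sum>i\<in>F. f i z)"
      using insert by (intro circ_linear assms(1) continuous_intros) auto
    with insert show ?case by simp
  qed auto
qed

lemma contour_integral_divide: "contour_integral g (\<lambda>z. h z / c) = contour_integral g h / c"
  by (simp add: contour_integral_integral)

lemma circ_swap:
  assumes "0 \<le> \<rho>" "0 \<le> \<rho>'"
    and "continuous_on (sphere p \<rho> \<times> sphere p' \<rho>') (\<lambda>(z, y). f z y)"
  shows "circ p \<rho> (\<lambda>z. circ p' \<rho>' (f z)) = circ p' \<rho>' (\<lambda>y. circ p \<rho> (\<lambda>z. f z y))"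
proof -
  have "contour_integral (circlepath p \<rho>) (\<lambda>z. contour_integral (circlepath p' \<rho>') (f z)) =
    contour_integral (circlepath p' \<rho>') (\<lambda>y. contour_integral (circlepath p \<rho>) (\<lambda>z. f z y))"
    using assms
    by (intro contour_integral_swap) (auto simp: vector_derivative_circlepath intro!: continuous_intros)
  then show ?thesis
    unfolding circ_def
    by (simp add: contour_integral_divide)
qed

lemma continuous_on_circ:
  fixes F :: "'a::topological_space \<Rightarrow> complex \<Rightarrow> complex"
  assumes "0 \<le> \<rho>" "continuous_on (U \<times> sphere p \<rho>) (\<lambda>(w, z). F w z)"
  shows "continuous_on U (\<lambda>w. circ p \<rho> (F w))"
proof -
  have "continuous_on (U \<times> cbox 0 1) (\<lambda>(w, t). F w (circlepath p \<rho> t) *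
      (2 * pi * \<i> * \<rho> * exp (2 * of_real pi * \<i> * of_real t)))"
  proof -
    have "continuous_on (U \<times> cbox 0 1) (\<lambda>x. F (fst x) (circlepath p \<rho> (snd x)))"
      using assms path_image_circlepath_nonneg[OF assms(1), of p]
      by (intro continuous_on_compose2[OF assms(2), where f="\<lambda>x. (fst x, circlepath p \<rho> (snd x))", simplified])
         (auto simp: path_image_def circlepath intro!: continuous_intros)
    then show ?thesis unfolding case_prod_unfold by (intro continuous_intros)
  qed
  from integral_continuous_on_param[OF this] show ?thesis
    unfolding circ_def contour_integral_integral vector_derivative_circlepath
    by (auto intro!: continuous_intros)
qed

text \<open>The variables of an iterated integral range over a product of plane sets. Only the coordinates
  in \<open>J\<close> are constrained, so that the set also makes sense while some variables are not yet
  assigned.\<close>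

definition torus :: "(nat \<Rightarrow> complex set) \<Rightarrow> nat set \<Rightarrow> (nat \<Rightarrow> complex) set" where
  "torus T J = {w. \<forall>j\<in>J. w j \<in> T j}"

lemma torus_upd: "z \<in> T j \<Longrightarrow> w \<in> torus T (J - {j}) \<Longrightarrow> w(j := z) \<in> torus T J"
  by (auto simp: torus_def)

lemma iterated_oint_append:
  "iterated_oint \<Gamma> (as @ bs) F w = iterated_oint \<Gamma> as (iterated_oint \<Gamma> bs F) w"
  by (induction as arbitrary: w) auto

lemma oint_0 [simp]: "oint \<Gamma> (\<lambda>_. 0) = 0"
  by (simp add: oint_def case_prod_unfold)

lemma iterated_oint_0 [simp]: "iterated_oint \<Gamma> js (\<lambda>_. 0) w = 0"
  by (induction js arbitrary: w) auto

lemma iterated_oint_upd_family: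
  "j \<notin> set js \<Longrightarrow> iterated_oint (\<Gamma>(j := C)) js F w = iterated_oint \<Gamma> js F w"
  by (induction js arbitrary: w) auto

text \<open>The sets \<open>T j\<close> may be larger than the contours themselves. This allows two families of contours
  to be compared inside the same domain of continuity.\<close>

locale contour_family =
  fixes \<Gamma> :: "nat \<Rightarrow> circles" and T :: "nat \<Rightarrow> complex set"
  assumes finite_circles: "finite (\<Gamma> j)"
    and radius_nonneg: "(p, \<rho>) \<in> \<Gamma> j \<Longrightarrow> 0 \<le> \<rho>"
    and sphere_subset: "(p, \<rho>) \<in> \<Gamma> j \<Longrightarrow> sphere p \<rho> \<subseteq> T j"
begin

lemma oint_cong:
  assumes "\<And>z. z \<in> T j \<Longrightarrow> f z = g z"
  shows "oint (\<Gamma> j) f = oint (\<Gamma> j) g"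
  unfolding oint_eq_sum_circ
  using assms sphere_subset by (intro sum.cong refl) (force intro!: circ_cong simp: radius_nonneg)

lemma oint_linear:
  assumes "continuous_on (T j) f" "continuous_on (T j) g"
  shows "oint (\<Gamma> j) (\<lambda>z. a * f z + b * g z) = a * oint (\<Gamma> j) f + b * oint (\<Gamma> j) g"
proof -
  have "oint (\<Gamma> j) (\<lambda>z. a * f z + b * g z) =
      (\<Sum>(p, \<rho>)\<in>\<Gamma> j. a * circ p \<rho> f + b * circ p \<rho> g)"
    unfolding oint_eq_sum_circ
  proof (intro sum.cong refl, clarify)
    fix p \<rho> assume pr: "(p, \<rho>) \<in> \<Gamma> j"
    show "circ p \<rho> (\<lambda>z. a * f z + b * g z) = a * circ p \<rho> f + b * circ p \<rho> g"
      using assms[THEN continuous_on_subset, OF sphere_subset[OF pr]] radius_nonneg[OF pr]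
      by (intro circ_linear)
  qed
  then show ?thesis by (simp add: oint_eq_sum_circ case_prod_unfold sum.distrib sum_distrib_left)
qed

lemma oint_swap:
  assumes cont: "continuous_on (T j \<times> T k) (\<lambda>(z, y). f z y)"
  shows "oint (\<Gamma> j) (\<lambda>z. oint (\<Gamma> k) (f z)) = oint (\<Gamma> k) (\<lambda>y. oint (\<Gamma> j) (\<lambda>z. f z y))"
proof -
  have c: "continuous_on (sphere p \<rho> \<times> sphere p' \<rho>') (\<lambda>(z, y). f z y)"
    if "(p, \<rho>) \<in> \<Gamma> j" "(p', \<rho>') \<in> \<Gamma> k" for p \<rho> p' \<rho>'
    using cont by (rule continuous_on_subset) (use sphere_subset that in fast)
  have "oint (\<Gamma> j) (\<lambda>z. oint (\<Gamma> k) (f z)) =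
      (\<Sum>(p, \<rho>)\<in>\<Gamma> j. \<Sum>(p', \<rho>')\<in>\<Gamma> k. circ p \<rho> (\<lambda>z. circ p' \<rho>' (f z)))"
    unfolding oint_eq_sum_circ case_prod_unfold
    using radius_nonneg
    by (intro sum.cong refl circ_sum_linear continuous_on_circ continuous_on_subset[OF c])
       (auto simp: case_prod_unfold)
  also have "\<dots> = (\<Sum>(p, \<rho>)\<in>\<Gamma> j. \<Sum>(p', \<rho>')\<in>\<Gamma> k. circ p' \<rho>' (\<lambda>y. circ p \<rho> (\<lambda>z. f z y)))"
    unfolding case_prod_unfold using radius_nonneg c
    by (intro sum.cong refl circ_swap) auto
  also have "\<dots> = (\<Sum>(p', \<rho>')\<in>\<Gamma> k. \<Sum>(p, \<rho>)\<in>\<Gamma> j. circ p' \<rho>' (\<lambda>y. circ p \<rho> (\<lambda>z. f z y)))"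
    unfolding case_prod_unfold by (rule sum.swap)
  also have "\<dots> = oint (\<Gamma> k) (\<lambda>y. oint (\<Gamma> j) (\<lambda>z. f z y))"
    unfolding oint_eq_sum_circ case_prod_unfold
  proof (intro sum.cong refl circ_sum_linear[symmetric])
    fix a assume a: "a \<in> \<Gamma> k"
    show "0 \<le> snd a" using a radius_nonneg[of "fst a" "snd a"] by simp
    fix b assume b: "b \<in> \<Gamma> j"
    note ab = a b
    have "continuous_on (sphere (fst a) (snd a) \<times> sphere (fst b) (snd b)) (\<lambda>x. f (snd x) (fst x))"
      by (rule continuous_on_compose2[OF c[of "fst b" "snd b" "fst a" "snd a"], where f="\<lambda>x. (snd x, fst x)", simplified])
         (use ab in \<open>auto intro!: continuous_intros\<close>)
    then show "continuous_on (sphere (fst a) (snd a)) (\<lambda>y. circ (fst b) (snd b) (\<lambda>z. f z y))"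
      using ab radius_nonneg[of "fst b" "snd b"] by (intro continuous_on_circ) (auto simp: case_prod_unfold)
  qed
  finally show ?thesis .
qed

lemma continuous_on_oint:
  assumes "continuous_on (torus T J) F"
  shows "continuous_on (torus T (J - {j})) (\<lambda>w. oint (\<Gamma> j) (\<lambda>z. F (w(j := z))))"
  unfolding oint_eq_sum_circ case_prod_unfold
proof (intro continuous_intros continuous_on_circ)
  fix a assume a: "a \<in> \<Gamma> j"
  then show "0 \<le> snd a" using radius_nonneg[of "fst a" "snd a"] by simp
  show "continuous_on (torus T (J - {j}) \<times> sphere (fst a) (snd a)) (\<lambda>(w, z). F (w(j := z)))"
    unfolding case_prod_unfold
  proof (rule continuous_on_compose2[OF assms])
    show "(\<lambda>x. (fst x)(j := snd x)) ` (torus T (J - {j}) \<times> sphere (fst a) (snd a)) \<subseteq> torus T J"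
      using sphere_subset[of "fst a" "snd a" j] a by (auto intro!: torus_upd)
    show "continuous_on (torus T (J - {j}) \<times> sphere (fst a) (snd a)) (\<lambda>x. (fst x)(j := snd x))"
    proof (rule continuous_on_coordinatewise_then_product)
      fix i
      show "continuous_on (torus T (J - {j}) \<times> sphere (fst a) (snd a)) (\<lambda>x. ((fst x)(j := snd x)) i)"
        using continuous_on_product_then_coordinatewise[OF continuous_on_fst[OF continuous_on_id]]
        by (cases "i = j") (simp_all add: continuous_on_snd continuous_on_id)
    qed
  qed
qed

lemma continuous_on_iterated:
  "continuous_on (torus T J) F \<Longrightarrow> continuous_on (torus T (J - set js)) (\<lambda>w. iterated_oint \<Gamma> js F w)"
proof (induction js)
  case (Cons j js)
  have "J - set (j # js) = J - set js - {j}" by auto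
  then show ?case using continuous_on_oint[OF Cons.IH[OF Cons.prems], of j] by (simp del: fun_upd_apply)
qed simp

lemma continuous_on_upd:
  assumes "continuous_on (torus T J) F" "w \<in> torus T (J - {j})"
  shows "continuous_on (T j) (\<lambda>z. F (w(j := z)))"
proof (rule continuous_on_compose2[OF assms(1)])
  show "continuous_on (T j) (\<lambda>z. w(j := z))"
  proof (rule continuous_on_coordinatewise_then_product)
    fix i show "continuous_on (T j) (\<lambda>z. (w(j := z)) i)" by (cases "i = j") (auto intro!: continuous_intros)
  qed
qed (use assms(2) in \<open>auto intro!: torus_upd\<close>)

lemma continuous_on_upd2:
  assumes "continuous_on (torus T J) F" "w \<in> torus T (J - {j, k})" "j \<noteq> k"
  shows "continuous_on (T j \<times> T k) (\<lambda>(z, y). F (w(j := z, k := y)))"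
  unfolding case_prod_unfold
proof (rule continuous_on_compose2[OF assms(1)])
  show "continuous_on (T j \<times> T k) (\<lambda>x. w(j := fst x, k := snd x))"
  proof (rule continuous_on_coordinatewise_then_product)
    fix i show "continuous_on (T j \<times> T k) (\<lambda>x. (w(j := fst x, k := snd x)) i)"
      by (cases "i = j"; cases "i = k") (auto intro!: continuous_intros)
  qed
  show "(\<lambda>x. w(j := fst x, k := snd x)) ` (T j \<times> T k) \<subseteq> torus T J"
    using assms(2) by (auto simp: torus_def)
qed

lemma iterated_cong:
  assumes "\<And>w. w \<in> torus T J \<Longrightarrow> F w = G w"
  shows "w \<in> torus T (J - set js) \<Longrightarrow> iterated_oint \<Gamma> js F w = iterated_oint \<Gamma> js G w"
proof (induction js arbitrary: w)
  case (Cons j js)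
  have "J - set (j # js) = J - set js - {j}" by auto
  with Cons show ?case by (auto intro!: oint_cong torus_upd)
qed (use assms in simp)

lemma iterated_linear:
  assumes "continuous_on (torus T J) F" "continuous_on (torus T J) G"
  shows "w \<in> torus T (J - set js) \<Longrightarrow> iterated_oint \<Gamma> js (\<lambda>w. a * F w + b * G w) w =
    a * iterated_oint \<Gamma> js F w + b * iterated_oint \<Gamma> js G w"
proof (induction js arbitrary: w)
  case (Cons j js)
  have J: "J - set (j # js) = J - set js - {j}" by auto
  have "oint (\<Gamma> j) (\<lambda>z. iterated_oint \<Gamma> js (\<lambda>w. a * F w + b * G w) (w(j := z))) =
      oint (\<Gamma> j) (\<lambda>z. a * iterated_oint \<Gamma> js F (w(j := z)) + b * iterated_oint \<Gamma> js G (w(j := z)))"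
    using Cons J by (intro oint_cong Cons.IH torus_upd) auto
  also have "\<dots> = a * oint (\<Gamma> j) (\<lambda>z. iterated_oint \<Gamma> js F (w(j := z))) +
      b * oint (\<Gamma> j) (\<lambda>z. iterated_oint \<Gamma> js G (w(j := z)))"
    
  proof (rule oint_linear)
    show "continuous_on (T j) (\<lambda>z. iterated_oint \<Gamma> js F (w(j := z)))"
      by (rule continuous_on_upd[OF continuous_on_iterated[OF assms(1)]]) (use Cons.prems J in simp)
    show "continuous_on (T j) (\<lambda>z. iterated_oint \<Gamma> js G (w(j := z)))"
      by (rule continuous_on_upd[OF continuous_on_iterated[OF assms(2)]]) (use Cons.prems J in simp)
  qed
  finally show ?case by (simp only: iterated_oint.simps)
qed simp

text \<open>Fubini: the outermost variable becomes the innermost one. It is the means to apply residue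
  calculus in any chosen variable, for fixed values of the others, without knowing how the
  integrals over the remaining variables depend on it.\<close>

lemma iterated_rotate:
  assumes "continuous_on (torus T J) F" "j \<notin> set js"
  shows "w \<in> torus T (J - set (j # js)) \<Longrightarrow> iterated_oint \<Gamma> (j # js) F w =
    iterated_oint \<Gamma> js (\<lambda>w. oint (\<Gamma> j) (\<lambda>z. F (w(j := z)))) w"
  using assms(2)
proof (induction js arbitrary: w)
  case (Cons k js)
  have jk: "j \<noteq> k" using Cons.prems by auto
  have J: "J - set (j # k # js) = J - set js - {j, k}" by auto
  have "iterated_oint \<Gamma> (j # k # js) F w =
     oint (\<Gamma> j) (\<lambda>z. oint (\<Gamma> k) (\<lambda>y. iterated_oint \<Gamma> js F (w(j := z, k := y))))"
    by simp
  also have "\<dots> = oint (\<Gamma> k) (\<lambda>y. oint (\<Gamma> j) (\<lambda>z. iterated_oint \<Gamma> js F (w(j := z, k := y))))"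
    by (rule oint_swap, rule continuous_on_upd2[OF continuous_on_iterated[OF assms(1)]])
       (use Cons.prems(1) J jk in simp_all)
  also have "\<dots> = oint (\<Gamma> k) (\<lambda>y. iterated_oint \<Gamma> (j # js) F (w(k := y)))"
    using jk by (simp add: fun_upd_twist)
  also have "\<dots> = oint (\<Gamma> k) (\<lambda>y. iterated_oint \<Gamma> js (\<lambda>w. oint (\<Gamma> j) (\<lambda>z. F (w(j := z)))) (w(k := y)))"
    using Cons.prems by (intro oint_cong Cons.IH) (auto simp: torus_def)
  finally show ?case by (simp only: iterated_oint.simps)
qed simp

lemma iterated_zero_coord:
  assumes "continuous_on (torus T J) F" "distinct js" "j \<in> set js"
    and "\<And>w. w \<in> torus T J \<Longrightarrow> oint (\<Gamma> j) (\<lambda>z. F (w(j := z))) = 0"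
    and "w \<in> torus T (J - set js)" "T j \<noteq> {}"
  shows "iterated_oint \<Gamma> js F w = 0"
proof -
  obtain as bs where js: "js = as @ j # bs" using assms(3) by (meson split_list)
  \<comment> \<open>the coordinate \<open>j\<close> of \<open>w\<close> is overwritten, so any point of \<open>T j\<close> may be put there\<close>
  have zero: "oint (\<Gamma> j) (\<lambda>z. F (w(j := z))) = 0" if "w \<in> torus T (J - {j})" for w
  proof -
    obtain y where "y \<in> T j" using assms(6) by auto
    from assms(4)[OF torus_upd[OF this that]] show ?thesis by simp
  qed
  have inner: "iterated_oint \<Gamma> (j # bs) F w = 0" if "w \<in> torus T (J - set (j # bs))" for w
  proof -
    have "iterated_oint \<Gamma> (j # bs) F w = iterated_oint \<Gamma> bs (\<lambda>w. oint (\<Gamma> j) (\<lambda>z. F (w(j := z)))) w"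
      using assms(2) js that by (intro iterated_rotate[OF assms(1)]) auto
    also have "\<dots> = iterated_oint \<Gamma> bs (\<lambda>w. 0) w"
      using that zero by (intro iterated_cong[where J="J - {j}"]) (auto simp: torus_def)
    finally show ?thesis by simp
  qed
  have "iterated_oint \<Gamma> js F w = iterated_oint \<Gamma> as (iterated_oint \<Gamma> (j # bs) F) w"
    unfolding js by (rule iterated_oint_append)
  also have "\<dots> = iterated_oint \<Gamma> as (\<lambda>w. 0) w"
    by (intro iterated_cong[where J="J - set (j # bs)"] inner)
       (use assms(5) js in \<open>auto simp: torus_def\<close>)
  finally show ?thesis by simp
qed

lemma iterated_zero_pair:
  assumes "continuous_on (torus T J) F" "distinct (as @ j # k # bs)"
    and "\<And>w. w \<in> torus T (J - {j, k}) \<Longrightarrow> oint (\<Gamma> j) (\<lambda>z. oint (\<Gamma> k) (\<lambda>y. F (w(j := z, k := y)))) = 0"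
    and "w \<in> torus T (J - set (as @ j # k # bs))"
  shows "iterated_oint \<Gamma> (as @ j # k # bs) F w = 0"
proof -
  have jk: "j \<noteq> k" using assms(2) by auto
  have inner: "iterated_oint \<Gamma> (j # k # bs) F w = 0" if w: "w \<in> torus T (J - set (j # k # bs))" for w
  proof -
    have "iterated_oint \<Gamma> (j # k # bs) F w = iterated_oint \<Gamma> (k # bs) (\<lambda>w. oint (\<Gamma> j) (\<lambda>z. F (w(j := z)))) w"
      using assms(2) that by (intro iterated_rotate[OF assms(1)]) auto
    also have "\<dots> = iterated_oint \<Gamma> bs (\<lambda>w. oint (\<Gamma> k) (\<lambda>y. oint (\<Gamma> j) (\<lambda>z. F (w(k := y, j := z))))) w"
      by (intro iterated_rotate[OF continuous_on_oint[OF assms(1)]]) (use assms(2) that in \<open>auto simp: torus_def\<close>)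
    also have "\<dots> = iterated_oint \<Gamma> bs (\<lambda>w. 0) w"
    proof (intro iterated_cong[where J="J - {j, k}"])
      fix w assume w: "w \<in> torus T (J - {j, k})"
      have "oint (\<Gamma> k) (\<lambda>y. oint (\<Gamma> j) (\<lambda>z. F (w(k := y, j := z)))) =
          oint (\<Gamma> k) (\<lambda>y. oint (\<Gamma> j) (\<lambda>z. F (w(j := z, k := y))))"
        using jk by (simp add: fun_upd_twist)
      also have "\<dots> = oint (\<Gamma> j) (\<lambda>z. oint (\<Gamma> k) (\<lambda>y. F (w(j := z, k := y))))"
        by (intro oint_swap[symmetric] continuous_on_upd2[OF assms(1) w jk])
      finally show "oint (\<Gamma> k) (\<lambda>y. oint (\<Gamma> j) (\<lambda>z. F (w(k := y, j := z)))) = 0"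
        using assms(3)[OF w] by simp
    qed (use w in \<open>auto simp: torus_def\<close>)
    finally show ?thesis by simp
  qed
  have "iterated_oint \<Gamma> (as @ j # k # bs) F w = iterated_oint \<Gamma> as (iterated_oint \<Gamma> (j # k # bs) F) w"
    by (rule iterated_oint_append)
  also have "\<dots> = iterated_oint \<Gamma> as (\<lambda>w. 0) w"
    by (intro iterated_cong[where J="J - set (j # k # bs)"] inner)
       (use assms(4) in \<open>auto simp: torus_def\<close>)
  finally show ?thesis by simp
qed

lemma iterated_cmult:
  assumes "continuous_on (torus T J) F" "w \<in> torus T (J - set js)"
  shows "iterated_oint \<Gamma> js (\<lambda>w. a * F w) w = a * iterated_oint \<Gamma> js F w"
  using iterated_linear[OF assms(1) assms(1) assms(2), of a 0] by simp

lemma iterated_sum_eq_0: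
  assumes "finite A" "\<And>i. i \<in> A \<Longrightarrow> continuous_on (torus T J) (F i)"
    and "\<And>i. i \<in> A \<Longrightarrow> iterated_oint \<Gamma> js (F i) w = 0" "w \<in> torus T (J - set js)"
  shows "iterated_oint \<Gamma> js (\<lambda>w. \<Sum>i\<in>A. F i w) w = 0"
  using assms(1-3)
proof (induction A rule: finite_induct)
  case (insert i A)
  have "iterated_oint \<Gamma> js (\<lambda>w. 1 * F i w + 1 * (\<Sum>i\<in>A. F i w)) w =
      1 * iterated_oint \<Gamma> js (F i) w + 1 * iterated_oint \<Gamma> js (\<lambda>w. \<Sum>i\<in>A. F i w) w"
    by (rule iterated_linear[OF _ _ assms(4)]) (use insert in \<open>auto intro!: continuous_intros\<close>)
  with insert show ?case by simp
qed simp

end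

text \<open>The contours are exchanged one variable at a time, each being rotated to the innermost place for
  the purpose; the intermediate families are mixtures of the two.\<close>

lemma iterated_oint_deform:
  assumes \<Gamma>: "contour_family \<Gamma> T" and \<Gamma>': "contour_family \<Gamma>' T"
    and F: "continuous_on (torus T J) F"
    and eq: "\<And>j w. j \<in> set js \<Longrightarrow> w \<in> torus T (J - {j}) \<Longrightarrow>
      oint (\<Gamma> j) (\<lambda>z. F (w(j := z))) = oint (\<Gamma>' j) (\<lambda>z. F (w(j := z)))"
  shows "distinct js \<Longrightarrow> w \<in> torus T (J - set js) \<Longrightarrow> iterated_oint \<Gamma> js F w = iterated_oint \<Gamma>' js F w"
  using eq
proof (induction js arbitrary: w)
  case (Cons j js)
  have M: "contour_family (\<Gamma>(j := \<Gamma>' j)) T"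
  proof
    fix i p \<rho>
    show "finite ((\<Gamma>(j := \<Gamma>' j)) i)"
      using contour_family.finite_circles[OF \<Gamma>] contour_family.finite_circles[OF \<Gamma>'] by simp
    assume "(p, \<rho>) \<in> (\<Gamma>(j := \<Gamma>' j)) i"
    then have "(p, \<rho>) \<in> \<Gamma> i \<or> (p, \<rho>) \<in> \<Gamma>' i" by (auto split: if_splits)
    then show "0 \<le> \<rho>" "sphere p \<rho> \<subseteq> T i"
      using contour_family.radius_nonneg[OF \<Gamma>] contour_family.radius_nonneg[OF \<Gamma>']
        contour_family.sphere_subset[OF \<Gamma>] contour_family.sphere_subset[OF \<Gamma>'] by blast+
  qed
  have j: "j \<notin> set js" using Cons.prems by simp
  have J: "J - set (j # js) = J - set js - {j}" "J - set (j # js) = J - {j} - set js" by auto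
  have "iterated_oint \<Gamma> (j # js) F w = iterated_oint \<Gamma> js (\<lambda>w. oint (\<Gamma> j) (\<lambda>z. F (w(j := z)))) w"
    by (rule contour_family.iterated_rotate[OF \<Gamma> F j Cons.prems(2)])
  also have "\<dots> = iterated_oint \<Gamma> js (\<lambda>w. oint (\<Gamma>' j) (\<lambda>z. F (w(j := z)))) w"
  proof (rule contour_family.iterated_cong[OF \<Gamma>])
    show "oint (\<Gamma> j) (\<lambda>z. F (w(j := z))) = oint (\<Gamma>' j) (\<lambda>z. F (w(j := z)))"
      if "w \<in> torus T (J - {j})" for w
      using _ that by (rule Cons.prems(3)) simp
    show "w \<in> torus T (J - {j} - set js)" using Cons.prems(2) by (simp only: J(2))
  qed
  also have "\<dots> = iterated_oint (\<Gamma>(j := \<Gamma>' j)) js (\<lambda>w. oint ((\<Gamma>(j := \<Gamma>' j)) j) (\<lambda>z. F (w(j := z)))) w"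
    by (simp add: iterated_oint_upd_family[OF j])
  also have "\<dots> = iterated_oint (\<Gamma>(j := \<Gamma>' j)) (j # js) F w"
    by (rule contour_family.iterated_rotate[OF M F j Cons.prems(2), symmetric])
  also have "\<dots> = oint (\<Gamma>' j) (\<lambda>z. iterated_oint \<Gamma> js F (w(j := z)))"
    by (simp add: iterated_oint_upd_family[OF j])
  also have "\<dots> = oint (\<Gamma>' j) (\<lambda>z. iterated_oint \<Gamma>' js F (w(j := z)))"
  proof (rule contour_family.oint_cong[OF \<Gamma>'], rule Cons.IH)
    fix z assume "z \<in> T j"
    then show "w(j := z) \<in> torus T (J - set js)"
      using Cons.prems(2) unfolding J(1) by (rule torus_upd)
  next
    fix k v assume "k \<in> set js" "v \<in> torus T (J - {k})"
    then show "oint (\<Gamma> k) (\<lambda>z. F (v(k := z))) = oint (\<Gamma>' k) (\<lambda>z. F (v(k := z)))"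
      by (intro Cons.prems(3)) simp
  qed (use Cons.prems(1) in simp)
  finally show ?case by (simp only: iterated_oint.simps)
qed simp

section \<open>Residues on circles\<close>

text \<open>The integrands below are rational in each variable, so this form of the residue theorem, with a
  finite set that contains all poles, suffices. The set may contain removable singularities.\<close>

lemma circ_residues:
  assumes "finite Z" "f holomorphic_on - Z" "0 < \<rho>" "sphere p \<rho> \<inter> Z = {}"
  shows "circ p \<rho> f = (\<Sum>z\<in>Z \<inter> ball p \<rho>. residue f z)"
proof -
  have wn: "winding_number (circlepath p \<rho>) z = (if z \<in> ball p \<rho> then 1 else 0)" if "z \<in> Z" for z
  proof (cases "z \<in> ball p \<rho>")
    case True
    then show ?thesis by (simp add: winding_number_circlepath dist_norm norm_minus_commute)
  next
    case False
    then have "z \<notin> cball p \<rho>" using assms(4) that by (auto simp: less_eq_real_def)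
    then have "winding_number (circlepath p \<rho>) z = 0"
      using assms(3) by (intro winding_number_zero_outside[where s="cball p \<rho>"]) auto
    with False show ?thesis by simp
  qed
  have "contour_integral (circlepath p \<rho>) f =
      2 * pi * \<i> * (\<Sum>z\<in>Z. winding_number (circlepath p \<rho>) z * residue f z)"
    by (rule Residue_theorem[where S=UNIV]) (use assms in \<open>auto simp: Compl_eq_Diff_UNIV\<close>)
  also have "(\<Sum>z\<in>Z. winding_number (circlepath p \<rho>) z * residue f z) = (\<Sum>z\<in>Z \<inter> ball p \<rho>. residue f z)"
    using assms(1) by (subst sum.inter_restrict) (auto intro!: sum.cong simp: wn)
  finally show ?thesis by (simp add: circ_def)
qed

lemma circ_eq_0:
  assumes "finite Z" "f holomorphic_on - Z" "0 < \<rho>" "cball p \<rho> \<inter> Z = {}"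
  shows "circ p \<rho> f = 0"
proof -
  have "sphere p \<rho> \<inter> Z = {}" "Z \<inter> ball p \<rho> = {}"
    using assms(4) sphere_cball[of p \<rho>] ball_subset_cball[of p \<rho>] by blast+
  then show ?thesis by (simp add: circ_residues[OF assms(1-3)])
qed

lemma tendsto_moebius_at_infinity:
  fixes a b c d :: complex
  assumes "d \<noteq> 0"
  shows "((\<lambda>z. (a + b * z) / (c + d * z)) \<longlongrightarrow> b / d) at_infinity"
proof -
  have "((\<lambda>z. (a * inverse z + b) / (c * inverse z + d)) \<longlongrightarrow> (a * 0 + b) / (c * 0 + d)) at_infinity"
    using assms by (intro tendsto_intros tendsto_inverse_0) auto
  moreover have "\<forall>\<^sub>F z in at_infinity. (a * inverse z + b) / (c * inverse z + d) = (a + b * z) / (c + d * z)"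
  proof -
    have "\<forall>\<^sub>F z :: complex in at_infinity. z \<noteq> 0"
      by (auto simp: eventually_at_infinity intro!: exI[of _ 1])
    then show ?thesis
    proof (rule eventually_mono)
      fix z :: complex assume z: "z \<noteq> 0"
      then have "(a * inverse z + b) / (c * inverse z + d) = ((a * inverse z + b) * z) / ((c * inverse z + d) * z)"
        by (metis mult_divide_mult_cancel_right)
      then show "(a * inverse z + b) / (c * inverse z + d) = (a + b * z) / (c + d * z)"
        using z by (simp add: distrib_right mult.assoc)
    qed
  qed
  ultimately show ?thesis by (simp add: tendsto_cong)
qed

text \<open>Integrate over a circle around all poles and let its radius tend to infinity.\<close>

lemma sum_residues_eq_0:
  assumes "finite Z" "f holomorphic_on - Z" "((\<lambda>z. z * f z) \<longlongrightarrow> 0) at_infinity"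
  shows "(\<Sum>z\<in>Z. residue f z) = 0"
proof (rule ccontr)
  let ?S = "\<Sum>z\<in>Z. residue f z"
  assume "?S \<noteq> 0"
  then have e: "0 < cmod ?S / 2" by simp
  obtain B where B: "\<And>z. B \<le> cmod z \<Longrightarrow> cmod (z * f z) < cmod ?S / 2"
    using tendstoD[OF assms(3) e] by (auto simp: eventually_at_infinity)
  \<comment> \<open>beyond all poles and in the region where \<open>z f(z)\<close> is small\<close>
  define R where "R = Max (insert (max B 1) (cmod ` Z)) + 1"
  have RZ: "cmod z < R" if "z \<in> Z" for z
  proof -
    have "cmod z \<le> Max (insert (max B 1) (cmod ` Z))" using that assms(1) by (intro Max_ge) auto
    then show ?thesis by (simp add: R_def)
  qed
  have RB: "max B 1 < R" using assms(1) Max_ge[of "insert (max B 1) (cmod ` Z)" "max B 1"] by (simp add: R_def)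
  have sph: "sphere 0 R \<inter> Z = {}" using RZ by fastforce
  have "Z \<inter> ball 0 R = Z" using RZ by auto
  then have S: "circ 0 R f = ?S" using circ_residues[OF assms(1,2) _ sph] RB by simp
  have "f contour_integrable_on circlepath 0 R"
    using RB sph by (intro contour_integrable_continuous_circlepath
        continuous_on_subset[OF holomorphic_on_imp_continuous_on[OF assms(2)]]) auto
  then have "cmod (contour_integral (circlepath 0 R) f) \<le> (cmod ?S / 2 / R) * (2 * pi * R)"
  proof (intro has_contour_integral_bound_circlepath[OF has_contour_integral_integral])
    fix z assume "cmod (z - 0) = R"
    then show "cmod (f z) \<le> cmod ?S / 2 / R"
      using B[of z] RB by (simp add: norm_mult field_simps)
  qed (use RB in auto)
  then have "cmod (contour_integral (circlepath 0 R) f) \<le> cmod ?S * pi" using RB by simp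
  then have "cmod (circ 0 R f) \<le> cmod ?S / 2" by (simp add: circ_def norm_divide norm_mult field_simps)
  then show False unfolding S using e by simp
qed

section \<open>The kernel of the moment formula\<close>

definition qkernel :: "real \<Rightarrow> complex \<Rightarrow> complex \<Rightarrow> complex" where
  "qkernel q a b = (a - b) / (a - of_real q * b)"

text \<open>Index sets other than \<open>{1..l}\<close> arise when variables are integrated out or singled out.\<close>

definition qkernel_prod :: "real \<Rightarrow> nat set \<Rightarrow> (nat \<Rightarrow> complex) \<Rightarrow> complex" where
  "qkernel_prod q S w = (\<Prod>(\<alpha>, \<beta>)\<in>{(\<alpha>, \<beta>). \<alpha> \<in> S \<and> \<beta> \<in> S \<and> \<alpha> < \<beta>}. qkernel q (w \<alpha>) (w \<beta>))"

lemma finite_pairs: "finite S \<Longrightarrow> finite {(\<alpha>, \<beta>). \<alpha> \<in> S \<and> \<beta> \<in> S \<and> \<alpha> < (\<beta>::nat)}"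
  by (rule finite_subset[of _ "S \<times> S"]) auto

lemma qkernel_prod_atLeastAtMost:
  "qkernel_prod q {1..l} w = (\<Prod>\<beta>=1..l. \<Prod>\<alpha>=1..<\<beta>. qkernel q (w \<alpha>) (w \<beta>))"
proof -
  have "(\<Prod>\<beta>=1..l. \<Prod>\<alpha>=1..<\<beta>. qkernel q (w \<alpha>) (w \<beta>)) =
     (\<Prod>(\<beta>, \<alpha>)\<in>Sigma {1..l} (\<lambda>\<beta>. {1..<\<beta>}). qkernel q (w \<alpha>) (w \<beta>))"
    by (rule prod.Sigma) auto
  also have "\<dots> = qkernel_prod q {1..l} w"
    unfolding qkernel_prod_def
    by (rule prod.reindex_bij_witness[of _ prod.swap prod.swap]) auto
  finally show ?thesis ..
qed

lemma qkernel_prod_cong: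
  "(\<And>i. i \<in> S \<Longrightarrow> w i = w' i) \<Longrightarrow> qkernel_prod q S w = qkernel_prod q S w'"
  unfolding qkernel_prod_def by (rule prod.cong) auto

text \<open>It isolates the dependence of the kernel on a single variable.\<close>

lemma qkernel_prod_remove:
  assumes "finite S" "i \<in> S"
  shows "qkernel_prod q S w = qkernel_prod q (S - {i}) w *
    ((\<Prod>\<alpha>\<in>{\<alpha>\<in>S. \<alpha> < i}. qkernel q (w \<alpha>) (w i)) * (\<Prod>\<beta>\<in>{\<beta>\<in>S. i < \<beta>}. qkernel q (w i) (w \<beta>)))"
proof -
  let ?f = "\<lambda>(\<alpha>, \<beta>). qkernel q (w \<alpha>) (w \<beta>)"
  let ?A = "{(\<alpha>, \<beta>). \<alpha> \<in> S - {i} \<and> \<beta> \<in> S - {i} \<and> \<alpha> < \<beta>}"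
  let ?B = "(\<lambda>\<alpha>. (\<alpha>, i)) ` {\<alpha>\<in>S. \<alpha> < i}"
  let ?C = "(\<lambda>\<beta>. (i, \<beta>)) ` {\<beta>\<in>S. i < \<beta>}"
  have eq: "{(\<alpha>, \<beta>). \<alpha> \<in> S \<and> \<beta> \<in> S \<and> \<alpha> < \<beta>} = ?A \<union> (?B \<union> ?C)"
    using assms(2) by auto
  have "qkernel_prod q S w = prod ?f ?A * (prod ?f ?B * prod ?f ?C)"
  proof -
    have "finite ?A" "finite ?B" "finite ?C" "?A \<inter> (?B \<union> ?C) = {}" "?B \<inter> ?C = {}"
      using assms(1) finite_pairs[of "S - {i}"] by auto
    then show ?thesis unfolding qkernel_prod_def eq by (simp only: prod.union_disjoint finite_Un)
  qed
  moreover have "prod ?f ?B = (\<Prod>\<alpha>\<in>{\<alpha>\<in>S. \<alpha> < i}. qkernel q (w \<alpha>) (w i))"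
    by (subst prod.reindex) (auto simp: inj_on_def)
  moreover have "prod ?f ?C = (\<Prod>\<beta>\<in>{\<beta>\<in>S. i < \<beta>}. qkernel q (w i) (w \<beta>))"
    by (subst prod.reindex) (auto simp: inj_on_def)
  ultimately show ?thesis by (simp add: qkernel_prod_def)
qed

section \<open>Geometry of the contours\<close>

locale moment_contours =
  fixes q s :: real and n l :: nat and u :: "nat \<Rightarrow> real" and \<rho> :: "complex \<Rightarrow> real" and c r :: real
  assumes q: "0 < q" "q < 1" and s: "s < 0"
    and u_pos: "\<And>i. i \<in> {1..n} \<Longrightarrow> 0 < u i"
    and admissible: "admissible_contours q s n u l \<rho> c r"
begin

abbreviation "P \<equiv> inverse_points n u"
text \<open>The part of the plane enclosed by the circles around the points \<open>1 / u\<^sub>j\<close>. Admissibility makes it disjoint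
  from \<open>q H\<close> and from the largest disc at the origin.\<close>

definition "H = (\<Union>p\<in>P. cball p (\<rho> p))"
definition "radius0 j = r ^ j * c"

lemma finite_P: "finite P"
  by (simp add: inverse_points_def)

lemma radius_pos: "p \<in> P \<Longrightarrow> 0 < \<rho> p"
  using admissible by (simp add: admissible_contours_def)

lemma P_subset_H: "P \<subseteq> H"
  using radius_pos by (force simp: H_def)

lemma cball_disjoint: "p \<in> P \<Longrightarrow> p' \<in> P \<Longrightarrow> p \<noteq> p' \<Longrightarrow> cball p (\<rho> p) \<inter> cball p' (\<rho> p') = {}"
proof -
  assume *: "p \<in> P" "p' \<in> P" "p \<noteq> p'"
  have "pairwise (\<lambda>p p'. disjnt (cball p (\<rho> p)) (cball p' (\<rho> p'))) P"
    using admissible unfolding admissible_contours_def by (elim conjE)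
  from pairwiseD[OF this *] show ?thesis by (simp add: disjnt_def)
qed

lemma hull_eq: "circles_hull (u_contour n u \<rho>) = H"
  by (auto simp: circles_hull_def u_contour_def H_def)

lemma image_eq: "circles_image (u_contour n u \<rho>) = (\<Union>p\<in>P. sphere p (\<rho> p))"
  by (auto simp: circles_image_def u_contour_def)

lemma image_dilate_eq:
  "circles_image (dilate R (u_contour n u \<rho>)) = (\<Union>p\<in>P. sphere (of_real R * p) (R * \<rho> p))"
  by (auto simp: circles_image_def u_contour_def dilate_def)

lemma zero_hull_eq: "circles_hull (dilate (r ^ l) {(0, c)}) = cball 0 (radius0 l)"
  by (auto simp: circles_hull_def dilate_def radius0_def)

lemmas adm = admissible[unfolded admissible_contours_def hull_eq image_eq image_dilate_eq zero_hull_eq]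

lemma cball_disjoint_q_sphere:
  assumes "p \<in> P" "p' \<in> P"
  shows "cball p (\<rho> p) \<inter> sphere (of_real q * p') (q * \<rho> p') = {}"
proof -
  have "disjnt H (\<Union>p\<in>P. sphere (of_real q * p) (q * \<rho> p))" using adm by (elim conjE)
  then show ?thesis using assms unfolding H_def disjnt_iff by blast
qed

lemma cball_disjoint_inverse_q_sphere:
  assumes "p \<in> P" "p' \<in> P"
  shows "cball p (\<rho> p) \<inter> sphere (of_real (inverse q) * p') (inverse q * \<rho> p') = {}"
proof -
  have "disjnt H (\<Union>p\<in>P. sphere (of_real (inverse q) * p) (inverse q * \<rho> p))" using adm by (elim conjE)
  then show ?thesis using assms unfolding H_def disjnt_iff by blast
qed

lemma cball_scale: "0 < R \<Longrightarrow> (z::complex) \<in> cball p x \<longleftrightarrow> of_real R * z \<in> cball (of_real R * p) (R * x)"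
proof -
  assume R: "0 < R"
  have "dist (of_real R * p) (of_real R * z) = R * dist p z"
    using R by (simp add: dist_norm norm_mult flip: right_diff_distrib)
  then show ?thesis using R by simp
qed

lemma sphere_scale: "0 < R \<Longrightarrow> (z::complex) \<in> sphere p x \<longleftrightarrow> of_real R * z \<in> sphere (of_real R * p) (R * x)"
proof -
  assume R: "0 < R"
  have "dist (of_real R * p) (of_real R * z) = R * dist p z"
    using R by (simp add: dist_norm norm_mult flip: right_diff_distrib)
  then show ?thesis using R by simp
qed

text \<open>A connected set that meets a disc but not its boundary lies inside the disc.\<close>

lemma cball_subset_of_disjoint_sphere:
  fixes a b :: complex
  assumes "cball a x \<inter> sphere b y = {}" "z \<in> cball a x" "z \<in> cball b y"
  shows "cball a x \<subseteq> cball b y"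
proof (rule ccontr)
  assume "\<not> ?thesis"
  then have "cball a x \<inter> frontier (cball b y) \<noteq> {}"
    using assms by (intro connected_Int_frontier) auto
  then show False using assms(1) by (simp add: frontier_cball)
qed

text \<open>Suppose that a disc \<open>B\<close> of \<open>H\<close> meets a disc \<open>A\<close> of \<open>q H\<close>. Admissibility says that \<open>B\<close> avoids the
  boundary of \<open>A\<close>, and, after scaling, that \<open>A\<close> avoids the boundary of \<open>B\<close>. By connectedness each
  of them contains the other, which is absurd.\<close>

lemma q_mult_notin_H: "z \<in> H \<Longrightarrow> of_real q * z \<notin> H"
proof
  assume z: "z \<in> H" "of_real q * z \<in> H"
  then obtain p p' where p: "p \<in> P" "z \<in> cball p (\<rho> p)" "p' \<in> P" "of_real q * z \<in> cball p' (\<rho> p')"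
    unfolding H_def by blast
  let ?A = "cball (of_real q * p) (q * \<rho> p)" and ?B = "cball p' (\<rho> p')"
  have zA: "of_real q * z \<in> ?A" using p(2) cball_scale[OF q(1)] by blast
  have BA: "?B \<inter> sphere (of_real q * p) (q * \<rho> p) = {}"
    by (rule cball_disjoint_q_sphere[OF p(3,1)])
  have "cball p (\<rho> p) \<inter> sphere (of_real (inverse q) * p') (inverse q * \<rho> p') = {}"
    by (rule cball_disjoint_inverse_q_sphere[OF p(1,3)])
  moreover have "of_real (inverse q) * y \<in> cball p (\<rho> p)" if "y \<in> ?A" for y
    using that cball_scale[OF q(1), of "of_real (inverse q) * y" p "\<rho> p"] q by (simp add: mult.assoc[symmetric] flip: of_real_mult)
  moreover have "of_real (inverse q) * y \<in> sphere (of_real (inverse q) * p') (inverse q * \<rho> p')"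
    if "y \<in> sphere p' (\<rho> p')" for y
    using that sphere_scale[of "inverse q" y p' "\<rho> p'"] q by simp
  ultimately have AB: "?A \<inter> sphere p' (\<rho> p') = {}" by blast
  have "?B \<subseteq> ?A" "?A \<subseteq> ?B"
    using cball_subset_of_disjoint_sphere[OF BA p(4) zA] cball_subset_of_disjoint_sphere[OF AB zA p(4)] .
  moreover have "of_real q * p + of_real (q * \<rho> p) \<in> sphere (of_real q * p) (q * \<rho> p)"
    using q radius_pos[OF p(1)] by (simp add: dist_norm norm_mult)
  moreover have "sphere (of_real q * p) (q * \<rho> p) \<subseteq> ?A" by (rule sphere_cball)
  ultimately show False using BA by blast
qed

text \<open>The origin is fixed by the multiplication by \<open>q\<close>.\<close>

lemma zero_notin_H: "0 \<notin> H"
  using q_mult_notin_H[of 0] by auto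

lemma radius0_pos: "0 < radius0 j"
proof -
  have c: "0 < c" "inverse q < r" using adm by blast+
  then have "0 < r" using less_trans[OF positive_imp_inverse_positive[OF q(1)]] by blast
  with c show ?thesis by (simp add: radius0_def)
qed

lemma radius0_less: assumes "i < j" shows "radius0 i < q * radius0 j"
proof -
  have c: "0 < c" "inverse q < r" using adm by blast+
  then have r: "1 < q * r" using q by (simp add: field_simps)
  have r1: "1 < r" using c q less_trans[OF one_less_inverse[of q]] by simp
  have "radius0 i < q * r * radius0 i" using r radius0_pos[of i] by simp
  also have "\<dots> = q * radius0 (Suc i)" by (simp add: radius0_def)
  also have "\<dots> \<le> q * radius0 j"
    using power_increasing[of "Suc i" j r] assms r1 c q by (simp add: radius0_def)
  finally show ?thesis .
qed

lemma radius0_le: "j \<le> l \<Longrightarrow> radius0 j \<le> radius0 l"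
  using radius0_less[of j l] mult_right_mono[of q 1 "radius0 l"] q radius0_pos[of l] by (cases "j = l") (force, linarith)

text \<open>Admissibility only separates the circles around \<open>1 / u\<^sub>j\<close> from the disc at the origin. If their
  interior met that disc, it would contain the origin.\<close>

lemma H_outside: assumes "z \<in> H" shows "radius0 l < cmod z"
proof (rule ccontr)
  assume "\<not> ?thesis"
  then have z: "z \<in> cball 0 (radius0 l)" by simp
  obtain p where p: "p \<in> P" "z \<in> cball p (\<rho> p)" using assms by (auto simp: H_def)
  have "sphere p (\<rho> p) \<inter> cball 0 (radius0 l) = {}" using adm p(1) unfolding disjnt_def by blast
  then have "cball 0 (radius0 l) \<subseteq> cball p (\<rho> p)"
    using z p(2) by (intro cball_subset_of_disjoint_sphere) auto
  then have "0 \<in> cball p (\<rho> p)" using radius0_pos[of l] centre_in_cball[of 0 "radius0 l"] by (meson less_imp_le subsetD)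
  then show False using zero_notin_H p(1) unfolding H_def by blast
qed

lemma qH_outside: assumes "z \<in> H" shows "radius0 l < cmod (of_real q * z)"
proof (rule ccontr)
  assume "\<not> ?thesis"
  then have z: "of_real q * z \<in> cball 0 (radius0 l)" by simp
  obtain p where p: "p \<in> P" "z \<in> cball p (\<rho> p)" using assms by (auto simp: H_def)
  have "sphere (of_real q * p) (q * \<rho> p) \<inter> cball 0 (radius0 l) = {}" using adm p(1) unfolding disjnt_def by blast
  then have "cball 0 (radius0 l) \<subseteq> cball (of_real q * p) (q * \<rho> p)"
    using z p(2) cball_scale[OF q(1), of z] by (intro cball_subset_of_disjoint_sphere) auto
  then have "of_real q * 0 \<in> cball (of_real q * p) (q * \<rho> p)" using radius0_pos[of l] centre_in_cball[of 0 "radius0 l"] by (auto simp only: mult_zero_right intro: subsetD less_imp_le)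
  then have "0 \<in> cball p (\<rho> p)" using cball_scale[OF q(1), of 0] by blast
  then show False using zero_notin_H p(1) unfolding H_def by blast
qed

lemma s_outside: "of_real s \<notin> H" "radius0 l < cmod (of_real s)"
proof -
  have "of_real s \<notin> H" using adm by (elim conjE)
  moreover have "of_real s \<notin> cball (0 :: complex) (radius0 l)" using adm by (elim conjE)
  ultimately show "of_real s \<notin> H" "radius0 l < cmod (of_real s)" by auto
qed

text \<open>\<open>T j\<close> is a domain for the variable \<open>w\<^sub>j\<close>: it contains the circles around the \<open>1 / u\<^sub>j\<close> for all choices
  of radii that are used, and the integrand is continuous on the product of these sets.\<close>

definition "T j = (H - P) \<union> sphere 0 (radius0 j)"

lemma T_cases:
  assumes "z \<in> T j"
  obtains "z \<in> H" "z \<notin> P" | "cmod z = radius0 j"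
  using assms by (auto simp: T_def)

lemma T_nonzero: "z \<in> T j \<Longrightarrow> z \<noteq> 0"
  using zero_notin_H radius0_pos[of j] by (auto simp: T_def)

lemma T_notin_P: "j \<le> l \<Longrightarrow> z \<in> T j \<Longrightarrow> z \<notin> P"
proof
  assume *: "j \<le> l" "z \<in> T j" "z \<in> P"
  then have "radius0 l < cmod z" "cmod z = radius0 j" using H_outside[of z] P_subset_H by (auto simp: T_def)
  then show False using radius0_le[OF *(1)] by simp
qed

lemma T_not_s: "j \<le> l \<Longrightarrow> z \<in> T j \<Longrightarrow> z \<noteq> of_real s"
  using s_outside radius0_le[of j] by (auto simp: T_def)

text \<open>The possible poles \<open>w\<^sub>i / q\<close> in a later variable \<open>w\<^sub>j\<close>. If \<open>w\<^sub>i\<close> lies on its circle around the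
  origin, then the pole is inside the larger circle of \<open>w\<^sub>j\<close>, because the radii grow by more than a
  factor \<open>1/q\<close> from one variable to the next.\<close>

lemma div_q_T_cases:
  assumes "a \<in> T i" "i < j" "j \<le> l"
  shows "a / of_real q \<notin> H" "cmod (a / of_real q) < radius0 j \<or> a \<in> H \<and> radius0 l < cmod (a / of_real q)"
proof -
  have q': "of_real q * (a / of_real q) = a" using q by simp
  have n: "cmod (a / of_real q) = cmod a / q" using q by (simp add: norm_divide)
  show "a / of_real q \<notin> H" "cmod (a / of_real q) < radius0 j \<or> a \<in> H \<and> radius0 l < cmod (a / of_real q)"
    using assms(1)
  proof (atomize (full), cases rule: T_cases)
    case 1
    have "cmod a \<le> cmod a / q" using q mult_right_mono[of q 1 "cmod a"] by (simp add: field_simps)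
    then show "a / of_real q \<notin> H \<and> (cmod (a / of_real q) < radius0 j \<or> a \<in> H \<and> radius0 l < cmod (a / of_real q))"
      using q_mult_notin_H[of "a / of_real q"] H_outside[OF 1(1)] 1 n q' by auto
  next
    case 2
    then have "cmod (a / of_real q) < radius0 j" using radius0_less[OF assms(2)] q n by (simp add: pos_divide_less_eq mult.commute)
    then show "a / of_real q \<notin> H \<and> (cmod (a / of_real q) < radius0 j \<or> a \<in> H \<and> radius0 l < cmod (a / of_real q))"
      using H_outside[of "a / of_real q"] radius0_le[OF assms(3)] by auto
  qed
qed

text \<open>The possible poles \<open>q w\<^sub>j\<close> in an earlier variable \<open>w\<^sub>i\<close> lie outside its contour: the circle of \<open>w\<^sub>j\<close> around the
  origin still surrounds that of \<open>w\<^sub>i\<close> when it is shrunk by \<open>q\<close>.\<close>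

lemma mult_q_T_cases:
  assumes "b \<in> T j" "i < j" "j \<le> l"
  shows "of_real q * b \<notin> H" "radius0 i < cmod (of_real q * b)"
proof -
  have n: "cmod (of_real q * b) = q * cmod b" using q by (simp add: norm_mult)
  have il: "radius0 i \<le> radius0 l" using radius0_le[of i] assms by simp
  show "of_real q * b \<notin> H" "radius0 i < cmod (of_real q * b)"
    using assms(1)
  proof (atomize (full), cases rule: T_cases)
    case 1
    then show "of_real q * b \<notin> H \<and> radius0 i < cmod (of_real q * b)"
      using q_mult_notin_H[of b] qH_outside[of b] il by auto
  next
    case 2
    have "q * radius0 j \<le> radius0 l" using radius0_le[OF assms(3)] q radius0_pos[of j]
      by (smt (verit) mult_le_cancel_right1)
    then show "of_real q * b \<notin> H \<and> radius0 i < cmod (of_real q * b)"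
      using 2 n radius0_less[OF assms(2)] H_outside[of "of_real q * b"] by auto
  qed
qed

lemma qkernel_denominator_nonzero:
  assumes "a \<in> T i" "b \<in> T j" "i < j" "j \<le> l"
  shows "a - of_real q * b \<noteq> 0"
  using mult_q_T_cases[OF assms(2-4)] assms(1) by (auto simp: T_def)

lemma Int_ball_sphere:
  assumes "Z \<inter> cball p x = {p :: complex}" "0 < x"
  shows "Z \<inter> ball p x = {p}" "sphere p x \<inter> Z = {}"
proof -
  have eq: "z = p" if "z \<in> Z" "dist p z \<le> x" for z
  proof -
    have "z \<in> Z \<inter> cball p x" using that by simp
    then show ?thesis unfolding assms(1) by simp
  qed
  have p: "p \<in> Z" using assms(1) by blast
  show "Z \<inter> ball p x = {p}"
  proof (intro equalityI subsetI)
    fix z assume "z \<in> Z \<inter> ball p x" then show "z \<in> {p}" using eq[of z] by simp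
  qed (use p assms(2) in simp)
  show "sphere p x \<inter> Z = {}"
  proof (rule equals0I)
    fix z assume z: "z \<in> sphere p x \<inter> Z" then have "z = p" using eq[of z] by simp
    with z assms(2) show False by simp
  qed
qed

lemma torusD: "w \<in> torus T' J \<Longrightarrow> i \<in> J \<Longrightarrow> w i \<in> T' i"
  by (simp add: torus_def)

lemma T_subset: "j \<le> l \<Longrightarrow> T j \<subseteq> - ({0, of_real s} \<union> P)"
  using T_nonzero T_notin_P T_not_s by blast

section \<open>The integrand as a function of a single variable\<close>

text \<open>The radii around the points \<open>1 / u\<^sub>j\<close> are scaled by \<open>\<theta> j\<close> for the variable \<open>w\<^sub>j\<close>; the value 1 gives the
  contours of the moment formula.\<close>

definition "circles_at \<theta> j = u_contour_ext n u (\<lambda>p. \<theta> j * \<rho> p) c r j"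

lemma circles_at_eq: "circles_at \<theta> j = (\<lambda>p. (p, \<theta> j * \<rho> p)) ` P \<union> {(0, radius0 j)}"
  by (simp add: circles_at_def u_contour_ext_def u_contour_def dilate_def radius0_def)

lemma zero_notin_P: "0 \<notin> P"
  using zero_notin_H P_subset_H by blast

lemma oint_circles_at:
  "oint (circles_at \<theta> j) f = (\<Sum>p\<in>P. circ p (\<theta> j * \<rho> p) f) + circ 0 (radius0 j) f"
proof -
  have "oint (circles_at \<theta> j) f = (\<Sum>(p, x)\<in>(\<lambda>p. (p, \<theta> j * \<rho> p)) ` P. circ p x f) + circ 0 (radius0 j) f"
    unfolding oint_eq_sum_circ circles_at_eq
    using finite_P zero_notin_P by (subst sum.union_disjoint) auto
  also have "(\<Sum>(p, x)\<in>(\<lambda>p. (p, \<theta> j * \<rho> p)) ` P. circ p x f) = (\<Sum>p\<in>P. circ p (\<theta> j * \<rho> p) f)"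
    by (subst sum.reindex) (auto simp: inj_on_def)
  finally show ?thesis .
qed

lemma scaled_cball_subset:
  assumes "p \<in> P" "0 < x" "x \<le> 1"
  shows "cball p (x * \<rho> p) \<subseteq> H" "cball p (x * \<rho> p) \<inter> P = {p}" "0 < x * \<rho> p"
proof -
  have x: "x * \<rho> p \<le> \<rho> p" "0 < x * \<rho> p" using assms radius_pos[OF assms(1)] by (simp_all add: mult_le_cancel_right1)
  then have sub: "cball p (x * \<rho> p) \<subseteq> cball p (\<rho> p)" by auto
  then show "cball p (x * \<rho> p) \<subseteq> H" using assms(1) by (auto simp: H_def)
  have "p' \<notin> cball p (\<rho> p)" if "p' \<in> P" "p' \<noteq> p" for p'
    using cball_disjoint[OF assms(1) that(1)] that radius_pos[OF that(1)] by fastforce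
  then have "cball p (x * \<rho> p) \<inter> P \<subseteq> {p}" using sub by blast
  moreover have "p \<in> cball p (x * \<rho> p)" using x by simp
  ultimately show "cball p (x * \<rho> p) \<inter> P = {p}" using assms(1) by blast
  show "0 < x * \<rho> p" by (rule x)
qed

lemma contour_family_circles_at:
  assumes "\<And>j. 0 < \<theta> j" "\<And>j. \<theta> j \<le> 1"
  shows "contour_family (circles_at \<theta>) T"
proof
  fix j p x
  show "finite (circles_at \<theta> j)" using finite_P by (simp add: circles_at_eq)
  assume "(p, x) \<in> circles_at \<theta> j"
  then consider "p \<in> P" "x = \<theta> j * \<rho> p" | "p = 0" "x = radius0 j" by (auto simp: circles_at_eq)
  then have "0 \<le> x \<and> sphere p x \<subseteq> T j"
  proof cases
    case 1
    note sub = scaled_cball_subset[OF 1(1) assms(1)[of j] assms(2)[of j], folded 1(2)]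
    have "p \<notin> sphere p x" using sub(3) by auto
    have "sphere p x \<subseteq> H - P"
    proof
      fix z assume z: "z \<in> sphere p x"
      then have zc: "z \<in> cball p x" by simp
      moreover have "z \<noteq> p" using z \<open>p \<notin> sphere p x\<close> by metis
      ultimately have "z \<notin> P" using sub(2) by (metis IntI singletonD)
      with zc sub(1) show "z \<in> H - P" by (meson DiffI subsetD)
    qed
    then show ?thesis using scaled_cball_subset(3)[OF 1(1) assms(1)[of j] assms(2)[of j]] 1 by (auto simp: T_def)
  next
    case 2
    then show ?thesis using radius0_pos[of j] by (auto simp: T_def)
  qed
  then show "0 \<le> x" "sphere p x \<subseteq> T j" by auto
qed

lemma qkernel_holomorphic:
  "qkernel q a holomorphic_on - {a / of_real q}" "(\<lambda>z. qkernel q z b) holomorphic_on - {of_real q * b}"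
  using q by (auto simp: qkernel_def[abs_def] field_simps intro!: holomorphic_intros)

text \<open>The possible poles of the kernel in the variable \<open>w\<^sub>j\<close>.\<close>

definition "poles S w j = (\<lambda>\<alpha>. w \<alpha> / of_real q) ` {\<alpha>\<in>S. \<alpha> < j} \<union> (\<lambda>\<beta>. of_real q * w \<beta>) ` {\<beta>\<in>S. j < \<beta>}"

lemma finite_poles: "finite S \<Longrightarrow> finite (poles S w j)"
  by (simp add: poles_def)

lemma qkernel_prod_holomorphic:
  "(\<lambda>z. qkernel_prod q S (w(j := z))) holomorphic_on - poles S w j"
proof -
  have "(\<lambda>z. qkernel q ((w(j := z)) \<alpha>) ((w(j := z)) \<beta>)) holomorphic_on - poles S w j"
    if "\<alpha> \<in> S" "\<beta> \<in> S" "\<alpha> < \<beta>" for \<alpha> \<beta>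
  proof -
    consider "j = \<alpha>" | "j = \<beta>" | "j \<noteq> \<alpha>" "j \<noteq> \<beta>" by blast
    then show ?thesis
    proof cases
      case 1
      then show ?thesis using that
        by (auto intro!: holomorphic_on_subset[OF qkernel_holomorphic(2)] simp: poles_def)
    next
      case 2
      then show ?thesis using that
        by (auto intro!: holomorphic_on_subset[OF qkernel_holomorphic(1)] simp: poles_def)
    qed auto
  qed
  then show ?thesis
    unfolding qkernel_prod_def case_prod_unfold by (intro holomorphic_on_prod) auto
qed

definition "integrand S g w = qkernel_prod q S w * (\<Prod>i\<in>S. g i (w i))"

lemma integrand_holomorphic:
  assumes "g j holomorphic_on - ({0, of_real s} \<union> P)"
  shows "(\<lambda>z. integrand S g (w(j := z))) holomorphic_on - ({0, of_real s} \<union> P \<union> poles S w j)"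
proof -
  have "(\<lambda>z. g i ((w(j := z)) i)) holomorphic_on - ({0, of_real s} \<union> P \<union> poles S w j)" for i
    by (cases "i = j") (use assms in \<open>auto elim: holomorphic_on_subset\<close>)
  then show ?thesis unfolding integrand_def
    by (intro holomorphic_on_mult holomorphic_on_prod holomorphic_on_subset[OF qkernel_prod_holomorphic]) auto
qed

lemma continuous_on_coord: "continuous_on A (\<lambda>w. w (i::nat) :: complex)"
  by (rule continuous_on_product_then_coordinatewise[OF continuous_on_id])

lemma continuous_on_integrand:
  assumes S: "S \<subseteq> {1..l}" and "\<And>i. i \<in> S \<Longrightarrow> continuous_on (T i) (g i)"
  shows "continuous_on (torus T S) (integrand S g)"
proof -
  have "continuous_on (torus T S) (\<lambda>w. qkernel q (w \<alpha>) (w \<beta>))"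
    if "\<alpha> \<in> S" "\<beta> \<in> S" "\<alpha> < \<beta>" for \<alpha> \<beta>
    unfolding qkernel_def
  proof (intro continuous_intros continuous_on_coord ballI)
    fix w assume "w \<in> torus T S"
    then have "w \<alpha> \<in> T \<alpha>" "w \<beta> \<in> T \<beta>"
      using torusD that(1,2) by blast+
    moreover have "\<beta> \<le> l" using that(2) S by auto
    ultimately show "w \<alpha> - of_real q * w \<beta> \<noteq> 0"
      using that(3) by (intro qkernel_denominator_nonzero)
  qed
  moreover have "continuous_on (torus T S) (\<lambda>w. g i (w i))" if "i \<in> S" for i
    by (rule continuous_on_compose2[OF assms(2)[OF that] continuous_on_coord]) (use that in \<open>auto simp: torus_def\<close>)
  ultimately show ?thesis
    unfolding integrand_def[abs_def] qkernel_prod_def case_prod_unfold by (intro continuous_intros) auto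
qed

lemma poles_notin_H:
  assumes "j \<in> {1..l}" "w \<in> torus T ({1..l} - {j})" "z \<in> poles {1..l} w j"
  shows "z \<notin> H"
proof -
  consider \<alpha> where "\<alpha> \<in> {1..l}" "\<alpha> < j" "z = w \<alpha> / of_real q"
    | \<beta> where "\<beta> \<in> {1..l}" "j < \<beta>" "z = of_real q * w \<beta>"
    using assms(3) unfolding poles_def by blast
  then show ?thesis
  proof cases
    case 1
    then show ?thesis using div_q_T_cases(1)[OF torusD[OF assms(2), of \<alpha>], of j] assms(1) by simp
  next
    case 2
    then show ?thesis using mult_q_T_cases(1)[OF torusD[OF assms(2), of \<beta>], of j] assms(1) by simp
  qed
qed

text \<open>The centre is the only pole inside any of the circles around the \<open>1 / u\<^sub>j\<close>, whatever their
  radii.\<close>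

lemma iterated_integrand_radius_independent:
  assumes \<theta>: "\<And>j. 0 < \<theta> j" "\<And>j. \<theta> j \<le> 1" "\<And>j. 0 < \<theta>' j" "\<And>j. \<theta>' j \<le> 1"
    and g: "\<And>i. i \<in> {1..l} \<Longrightarrow> g i holomorphic_on - ({0, of_real s} \<union> P)"
  shows "iterated_oint (circles_at \<theta>) [1..<Suc l] (integrand {1..l} g) w =
    iterated_oint (circles_at \<theta>') [1..<Suc l] (integrand {1..l} g) w"
proof (rule iterated_oint_deform[OF contour_family_circles_at contour_family_circles_at])
  have "continuous_on (T i) (g i)" if "i \<in> {1..l}" for i
    using holomorphic_on_imp_continuous_on[OF g[OF that]] by (rule continuous_on_subset)
     (rule T_subset, use that in simp)
  then show "continuous_on (torus T {1..l}) (integrand {1..l} g)" by (rule continuous_on_integrand[OF subset_refl])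
next
  fix j w assume "j \<in> set [1..<Suc l]" and w: "w \<in> torus T ({1..l} - {j})"
  then have j: "j \<in> {1..l}" by auto
  let ?Z = "{0, of_real s} \<union> P \<union> poles {1..l} w j"
  have Z: "?Z \<inter> cball p (x * \<rho> p) = {p}" if "p \<in> P" "0 < x" "x \<le> 1" for p x
  proof -
    note sub = scaled_cball_subset[OF that]
    have "poles {1..l} w j \<inter> H = {}" using poles_notin_H[OF j w] by blast
    then show ?thesis using sub(1,2) zero_notin_H s_outside(1) by blast
  qed
  have "circ p (x * \<rho> p) (\<lambda>z. integrand {1..l} g (w(j := z))) = residue (\<lambda>z. integrand {1..l} g (w(j := z))) p"
    if p: "p \<in> P" "0 < x" "x \<le> 1" for p x
  proof -
    have "?Z \<inter> ball p (x * \<rho> p) = {p}" "sphere p (x * \<rho> p) \<inter> ?Z = {}"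
      using Int_ball_sphere[OF Z[OF p] scaled_cball_subset(3)[OF p]] .
    note Zp = this
    have "finite ?Z" using finite_P finite_poles[of "{1..l}" w j] by simp
    then have "circ p (x * \<rho> p) (\<lambda>z. integrand {1..l} g (w(j := z))) =
        (\<Sum>z\<in>?Z \<inter> ball p (x * \<rho> p). residue (\<lambda>z. integrand {1..l} g (w(j := z))) z)"
      using integrand_holomorphic[of g j, OF g[OF j]] scaled_cball_subset(3)[OF p] Zp(2)
      by (rule circ_residues)
    then show ?thesis unfolding Zp(1) by simp
  qed
  then show "oint (circles_at \<theta> j) (\<lambda>z. integrand {1..l} g (w(j := z))) =
      oint (circles_at \<theta>' j) (\<lambda>z. integrand {1..l} g (w(j := z)))"
    using \<theta> by (simp add: oint_circles_at)
qed (use \<theta> in \<open>auto simp: torus_def\<close>)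

lemma integrand_remove_coord:
  assumes "finite S" "a \<in> S"
  shows "integrand S g (w(a := z)) = integrand (S - {a}) g w *
    (g a z * (\<Prod>\<alpha>\<in>{\<alpha>\<in>S. \<alpha> < a}. qkernel q (w \<alpha>) z) * (\<Prod>\<beta>\<in>{\<beta>\<in>S. a < \<beta>}. qkernel q z (w \<beta>)))"
proof -
  let ?w = "w(a := z)"
  have w: "?w \<alpha> = w \<alpha>" if "\<alpha> \<noteq> a" for \<alpha> using that by simp
  have "(\<Prod>i\<in>S. g i (?w i)) = g a (?w a) * (\<Prod>i\<in>S - {a}. g i (?w i))"
    by (rule prod.remove[OF assms])
  also have "(\<Prod>i\<in>S - {a}. g i (?w i)) = (\<Prod>i\<in>S - {a}. g i (w i))"
    by (rule prod.cong) auto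
  also have "?w a = z" by simp
  finally have G: "(\<Prod>i\<in>S. g i (?w i)) = g a z * (\<Prod>i\<in>S - {a}. g i (w i))" .
  have K: "qkernel_prod q (S - {a}) ?w = qkernel_prod q (S - {a}) w" by (rule qkernel_prod_cong) auto
  have 1: "(\<Prod>\<alpha>\<in>{\<alpha>\<in>S. \<alpha> < a}. qkernel q (?w \<alpha>) (?w a)) = (\<Prod>\<alpha>\<in>{\<alpha>\<in>S. \<alpha> < a}. qkernel q (w \<alpha>) z)"
    by (rule prod.cong) auto
  have 2: "(\<Prod>\<beta>\<in>{\<beta>\<in>S. a < \<beta>}. qkernel q (?w a) (?w \<beta>)) = (\<Prod>\<beta>\<in>{\<beta>\<in>S. a < \<beta>}. qkernel q z (w \<beta>))"
    by (rule prod.cong) auto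
  show ?thesis
    unfolding integrand_def qkernel_prod_remove[OF assms] G K 1 2 by (simp add: algebra_simps)
qed

lemma qkernel_left_holomorphic:
  "(\<lambda>z. \<Prod>\<alpha>\<in>A. qkernel q (w \<alpha>) z) holomorphic_on - ((\<lambda>\<alpha>. w \<alpha> / of_real q) ` A)"
  by (intro holomorphic_intros holomorphic_on_subset[OF qkernel_holomorphic(1)]) auto

lemma qkernel_right_holomorphic:
  "(\<lambda>z. \<Prod>\<beta>\<in>A. qkernel q z (w \<beta>)) holomorphic_on - ((\<lambda>\<beta>. of_real q * w \<beta>) ` A)"
  by (intro holomorphic_intros holomorphic_on_subset[OF qkernel_holomorphic(2)]) auto

end

section \<open>The vertex relation for integrals\<close>

text \<open>The function of one variable that represents the point \<open>(x, t)\<close> in the moment formula.\<close>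

definition point_fun :: "real \<Rightarrow> real \<Rightarrow> (nat \<Rightarrow> real) \<Rightarrow> nat \<Rightarrow> nat \<Rightarrow> complex \<Rightarrow> complex" where
  "point_fun q s u x t z = inverse z *
     ((1 - of_real s * z) / (1 - inverse (of_real s) * z)) ^ (x - 1) *
     (\<Prod>j=1..t. (1 - of_real (q * u j) * z) / (1 - of_real (u j) * z))"

context moment_contours
begin

lemma u_factor_nonzero:
  assumes "j \<in> {1..n}" "z \<notin> P"
  shows "1 - of_real (u j) * z \<noteq> 0"
proof
  assume "1 - of_real (u j) * z = 0"
  then have "z = of_real (inverse (u j))" using u_pos[OF assms(1)] by (simp add: field_simps)
  then show False using assms by (auto simp: inverse_points_def)
qed

lemma s_factor_nonzero: "z \<noteq> of_real s \<Longrightarrow> 1 - inverse (of_real s) * z \<noteq> (0::complex)"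
  using s by (auto simp: field_simps)

lemma point_fun_holomorphic:
  assumes "t \<le> n"
  shows "point_fun q s u x t holomorphic_on - ({0, of_real s} \<union> P)"
  unfolding point_fun_def[abs_def]
proof (intro holomorphic_intros)
  fix z j assume "z \<in> - ({0, of_real s} \<union> P)" "j \<in> {1..t}"
  then show "1 - of_real (u j) * z \<noteq> 0" using assms by (intro u_factor_nonzero) auto
next
  fix z assume "z \<in> - ({0, of_real s} \<union> P)"
  then show "1 - inverse (of_real s) * z \<noteq> 0" by (intro s_factor_nonzero) auto
qed auto

lemma holomorphic_continuous_on_T:
  assumes "f holomorphic_on - ({0, of_real s} \<union> P)" "i \<le> l"
  shows "continuous_on (T i) f"
  using holomorphic_on_imp_continuous_on[OF assms(1)] T_subset[OF assms(2)] by (rule continuous_on_subset)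

end

locale nested_contours = moment_contours +
  fixes \<theta> :: "nat \<Rightarrow> real"
  assumes \<theta>: "\<And>j. 0 < \<theta> j" "\<And>j. \<theta> j \<le> 1" and \<theta>_mono: "strict_mono \<theta>"
begin

sublocale contour_family "circles_at \<theta>" T
  by (rule contour_family_circles_at[OF \<theta>])

definition "nested_integral g = iterated_oint (circles_at \<theta>) [1..<Suc l] (integrand {1..l} g) (\<lambda>_. 0)"

text \<open>The condition on the one-variable factors under which the integrand is continuous and all its poles
  are under control.\<close>

definition "regular g \<longleftrightarrow> (\<forall>i\<in>{1..l}. g i holomorphic_on - ({0, of_real s} \<union> P))"

lemma regular_continuous: "regular g \<Longrightarrow> i \<in> {1..l} \<Longrightarrow> continuous_on (T i) (g i)"
  by (simp add: regular_def holomorphic_continuous_on_T)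

lemma continuous_on_integrand_regular:
  "regular g \<Longrightarrow> S \<subseteq> {1..l} \<Longrightarrow> continuous_on (torus T S) (integrand S g)"
  by (rule continuous_on_integrand) (use regular_continuous in blast)+

lemma torus_Diff_all: "w \<in> torus T ({1..l} - set [1..<Suc l])"
  by (auto simp: torus_def)

lemma integrand_cong:
  "(\<And>i. i \<in> S \<Longrightarrow> g i (w i) = g' i (w i)) \<Longrightarrow> integrand S g w = integrand S g' w"
  unfolding integrand_def by (simp cong: prod.cong)

lemma nested_integral_cong:
  assumes "\<And>i z. i \<in> {1..l} \<Longrightarrow> z \<in> T i \<Longrightarrow> g i z = g' i z"
  shows "nested_integral g = nested_integral g'"
  unfolding nested_integral_def by (rule iterated_cong[OF _ torus_Diff_all], rule integrand_cong, rule assms)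
    (auto dest: torusD)

lemma integrand_upd:
  assumes "finite S" "i \<in> S"
  shows "integrand S (g(i := f)) w = qkernel_prod q S w * (f (w i) * (\<Prod>j\<in>S - {i}. g j (w j)))"
proof -
  have "(\<Prod>j\<in>S. (g(i := f)) j (w j)) = f (w i) * (\<Prod>j\<in>S - {i}. (g(i := f)) j (w j))"
    using assms by (simp add: prod.remove)
  also have "(\<Prod>j\<in>S - {i}. (g(i := f)) j (w j)) = (\<Prod>j\<in>S - {i}. g j (w j))"
    by (rule prod.cong) auto
  finally show ?thesis by (simp add: integrand_def)
qed

lemma nested_integral_linear:
  assumes i: "i \<in> {1..l}" and reg: "regular (g(i := f))" "regular (g(i := h))"
  shows "nested_integral (g(i := \<lambda>z. a * f z + b * h z)) = a * nested_integral (g(i := f)) + b * nested_integral (g(i := h))"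
proof -
  have eq: "integrand {1..l} (g(i := \<lambda>z. a * f z + b * h z)) =
      (\<lambda>w. a * integrand {1..l} (g(i := f)) w + b * integrand {1..l} (g(i := h)) w)"
    using integrand_upd[OF finite_atLeastAtMost i] by (simp add: fun_eq_iff algebra_simps)
  show ?thesis unfolding nested_integral_def eq
    by (rule iterated_linear[OF continuous_on_integrand_regular continuous_on_integrand_regular torus_Diff_all])
       (use reg in auto)
qed

text \<open>The functions at \<open>x + 1\<close> and \<open>t + 1\<close> arise from those at \<open>x\<close> and \<open>t\<close> by the factors
  \<open>X = (1 - s z) / (1 - z / s)\<close> and \<open>\<eta> = (1 - q v z) / (1 - v z)\<close>. The sums \<open>(1 - s v) X + s v - s\<^sup>2\<close> and
  \<open>(1 - q s v) X + q s v - s\<^sup>2\<close> are the same multiple of \<open>1 - v z\<close> and of \<open>1 - q v z\<close>, respectively, so their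
  ratio is \<open>\<eta>\<close>.\<close>

lemma vertex_relation_point_fun:
  assumes "t < n" "i \<le> l" "z \<in> T i" "1 \<le> x"
  defines "v \<equiv> u (Suc t)"
  shows "of_real (1 - s * v) * point_fun q s u (Suc x) (Suc t) z +
      of_real (s * v - s\<^sup>2) * point_fun q s u x (Suc t) z =
    of_real (1 - q * s * v) * point_fun q s u (Suc x) t z + of_real (q * s * v - s\<^sup>2) * point_fun q s u x t z"
proof -
  define R where "R = inverse z * ((1 - of_real s * z) / (1 - inverse (of_real s) * z)) ^ (x - 1) *
    (\<Prod>j=1..t. (1 - of_real (q * u j) * z) / (1 - of_real (u j) * z))"
  define X where "X = (1 - of_real s * z) / (1 - inverse (of_real s) * z)"
  define \<eta> where "\<eta> = (1 - of_real (q * v) * z) / (1 - of_real v * z)"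
  have x: "Suc x - 1 = Suc (x - 1)" using assms(4) by simp
  have pf: "point_fun q s u (Suc x) (Suc t) z = R * (X * \<eta>)" "point_fun q s u x (Suc t) z = R * \<eta>"
    "point_fun q s u (Suc x) t z = R * X" "point_fun q s u x t z = R"
    unfolding point_fun_def x R_def by (simp_all add: X_def \<eta>_def v_def)
  define a where "a = (of_real s :: complex)"
  define y where "y = (of_real v :: complex)"
  define p where "p = (of_real q :: complex)"
  have nz: "1 - y * z \<noteq> 0" "1 - inverse a * z \<noteq> 0" "a \<noteq> 0"
    using u_factor_nonzero[of "Suc t" z] s_factor_nonzero[of z] T_notin_P[OF assms(2,3)] T_not_s[OF assms(2,3)] assms(1) s
    by (auto simp: v_def y_def a_def)
  then have az: "a - z \<noteq> 0" by (auto simp: field_simps)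
  have X: "X = a * (1 - a * z) / (a - z)"
    unfolding X_def a_def[symmetric] using nz az by (simp add: divide_simps algebra_simps)
  have \<eta>: "\<eta> = (1 - p * y * z) / (1 - y * z)" by (simp add: \<eta>_def p_def y_def)
  have "(1 - a * y) * (X * \<eta>) + (a * y - a\<^sup>2) * \<eta> = (1 - p * a * y) * X + (p * a * y - a\<^sup>2)"
    unfolding X \<eta> using nz(1) az by (simp add: divide_simps) (simp add: algebra_simps power2_eq_square)
  from arg_cong[OF this, of "\<lambda>e. R * e"] show ?thesis
    unfolding pf by (simp add: a_def y_def p_def algebra_simps)
qed

lemma nested_integral_vertex:
  assumes "t < n" "i \<in> {1..l}" "1 \<le> x" "\<And>f. f holomorphic_on - ({0, of_real s} \<union> P) \<Longrightarrow> regular (g(i := f))"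
  defines "v \<equiv> u (Suc t)"
  shows "of_real (1 - s * v) * nested_integral (g(i := point_fun q s u (Suc x) (Suc t))) +
      of_real (s * v - s\<^sup>2) * nested_integral (g(i := point_fun q s u x (Suc t))) =
    of_real (1 - q * s * v) * nested_integral (g(i := point_fun q s u (Suc x) t)) +
      of_real (q * s * v - s\<^sup>2) * nested_integral (g(i := point_fun q s u x t))"
proof -
  have h: "regular (g(i := point_fun q s u y r))" if "r \<le> n" for y r
    by (rule assms(4), rule point_fun_holomorphic, rule that)
  have "nested_integral (g(i := \<lambda>z. of_real (1 - s * v) * point_fun q s u (Suc x) (Suc t) z +
      of_real (s * v - s\<^sup>2) * point_fun q s u x (Suc t) z)) =
    nested_integral (g(i := \<lambda>z. of_real (1 - q * s * v) * point_fun q s u (Suc x) t z +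
      of_real (q * s * v - s\<^sup>2) * point_fun q s u x t z))"
    using vertex_relation_point_fun[OF assms(1) _ _ assms(3)] by (intro nested_integral_cong) (auto simp: v_def)
  then show ?thesis
    using assms(1) by (simp add: nested_integral_linear[OF assms(2)] h)
qed

section \<open>Equal points\<close>

lemma circ_0_same:
  assumes "finite Z" "f holomorphic_on - Z" "i < j" "\<And>z. z \<in> Z \<Longrightarrow> cmod z < radius0 i \<or> radius0 j < cmod z"
  shows "circ 0 (radius0 i) f = circ 0 (radius0 j) f"
proof -
  have ij: "radius0 i < radius0 j" using radius0_less[OF assms(3)] mult_right_mono[of q 1 "radius0 j"] q radius0_pos[of j] by linarith
  have "Z \<inter> ball 0 (radius0 i) = Z \<inter> ball 0 (radius0 j)" "sphere 0 (radius0 i) \<inter> Z = {}" "sphere 0 (radius0 j) \<inter> Z = {}"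
    using assms(4) ij by fastforce+
  then show ?thesis using circ_residues[OF assms(1,2) radius0_pos] by simp
qed

lemma circ_P_residue:
  assumes "finite Z" "f holomorphic_on - Z" "p \<in> P" "0 < x" "x \<le> 1" "Z \<inter> H \<subseteq> P" "P \<subseteq> Z"
  shows "circ p (x * \<rho> p) f = residue f p"
proof -
  note sub = scaled_cball_subset[OF assms(3-5)]
  have "Z \<inter> cball p (x * \<rho> p) = {p}"
  proof (intro equalityI subsetI)
    fix z assume z: "z \<in> Z \<inter> cball p (x * \<rho> p)"
    then have "z \<in> P" using sub(1) assms(6) by (meson IntE IntI subsetD)
    then have "z \<in> cball p (x * \<rho> p) \<inter> P" using z by simp
    then show "z \<in> {p}" unfolding sub(2) .
  qed (use assms(3,7) sub(3) in auto)
  from Int_ball_sphere[OF this sub(3)] circ_residues[OF assms(1,2) sub(3)] show ?thesis by simp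
qed

lemma circ_P_eq_0:
  assumes "finite Z" "f holomorphic_on - Z" "p \<in> P" "0 < x" "x \<le> 1" "Z \<inter> H = {}"
  shows "circ p (x * \<rho> p) f = 0"
proof (rule circ_eq_0[OF assms(1,2)])
  show "0 < x * \<rho> p" by (rule scaled_cball_subset(3)[OF assms(3-5)])
  show "cball p (x * \<rho> p) \<inter> Z = {}"
    using scaled_cball_subset(1)[OF assms(3-5)] assms(6) by (metis inf.absorb_iff2 inf.assoc inf.commute inf_bot_right)
qed

text \<open>Once both variables run over the same contour, the double integral of \<open>(z - y) E z E y\<close> is a
  difference of two equal products.\<close>

lemma oint_pair_antisymmetric:
  assumes "finite Z" "E holomorphic_on - Z" "Z \<inter> H \<subseteq> P" "P \<subseteq> Z"
    and "\<And>z. z \<in> Z \<Longrightarrow> cmod z < radius0 i \<or> radius0 (Suc i) < cmod z" "T i \<subseteq> - Z"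
  shows "oint (circles_at \<theta> i) (\<lambda>z. oint (circles_at \<theta> (Suc i)) (\<lambda>y. C * ((z - y) * E z * E y))) = 0"
proof -
  have contE: "continuous_on (T i) E"
    using holomorphic_on_imp_continuous_on[OF assms(2)] assms(6) by (rule continuous_on_subset)
  have same: "oint (circles_at \<theta> (Suc i)) f = oint (circles_at \<theta> i) f" if f: "f holomorphic_on - Z" for f
    unfolding oint_circles_at using circ_0_same[OF assms(1) f lessI assms(5)] circ_P_residue[OF assms(1) f _ \<theta> assms(3,4)]
    by simp
  define A where "A = oint (circles_at \<theta> i) (\<lambda>y. y * E y)"
  define B where "B = oint (circles_at \<theta> i) E"
  have cont2: "continuous_on (T i) (\<lambda>y. y * E y)" by (intro continuous_intros contE)
  have inner: "oint (circles_at \<theta> (Suc i)) (\<lambda>y. C * ((z - y) * E z * E y)) = (C * B) * (z * E z) + (- C * A) * E z" for z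
  proof -
    have "oint (circles_at \<theta> (Suc i)) (\<lambda>y. C * ((z - y) * E z * E y)) =
        oint (circles_at \<theta> i) (\<lambda>y. (C * z * E z) * E y + (- C * E z) * (y * E y))"
      by (subst same) (auto intro!: holomorphic_intros assms(2) simp: algebra_simps)
    also have "\<dots> = (C * z * E z) * B + (- C * E z) * A"
      unfolding A_def B_def by (rule oint_linear[OF contE cont2])
    finally show ?thesis by (simp add: algebra_simps)
  qed
  have "oint (circles_at \<theta> i) (\<lambda>z. (C * B) * (z * E z) + (- C * A) * E z) = (C * B) * A + (- C * A) * B"
    unfolding A_def B_def by (rule oint_linear[OF cont2 contE])
  then show ?thesis unfolding inner by simp
qed

text \<open>Apart from \<open>qkernel q z y\<close> itself, the kernel is symmetric in two adjacent variables.\<close>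

lemma integrand_pair:
  assumes i: "i \<in> {1..l}" "Suc i \<in> {1..l}"
  defines "S \<equiv> {1..l} - {i, Suc i}"
  defines "M \<equiv> \<lambda>w z. (\<Prod>\<alpha>\<in>{\<alpha>\<in>S. \<alpha> < i}. qkernel q (w \<alpha>) z) * (\<Prod>\<beta>\<in>{\<beta>\<in>S. Suc i < \<beta>}. qkernel q z (w \<beta>))"
  shows "integrand {1..l} g (w(i := z, Suc i := y)) =
    integrand S g w * (qkernel q z y * M w z * M w y * g i z * g (Suc i) y)"
proof -
  let ?w = "w(i := z, Suc i := y)"
  have S: "{1..l} - {i} - {Suc i} = S" by (auto simp: S_def)
  have eqs: "{\<alpha>\<in>{1..l}. \<alpha> < i} = {\<alpha>\<in>S. \<alpha> < i}" "{\<beta>\<in>{1..l}. i < \<beta>} = insert (Suc i) {\<beta>\<in>S. Suc i < \<beta>}"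
    "{\<alpha>\<in>{1..l} - {i}. \<alpha> < Suc i} = {\<alpha>\<in>S. \<alpha> < i}" "{\<beta>\<in>{1..l} - {i}. Suc i < \<beta>} = {\<beta>\<in>S. Suc i < \<beta>}"
    using i by (auto simp: S_def)
  have w: "?w \<alpha> = w \<alpha>" if "\<alpha> \<in> S" for \<alpha> using that by (auto simp: S_def)
  have P1: "(\<Prod>\<alpha>\<in>{\<alpha>\<in>S. \<alpha> < i}. qkernel q (?w \<alpha>) x) = (\<Prod>\<alpha>\<in>{\<alpha>\<in>S. \<alpha> < i}. qkernel q (w \<alpha>) x)" for x
    by (rule prod.cong) (simp_all add: w del: fun_upd_apply)
  have P2: "(\<Prod>\<beta>\<in>{\<beta>\<in>S. Suc i < \<beta>}. qkernel q x (?w \<beta>)) = (\<Prod>\<beta>\<in>{\<beta>\<in>S. Suc i < \<beta>}. qkernel q x (w \<beta>))" for x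
    by (rule prod.cong) (simp_all add: w del: fun_upd_apply)
  have K: "qkernel_prod q S ?w = qkernel_prod q S w" by (rule qkernel_prod_cong) (rule w)
  have fin: "finite {\<beta>\<in>S. Suc i < \<beta>}" "finite ({1..l} - {i})" "Suc i \<in> {1..l} - {i}" using i by (auto simp: S_def)
  have G: "(\<Prod>j=1..l. g j (?w j)) = g i z * (g (Suc i) y * (\<Prod>j\<in>S. g j (w j)))"
  proof -
    have "(\<Prod>j=1..l. g j (?w j)) = g i (?w i) * (\<Prod>j\<in>{1..l} - {i}. g j (?w j))"
      by (rule prod.remove[OF finite_atLeastAtMost i(1)])
    also have "(\<Prod>j\<in>{1..l} - {i}. g j (?w j)) = g (Suc i) (?w (Suc i)) * (\<Prod>j\<in>S. g j (?w j))"
      using prod.remove[OF fin(2,3), of "\<lambda>j. g j (?w j)"] unfolding S .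
    also have "(\<Prod>j\<in>S. g j (?w j)) = (\<Prod>j\<in>S. g j (w j))" by (rule prod.cong) (simp_all add: w del: fun_upd_apply)
    also have "?w i = z" by simp
    also have "?w (Suc i) = y" by simp
    finally show ?thesis .
  qed
  have "qkernel_prod q {1..l} ?w = qkernel_prod q S ?w *
      ((\<Prod>\<alpha>\<in>{\<alpha>\<in>S. \<alpha> < i}. qkernel q (?w \<alpha>) y) * (\<Prod>\<beta>\<in>{\<beta>\<in>S. Suc i < \<beta>}. qkernel q y (?w \<beta>))) *
      ((\<Prod>\<alpha>\<in>{\<alpha>\<in>S. \<alpha> < i}. qkernel q (?w \<alpha>) z) * (qkernel q z y * (\<Prod>\<beta>\<in>{\<beta>\<in>S. Suc i < \<beta>}. qkernel q z (?w \<beta>))))"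
    using fin i by (simp only: qkernel_prod_remove[OF finite_atLeastAtMost i(1)] qkernel_prod_remove[OF fin(2,3)] S eqs
       prod.insert mem_Collect_eq) simp
  then show ?thesis unfolding integrand_def G K P1 P2 M_def by (simp add: algebra_simps)
qed

text \<open>The counterpart of \<open>(Q' - Q) (Q' - q Q) = 0\<close>: the bracket is divisible by \<open>z - p y\<close>, the
  denominator of the kernel.\<close>

lemma quadratic_point_fun_identity:
  assumes "1 - v * z \<noteq> 0" "1 - v * y \<noteq> (0::complex)" "z - p * y \<noteq> 0"
  shows "(z - y) / (z - p * y) * ((1 - p * v * z) / (1 - v * z) * ((1 - p * v * y) / (1 - v * y)) -
     (1 + p) * ((1 - p * v * y) / (1 - v * y)) + p) =
   (1 - p) * v * ((z - y) / (1 - v * z) / (1 - v * y))"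
  using assms by (simp add: divide_simps) (simp add: algebra_simps power2_eq_square)

lemma nested_integral_equal_points:
  fixes x :: nat
  assumes i: "i \<in> {1..l}" "Suc i \<in> {1..l}" and t: "t < n"
    and g: "\<And>f h. f holomorphic_on - ({0, of_real s} \<union> P) \<Longrightarrow> h holomorphic_on - ({0, of_real s} \<union> P) \<Longrightarrow>
        regular (g(i := f, Suc i := h))"
  defines "pf \<equiv> point_fun q s u x"
  shows "nested_integral (g(i := pf (Suc t), Suc i := pf (Suc t))) =
    (1 + of_real q) * nested_integral (g(i := pf t, Suc i := pf (Suc t))) - of_real q * nested_integral (g(i := pf t, Suc i := pf t))"
proof -
  let ?g1 = "g(i := pf (Suc t), Suc i := pf (Suc t))"
  let ?g2 = "g(i := pf t, Suc i := pf (Suc t))"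
  let ?g3 = "g(i := pf t, Suc i := pf t)"
  let ?F = "integrand {1..l}"
  have reg: "regular ?g1" "regular ?g2" "regular ?g3"
    unfolding pf_def using t by (auto intro!: g point_fun_holomorphic simp del: fun_upd_apply)
  note cont = reg[THEN continuous_on_integrand_regular, OF subset_refl]
  let ?D = "\<lambda>w. 1 * ?F ?g1 w + - 1 * ((1 + of_real q) * ?F ?g2 w + - of_real q * ?F ?g3 w)"
  have cont23: "continuous_on (torus T {1..l}) (\<lambda>w. (1 + of_real q) * ?F ?g2 w + - of_real q * ?F ?g3 w)"
    by (intro continuous_intros cont)
  have "iterated_oint (circles_at \<theta>) [1..<Suc l] ?D (\<lambda>_. 0) =
      1 * nested_integral ?g1 + - 1 * ((1 + of_real q) * nested_integral ?g2 + - of_real q * nested_integral ?g3)"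
    unfolding nested_integral_def
    by (subst iterated_linear[OF cont(1) cont23 torus_Diff_all],
        subst iterated_linear[OF cont(2,3) torus_Diff_all]) (rule refl)
  moreover have "iterated_oint (circles_at \<theta>) [1..<Suc l] ?D (\<lambda>_. 0) = 0"
  proof -
    have upt: "[1..<Suc l] = [1..<i] @ i # Suc i # [Suc (Suc i)..<Suc l]"
      using i upt_add_eq_append[of 1 i "Suc l - i"] by (simp add: upt_conv_Cons)
    show ?thesis unfolding upt
    proof (rule iterated_zero_pair)
      show "continuous_on (torus T {1..l}) ?D" by (intro continuous_intros cont cont23)
      show "distinct ([1..<i] @ i # Suc i # [Suc (Suc i)..<Suc l])" using upt by (metis distinct_upt)
      show "(\<lambda>_. 0) \<in> torus T ({1..l} - set ([1..<i] @ i # Suc i # [Suc (Suc i)..<Suc l]))"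
        using torus_Diff_all unfolding upt .
    next
      fix w assume w: "w \<in> torus T ({1..l} - {i, Suc i})"
      let ?S = "{1..l} - {i, Suc i}"
      \<comment> \<open>\<open>M\<close> collects the kernel factors that link either of the two variables to the others, and \<open>Z\<close> the
        poles that remain in each of them\<close>
      define M where "M z = (\<Prod>\<alpha>\<in>{\<alpha>\<in>?S. \<alpha> < i}. qkernel q (w \<alpha>) z) * (\<Prod>\<beta>\<in>{\<beta>\<in>?S. Suc i < \<beta>}. qkernel q z (w \<beta>))" for z
      define v where "v = (of_real (u (Suc t)) :: complex)"
      define E where "E z = M z * (pf t z / (1 - v * z))" for z
      define C where "C = integrand ?S g w * ((1 - of_real q) * v)"
      define Z where "Z = {0, of_real s} \<union> P \<union> ((\<lambda>\<alpha>. w \<alpha> / of_real q) ` {\<alpha>\<in>?S. \<alpha> < i} \<union> (\<lambda>\<beta>. of_real q * w \<beta>) ` {\<beta>\<in>?S. Suc i < \<beta>})"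
      have pfS: "pf (Suc t) z = pf t z * ((1 - of_real q * v * z) / (1 - v * z))" for z
        by (simp add: pf_def point_fun_def v_def)
      have S: "integrand ?S (g(i := f, Suc i := h)) w = integrand ?S g w" for f h
        by (rule integrand_cong) auto
      have eq: "?D (w(i := z, Suc i := y)) = C * ((z - y) * E z * E y)" if "z \<in> T i" "y \<in> T (Suc i)" for z y
      proof -
        have nz: "1 - v * z \<noteq> 0" "1 - v * y \<noteq> 0" "z - of_real q * y \<noteq> 0"
          using u_factor_nonzero[of "Suc t"] T_notin_P[OF _ that(1)] T_notin_P[OF _ that(2)] i t
            qkernel_denominator_nonzero[OF that] by (auto simp: v_def)
        have "?D (w(i := z, Suc i := y)) = integrand ?S g w * M z * M y * pf t z * pf t y *
           (qkernel q z y * ((1 - of_real q * v * z) / (1 - v * z) * ((1 - of_real q * v * y) / (1 - v * y)) -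
             (1 + of_real q) * ((1 - of_real q * v * y) / (1 - v * y)) + of_real q))"
          unfolding integrand_pair[OF i] S M_def[symmetric]
          by (simp add: pfS) (simp add: algebra_simps)
        also have "\<dots> = integrand ?S g w * M z * M y * pf t z * pf t y *
            ((1 - of_real q) * v * ((z - y) / (1 - v * z) / (1 - v * y)))"
          unfolding qkernel_def quadratic_point_fun_identity[OF nz] ..
        also have "\<dots> = C * ((z - y) * E z * E y)" by (simp add: C_def E_def)
        finally show ?thesis .
      qed
      have "oint (circles_at \<theta> i) (\<lambda>z. oint (circles_at \<theta> (Suc i)) (\<lambda>y. ?D (w(i := z, Suc i := y)))) =
         oint (circles_at \<theta> i) (\<lambda>z. oint (circles_at \<theta> (Suc i)) (\<lambda>y. C * ((z - y) * E z * E y)))"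
        by (intro oint_cong eq)
      also have "\<dots> = 0"
      proof (rule oint_pair_antisymmetric)
        show "finite Z" using finite_P by (simp add: Z_def)
        have "M holomorphic_on - Z"
          unfolding M_def[abs_def] Z_def
          by (intro holomorphic_intros holomorphic_on_subset[OF qkernel_holomorphic(1)]
              holomorphic_on_subset[OF qkernel_holomorphic(2)]) auto
        moreover have "pf t holomorphic_on - Z"
          unfolding pf_def Z_def by (rule holomorphic_on_subset[OF point_fun_holomorphic]) (use t in auto)
        moreover have "1 - v * z \<noteq> 0" if "z \<in> - Z" for z
          using u_factor_nonzero[of "Suc t" z] t that by (auto simp: v_def Z_def)
        ultimately show "E holomorphic_on - Z"
          unfolding E_def[abs_def] by (intro holomorphic_intros) auto
        have wT: "w \<alpha> \<in> T \<alpha>" "\<alpha> \<le> l" if "\<alpha> \<in> ?S" for \<alpha> using torusD[OF w that] that by auto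
        have Zc: "z \<in> {0, of_real s} \<union> P \<or> z \<notin> H \<and> (cmod z < radius0 i \<or> radius0 (Suc i) < cmod z)"
          if "z \<in> Z" for z
        proof -
          consider "z \<in> {0, of_real s} \<union> P" | \<alpha> where "\<alpha> \<in> ?S" "\<alpha> < i" "z = w \<alpha> / of_real q"
            | \<beta> where "\<beta> \<in> ?S" "Suc i < \<beta>" "z = of_real q * w \<beta>"
            using \<open>z \<in> Z\<close> unfolding Z_def by blast
          then show ?thesis
          proof cases
            case 2
            have "radius0 (Suc i) \<le> radius0 l" using i radius0_le by simp
            then show ?thesis using div_q_T_cases[OF wT(1)[OF 2(1)] 2(2)] i 2(3) by force
          next
            case 3
            then show ?thesis using mult_q_T_cases[OF wT(1)[OF 3(1)] 3(2) wT(2)[OF 3(1)]] by force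
          qed simp
        qed
        show "Z \<inter> H \<subseteq> P" using Zc zero_notin_H s_outside(1) by blast
        show "P \<subseteq> Z" by (auto simp: Z_def)
        show "cmod z < radius0 i \<or> radius0 (Suc i) < cmod z" if "z \<in> Z" for z
        proof -
          have "radius0 (Suc i) \<le> radius0 l" using i radius0_le by simp
          then have "cmod z < radius0 i \<or> radius0 (Suc i) < cmod z" if "z \<in> {0, of_real s} \<union> P"
            using that radius0_pos[of i] s_outside(2) H_outside[of z] P_subset_H by auto
          with Zc[OF that] show ?thesis by blast
        qed
        show "T i \<subseteq> - Z"
        proof
          fix z assume z: "z \<in> T i"
          have "z \<notin> {0, of_real s} \<union> P" using T_subset[of i] z i by (auto simp del: Un_iff)
          moreover have "z \<in> H \<or> cmod z = radius0 i" using z by (auto simp: T_def)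
          moreover have "radius0 i < radius0 (Suc i)" using radius0_less[of i "Suc i"] q radius0_pos[of "Suc i"] mult_right_mono[of q 1 "radius0 (Suc i)"] by linarith
          ultimately show "z \<in> - Z" using Zc[of z] by auto
        qed
      qed
      finally show "oint (circles_at \<theta> i) (\<lambda>z. oint (circles_at \<theta> (Suc i)) (\<lambda>y. ?D (w(i := z, Suc i := y)))) = 0" .
    qed
  qed
  ultimately show ?thesis by (simp add: algebra_simps)
qed

section \<open>The integrals at time 0\<close>

text \<open>At time 0 the function of the first variable has no pole at the \<open>1 / u\<^sub>j\<close>, and the poles of the
  kernel lie outside its contour. This leaves the residue at the origin, where each kernel factor
  equals \<open>1/q\<close>.\<close>

lemma oint_first_coord:
  assumes a: "a \<in> {1..l}" and w: "w \<in> torus T {Suc a..l}"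
  shows "oint (circles_at \<theta> a) (\<lambda>z. integrand {a..l} (\<lambda>i. point_fun q s u (x i) 0) (w(a := z))) =
    inverse (of_real q) ^ (l - a) * integrand {Suc a..l} (\<lambda>i. point_fun q s u (x i) 0) w"
proof -
  let ?g = "\<lambda>i. point_fun q s u (x i) 0"
  define c0 where "c0 = integrand {Suc a..l} ?g w"
  define \<psi> where "\<psi> z = c0 * (((1 - of_real s * z) / (1 - inverse (of_real s) * z)) ^ (x a - 1) *
    (\<Prod>\<beta>\<in>{Suc a..l}. qkernel q z (w \<beta>)))" for z
  define Y where "Y = insert (of_real s) ((\<lambda>\<beta>. of_real q * w \<beta>) ` {Suc a..l})"
  have sets: "{a..l} - {a} = {Suc a..l}" "{\<alpha>\<in>{a..l}. \<alpha> < a} = {}" "{\<beta>\<in>{a..l}. a < \<beta>} = {Suc a..l}"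
    using a by auto
  have eq: "integrand {a..l} ?g (w(a := z)) = \<psi> z / (z - 0)" for z
    using integrand_remove_coord[of "{a..l}" a ?g w z] a unfolding sets c0_def[symmetric]
    by (simp add: \<psi>_def point_fun_def divide_inverse mult_ac)
  have wT: "w \<beta> \<in> T \<beta>" if "\<beta> \<in> {Suc a..l}" for \<beta> by (rule torusD[OF w that])
  have Y: "y \<notin> H" "radius0 a < cmod y" if yY: "y \<in> Y" for y
  proof -
    have "y \<notin> H \<and> radius0 a < cmod y"
    proof (cases "y = of_real s")
      case True
      then show ?thesis using s_outside radius0_le[of a] a by auto
    next
      case False
      then obtain \<beta> where "\<beta> \<in> {Suc a..l}" "y = of_real q * w \<beta>" using yY unfolding Y_def by blast
      then show ?thesis using mult_q_T_cases[OF wT[of \<beta>], of a] by auto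
    qed
    then show "y \<notin> H" "radius0 a < cmod y" by auto
  qed
  have Y0: "0 \<notin> Y" using Y(2)[of 0] radius0_pos[of a] by force
  have finY: "finite Y" by (simp add: Y_def)
  have holo\<psi>: "\<psi> holomorphic_on - Y"
    unfolding \<psi>_def[abs_def]
    by (intro holomorphic_intros holomorphic_on_subset[OF qkernel_right_holomorphic] s_factor_nonzero)
       (auto simp: Y_def)
  have holo: "(\<lambda>z. \<psi> z / (z - 0)) holomorphic_on - (insert 0 Y)"
    by (intro holomorphic_intros holomorphic_on_subset[OF holo\<psi>]) auto
  have fin: "finite (insert 0 Y)" using finY by simp
  have "circ p (\<theta> a * \<rho> p) (\<lambda>z. \<psi> z / (z - 0)) = 0" if "p \<in> P" for p
    by (rule circ_P_eq_0[OF fin holo that \<theta>]) (use Y(1) zero_notin_H in auto)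
  moreover have "circ 0 (radius0 a) (\<lambda>z. \<psi> z / (z - 0)) = \<psi> 0"
  proof -
    have b: "insert 0 Y \<inter> ball 0 (radius0 a) = {0}" "sphere 0 (radius0 a) \<inter> insert 0 Y = {}"
      using Y(2) radius0_pos[of a] by force+
    have "open (- Y)" using finY by (simp add: finite_imp_closed open_Compl)
    then have "residue (\<lambda>z. \<psi> z / (z - 0)) 0 = \<psi> 0" using Y0 holo\<psi> by (intro residue_simple) auto
    then show ?thesis using circ_residues[OF fin holo radius0_pos b(2)] unfolding b(1) by simp
  qed
  moreover have "\<psi> 0 = inverse (of_real q) ^ (l - a) * c0"
  proof -
    have "qkernel q 0 (w \<beta>) = inverse (of_real q)" if "\<beta> \<in> {Suc a..l}" for \<beta>
      using T_nonzero[OF wT[OF that]] q by (simp add: qkernel_def field_simps)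
    then show ?thesis by (simp add: \<psi>_def)
  qed
  ultimately show ?thesis unfolding eq oint_circles_at c0_def by simp
qed

text \<open>The variables are integrated out from the first to the last, with one factor \<open>1/q\<close> for every
  later variable.\<close>

lemma nested_integral_time_0: "nested_integral (\<lambda>i. point_fun q s u (x i) 0) = inverse (of_real q) ^ (l * (l - 1) div 2)"
proof -
  let ?g = "\<lambda>i. point_fun q s u (x i) 0"
  have reg: "regular ?g" using point_fun_holomorphic[of 0] by (auto simp: regular_def)
  have "iterated_oint (circles_at \<theta>) [Suc l - d..<Suc l] (integrand {Suc l - d..l} ?g) w =
      inverse (of_real q) ^ (d * (d - 1) div 2)" if "d \<le> l" for d w
    using that
  proof (induction d arbitrary: w)
    case 0
    then show ?case by (simp add: integrand_def qkernel_prod_def)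
  next
    case (Suc d)
    define a where "a = l - d"
    have a: "a \<in> {1..l}" "Suc l - Suc d = a" "Suc l - d = Suc a" "l - a = d"
      using Suc.prems by (auto simp: a_def)
    have upt: "[a..<Suc l] = a # [Suc a..<Suc l]" using a(1) by (simp add: upt_conv_Cons)
    have sub: "{a..l} \<subseteq> {1..l}" "{Suc a..l} \<subseteq> {1..l}" using a(1) by auto
    have w: "w \<in> torus T ({a..l} - set (a # [Suc a..<Suc l]))" "w \<in> torus T ({Suc a..l} - set [Suc a..<Suc l])" for w
      by (auto simp: torus_def)
    have "iterated_oint (circles_at \<theta>) [a..<Suc l] (integrand {a..l} ?g) w =
      iterated_oint (circles_at \<theta>) [Suc a..<Suc l] (\<lambda>w. oint (circles_at \<theta> a) (\<lambda>z. integrand {a..l} ?g (w(a := z)))) w"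
      unfolding upt by (rule iterated_rotate[OF continuous_on_integrand_regular[OF reg sub(1)] _ w(1)]) simp
    also have "\<dots> = iterated_oint (circles_at \<theta>) [Suc a..<Suc l] (\<lambda>w. inverse (of_real q) ^ d * integrand {Suc a..l} ?g w) w"
      using oint_first_coord[OF a(1)] unfolding a(4) by (rule iterated_cong[OF _ w(2)])
    also have "\<dots> = inverse (of_real q) ^ d * iterated_oint (circles_at \<theta>) [Suc a..<Suc l] (integrand {Suc a..l} ?g) w"
      by (rule iterated_cmult[OF continuous_on_integrand_regular[OF reg sub(2)] w(2)])
    also have "\<dots> = inverse (of_real q) ^ d * inverse (of_real q) ^ (d * (d - 1) div 2)"
      using Suc.IH Suc.prems unfolding a(3) by simp
    also have "\<dots> = inverse (of_real q) ^ (d + d * (d - 1) div 2)"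
      by (simp only: power_add)
    also have "d + d * (d - 1) div 2 = Suc d * (Suc d - 1) div 2"
      by (cases d) auto
    finally show ?case unfolding a(2) .
  qed
  from this[of l "\<lambda>_. 0"] show ?thesis by (simp add: nested_integral_def)
qed

section \<open>The boundary relation\<close>

text \<open>The contour of \<open>w\<^sub>j\<close> as a point set. Unlike the domains \<open>T j\<close>, these sets are pairwise disjoint,
  which keeps the residues below free of singularities.\<close>

definition "K j = circles_image (circles_at \<theta> j)"

lemma K_eq: "K j = (\<Union>p\<in>P. sphere p (\<theta> j * \<rho> p)) \<union> sphere 0 (radius0 j)"
  by (auto simp: K_def circles_image_def circles_at_eq)

lemma K_subset_T: "K j \<subseteq> T j"
  using sphere_subset[of _ _ j] unfolding K_def circles_image_def by auto

lemma torus_K_T: "w \<in> torus K S \<Longrightarrow> w \<in> torus T S"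
  using K_subset_T by (auto simp: torus_def)

lemma contour_family_K: "contour_family (circles_at \<theta>) K"
  by standard (use finite_circles radius_nonneg in \<open>auto simp: K_def circles_image_def\<close>)

lemma sphere_subset_H: "p \<in> P \<Longrightarrow> sphere p (\<theta> j * \<rho> p) \<subseteq> H"
  using scaled_cball_subset(1)[OF _ \<theta>, of p j] sphere_cball[of p "\<theta> j * \<rho> p"] by (meson subset_trans)

text \<open>This is where the radii around the \<open>1 / u\<^sub>j\<close> have to increase strictly with the index.\<close>

lemma K_distinct:
  assumes "a \<in> K i" "b \<in> K j" "i < j" "j \<le> l"
  shows "a \<noteq> b"
proof
  assume ab: "a = b"
  have il: "radius0 i \<le> radius0 l" "radius0 j \<le> radius0 l" using assms radius0_le by auto
  have lt: "radius0 i < radius0 j" using radius0_less[OF assms(3)] q radius0_pos[of j] mult_right_mono[of q 1 "radius0 j"] by linarith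
  have sH: "radius0 l < cmod z" if "p \<in> P" "z \<in> sphere p (\<theta> k * \<rho> p)" for p z k
    using H_outside sphere_subset_H that by blast
  show False
  proof (cases "cmod a \<le> radius0 l")
    case True
    then have "cmod a = radius0 i" "cmod b = radius0 j"
      using assms(1,2) sH ab unfolding K_eq by fastforce+
    then show False using ab lt by simp
  next
    case False
    then obtain p p' where p: "p \<in> P" "a \<in> sphere p (\<theta> i * \<rho> p)" "p' \<in> P" "b \<in> sphere p' (\<theta> j * \<rho> p')"
      using assms(1,2) ab il unfolding K_eq by auto
    have "\<theta> k * \<rho> p \<le> \<rho> p" if "p \<in> P" for p k
      using \<theta>(2)[of k] radius_pos[OF that] by (simp add: mult_le_cancel_right1)
    then have "a \<in> cball p (\<rho> p)" "a \<in> cball p' (\<rho> p')" using p ab by (auto intro: order.trans)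
    then have "p = p'" using cball_disjoint[OF p(1,3)] by blast
    then have "\<theta> i * \<rho> p = \<theta> j * \<rho> p" using p(2,4) ab by auto
    then show False using radius_pos[OF p(1)] strict_monoD[OF \<theta>_mono assms(3)] by simp
  qed
qed

lemma K_distinct':
  assumes "w \<in> torus K S" "i \<in> S" "j \<in> S" "i \<noteq> j" "S \<subseteq> {1..l}"
  shows "w i \<noteq> w j"
  using K_distinct[of "w i" i "w j" j] K_distinct[of "w j" j "w i" i] torusD[OF assms(1)] assms
  by (cases "i < j") (fastforce simp: subset_iff)+

text \<open>The indicator of the part of the contour that surrounds the points \<open>1 / u\<^sub>j\<close>, in a form
  that does not refer to the index of the variable.\<close>

definition "on_u_circle z = (if radius0 l < cmod z then 1 else 0 :: complex)"

lemma continuous_on_on_u_circle: "j \<le> l \<Longrightarrow> continuous_on (K j) on_u_circle"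
  unfolding K_eq
proof (rule continuous_on_closed_Un)
  show "closed (\<Union>p\<in>P. sphere p (\<theta> j * \<rho> p))" using finite_P by auto
  have "on_u_circle z = 1" if "z \<in> (\<Union>p\<in>P. sphere p (\<theta> j * \<rho> p))" for z
  proof -
    have "z \<in> H" using that sphere_subset_H by blast
    then show ?thesis using H_outside by (simp add: on_u_circle_def)
  qed
  then show "continuous_on (\<Union>p\<in>P. sphere p (\<theta> j * \<rho> p)) on_u_circle"
    by (intro continuous_on_eq[OF continuous_on_const[of _ 1]]) simp
next
  assume "j \<le> l"
  then have "on_u_circle z = 0" if "z \<in> sphere 0 (radius0 j)" for z
    using that radius0_le[of j] by (auto simp: on_u_circle_def)
  then show "continuous_on (sphere 0 (radius0 j)) on_u_circle"
    by (intro continuous_on_eq[OF continuous_on_const[of _ 0]]) simp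
qed auto

text \<open>Up to sign, the residue of the function in \<open>oint_last_coord\<close> at \<open>w \<alpha> / q\<close>.\<close>

definition "last_residue h \<alpha> w = h (w \<alpha> / of_real q) * ((w \<alpha> - w \<alpha> / of_real q) / of_real q) *
  (\<Prod>\<beta>\<in>{1..<l} - {\<alpha>}. qkernel q (w \<beta>) (w \<alpha> / of_real q))"

text \<open>All residues sum to 0, so the integral is minus the sum of the residues outside the contour. The
  poles outside are the points \<open>w\<^sub>\<alpha> / q\<close> with \<open>w\<^sub>\<alpha>\<close> near some \<open>1 / u\<^sub>j\<close>; they are simple since the \<open>w\<^sub>\<alpha>\<close> are
  distinct.\<close>

lemma oint_last_coord:
  assumes w: "w \<in> torus K {1..<l}" and h: "h holomorphic_on - ({0} \<union> P)"
    and lim: "((\<lambda>z. z * h z) \<longlongrightarrow> 0) at_infinity"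
  shows "oint (circles_at \<theta> l) (\<lambda>z. h z * (\<Prod>\<alpha>\<in>{1..<l}. qkernel q (w \<alpha>) z)) =
    (\<Sum>\<alpha>\<in>{1..<l}. on_u_circle (w \<alpha>) * last_residue h \<alpha> w)"
proof -
  let ?S = "{1..<l}"
  define \<phi> where "\<phi> z = h z * (\<Prod>\<alpha>\<in>?S. qkernel q (w \<alpha>) z)" for z
  define V where "V = (\<lambda>\<alpha>. w \<alpha> / of_real q) ` ?S"
  define Z where "Z = {0} \<union> P \<union> V"
  define A where "A = {\<alpha>\<in>?S. radius0 l < cmod (w \<alpha>)}"
  have q0: "of_real q \<noteq> (0::complex)" using q by simp
  have sub: "?S \<subseteq> {1..l}" by auto
  have wT: "w \<alpha> \<in> T \<alpha>" if "\<alpha> \<in> ?S" for \<alpha> using torusD[OF w that] K_subset_T by blast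
  have VH: "w \<alpha> / of_real q \<notin> H" if "\<alpha> \<in> ?S" for \<alpha>
    using div_q_T_cases(1)[OF wT[OF that], of l] that by simp
  have inA: "radius0 l < cmod (w \<alpha> / of_real q)" if "\<alpha> \<in> A" for \<alpha>
  proof -
    have "\<alpha> \<in> ?S" "radius0 l < cmod (w \<alpha>)" using that by (auto simp: A_def)
    moreover have "cmod (w \<alpha>) \<le> cmod (w \<alpha> / of_real q)"
      using q mult_right_mono[of q 1 "cmod (w \<alpha>)"] by (simp add: norm_divide field_simps)
    ultimately show ?thesis by linarith
  qed
  have notinA: "cmod (w \<alpha> / of_real q) < radius0 l" if "\<alpha> \<in> ?S" "\<alpha> \<notin> A" for \<alpha>
    using div_q_T_cases(2)[OF wT[OF that(1)], of l] that H_outside[of "w \<alpha>"] by (auto simp: A_def)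
  have finV: "finite V" and finZ: "finite Z" using finite_P by (auto simp: V_def Z_def)
  have holo: "\<phi> holomorphic_on - Z"
    unfolding \<phi>_def[abs_def]
    by (intro holomorphic_on_mult holomorphic_on_subset[OF h] holomorphic_on_subset[OF qkernel_left_holomorphic])
       (auto simp: Z_def V_def)
  have resP: "circ p (\<theta> l * \<rho> p) \<phi> = residue \<phi> p" if "p \<in> P" for p
  proof (rule circ_P_residue[OF finZ holo that \<theta>])
    show "Z \<inter> H \<subseteq> P" using VH zero_notin_H unfolding Z_def V_def by blast
    show "P \<subseteq> Z" by (auto simp: Z_def)
  qed
  let ?B = "Z \<inter> ball 0 (radius0 l)"
  have Pout: "radius0 l < cmod p" if "p \<in> P" for p using that P_subset_H H_outside by blast
  have Vout: "cmod v < radius0 l \<or> (\<exists>\<alpha>\<in>A. v = w \<alpha> / of_real q)" if "v \<in> V" for v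
    using that notinA unfolding V_def by blast
  have sph: "sphere 0 (radius0 l) \<inter> Z = {}"
  proof -
    have "cmod z \<noteq> radius0 l" if zZ: "z \<in> Z" for z
    proof -
      consider "z = 0" | "z \<in> P" | "z \<in> V" using zZ unfolding Z_def by blast
      then show ?thesis
      proof cases
        case 3
        then show ?thesis using Vout[OF 3] inA by fastforce
      qed (use Pout[of z] radius0_pos[of l] in auto)
    qed
    then show ?thesis by auto
  qed
  have res0: "circ 0 (radius0 l) \<phi> = (\<Sum>z\<in>?B. residue \<phi> z)"
    by (rule circ_residues[OF finZ holo radius0_pos sph])
  \<comment> \<open>the poles at the \<open>1 / u\<^sub>j\<close>, those inside the circle around the origin, and those outside the contour\<close>
  have decomp: "Z = P \<union> (?B \<union> (\<lambda>\<alpha>. w \<alpha> / of_real q) ` A)"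
  proof (intro equalityI subsetI)
    fix z assume "z \<in> Z"
    then consider "z = 0" | "z \<in> P" | "z \<in> V" by (auto simp: Z_def)
    then show "z \<in> P \<union> (?B \<union> (\<lambda>\<alpha>. w \<alpha> / of_real q) ` A)"
    proof cases
      case 1
      then show ?thesis using radius0_pos[of l] by (simp add: Z_def)
    next
      case 3
      then show ?thesis using Vout[OF 3] \<open>z \<in> Z\<close> by auto
    qed simp
  qed (auto simp: Z_def V_def A_def)
  have disj: "P \<inter> (?B \<union> (\<lambda>\<alpha>. w \<alpha> / of_real q) ` A) = {}" "?B \<inter> (\<lambda>\<alpha>. w \<alpha> / of_real q) ` A = {}"
  proof -
    have "p \<notin> ?B" if "p \<in> P" for p using Pout[OF that] by simp
    moreover have "p \<notin> (\<lambda>\<alpha>. w \<alpha> / of_real q) ` A" if "p \<in> P" for p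
      using VH that P_subset_H by (auto simp: A_def)
    ultimately show "P \<inter> (?B \<union> (\<lambda>\<alpha>. w \<alpha> / of_real q) ` A) = {}" by blast
    have "z \<notin> ball 0 (radius0 l)" if "z \<in> (\<lambda>\<alpha>. w \<alpha> / of_real q) ` A" for z
      using that inA by fastforce
    then show "?B \<inter> (\<lambda>\<alpha>. w \<alpha> / of_real q) ` A = {}" by blast
  qed
  have inj: "inj_on (\<lambda>\<alpha>. w \<alpha> / of_real q) A"
  proof (rule inj_onI, rule ccontr)
    fix \<alpha> \<beta> assume "\<alpha> \<in> A" "\<beta> \<in> A" "w \<alpha> / of_real q = w \<beta> / of_real q" "\<alpha> \<noteq> \<beta>"
    then show False using K_distinct'[OF w _ _ _ sub, of \<alpha> \<beta>] q0 by (auto simp: A_def)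
  qed
  have total: "(\<Sum>z\<in>Z. residue \<phi> z) = 0"
  proof (rule sum_residues_eq_0[OF finZ holo])
    have "((\<lambda>z. (z * h z) * (\<Prod>\<alpha>\<in>?S. qkernel q (w \<alpha>) z)) \<longlongrightarrow> 0 * (\<Prod>\<alpha>\<in>?S. - 1 / - of_real q)) at_infinity"
    proof (intro tendsto_mult lim tendsto_prod)
      fix \<alpha>
      show "(qkernel q (w \<alpha>) \<longlongrightarrow> - 1 / - of_real q) at_infinity"
        using tendsto_moebius_at_infinity[of "- of_real q" "w \<alpha>" "- 1" "w \<alpha>"] q0
        by (simp add: qkernel_def[abs_def])
    qed
    then show "((\<lambda>z. z * \<phi> z) \<longlongrightarrow> 0) at_infinity" by (simp add: \<phi>_def mult.assoc)
  qed
  have "(\<Sum>z\<in>P \<union> (?B \<union> (\<lambda>\<alpha>. w \<alpha> / of_real q) ` A). residue \<phi> z) =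
     (\<Sum>p\<in>P. residue \<phi> p) + ((\<Sum>z\<in>?B. residue \<phi> z) + (\<Sum>z\<in>(\<lambda>\<alpha>. w \<alpha> / of_real q) ` A. residue \<phi> z))"
    using finZ finite_P by (subst sum.union_disjoint, (use disj in \<open>simp_all add: A_def\<close>)[3], subst sum.union_disjoint)
      (use disj in \<open>simp_all add: A_def\<close>)
  also have "(\<Sum>z\<in>(\<lambda>\<alpha>. w \<alpha> / of_real q) ` A. residue \<phi> z) = (\<Sum>\<alpha>\<in>A. residue \<phi> (w \<alpha> / of_real q))"
    by (subst sum.reindex[OF inj]) simp
  finally have "oint (circles_at \<theta> l) \<phi> = - (\<Sum>\<alpha>\<in>A. residue \<phi> (w \<alpha> / of_real q))"
    using total unfolding decomp[symmetric] oint_circles_at by (simp add: resP res0 add_eq_0_iff2)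
  also have "\<dots> = (\<Sum>\<alpha>\<in>A. last_residue h \<alpha> w)"
    unfolding sum_negf[symmetric]
  proof (rule sum.cong[OF refl])
    fix \<alpha> assume \<alpha>: "\<alpha> \<in> A"
    then have \<alpha>S: "\<alpha> \<in> ?S" by (simp add: A_def)
    define \<psi> where "\<psi> z = h z * (- (w \<alpha> - z) / of_real q) * (\<Prod>\<beta>\<in>?S - {\<alpha>}. qkernel q (w \<beta>) z)" for z
    define Y where "Y = {0} \<union> P \<union> (\<lambda>\<beta>. w \<beta> / of_real q) ` (?S - {\<alpha>})"
    have "qkernel q (w \<alpha>) z = (- (w \<alpha> - z) / of_real q) / (z - w \<alpha> / of_real q)" for z
    proof -
      have "w \<alpha> - of_real q * z = - of_real q * (z - w \<alpha> / of_real q)" using q0 by (simp add: field_simps)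
      then show ?thesis unfolding qkernel_def by (simp only: divide_divide_eq_left mult_minus_left divide_minus_right minus_divide_left)
    qed
    then have "\<phi> z = \<psi> z / (z - w \<alpha> / of_real q)" for z
      using prod.remove[of ?S \<alpha> "\<lambda>\<alpha>. qkernel q (w \<alpha>) z"] \<alpha>S by (simp add: \<phi>_def \<psi>_def)
    then have "residue \<phi> (w \<alpha> / of_real q) = residue (\<lambda>z. \<psi> z / (z - w \<alpha> / of_real q)) (w \<alpha> / of_real q)"
      by (metis ext)
    also have "\<dots> = \<psi> (w \<alpha> / of_real q)"
    proof (rule residue_simple[of "- Y"])
      show "open (- Y)" using finite_P by (auto simp: Y_def intro!: open_Compl finite_imp_closed)
      show "\<psi> holomorphic_on - Y"
        unfolding \<psi>_def[abs_def]
        by (intro holomorphic_intros holomorphic_on_subset[OF h] holomorphic_on_subset[OF qkernel_left_holomorphic] q0)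
           (auto simp: Y_def)
      have "w \<alpha> / of_real q \<noteq> w \<beta> / of_real q" if "\<beta> \<in> ?S - {\<alpha>}" for \<beta>
        using K_distinct'[OF w \<alpha>S _ _ sub, of \<beta>] that q0 by auto
      moreover have "w \<alpha> / of_real q \<noteq> 0" using inA[OF \<alpha>] radius0_pos[of l] by auto
      moreover have "w \<alpha> / of_real q \<notin> P" using VH[OF \<alpha>S] P_subset_H by blast
      ultimately show "w \<alpha> / of_real q \<in> - Y" unfolding Y_def by blast
    qed
    finally show "- residue \<phi> (w \<alpha> / of_real q) = last_residue h \<alpha> w"
      by (simp add: \<psi>_def last_residue_def left_diff_distrib right_diff_distrib diff_divide_distrib)
  qed
  also have "\<dots> = (\<Sum>\<alpha>\<in>?S. on_u_circle (w \<alpha>) * last_residue h \<alpha> w)"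
    by (rule sum.mono_neutral_cong_left) (auto simp: A_def on_u_circle_def)
  finally show ?thesis by (simp add: \<phi>_def[abs_def])
qed

text \<open>The combination of \<open>boundary_fun_eq\<close> in a form that shows its decay at infinity.\<close>

definition boundary_fun :: "nat \<Rightarrow> complex \<Rightarrow> complex" where
  "boundary_fun t z = inverse z * (\<Prod>j=1..t. (1 - of_real (q * u j) * z) / (1 - of_real (u j) * z)) *
    ((1 - of_real q) / (1 - of_real (u (Suc t)) * z))"

lemma boundary_fun_holomorphic: "t < n \<Longrightarrow> boundary_fun t holomorphic_on - ({0} \<union> P)"
  unfolding boundary_fun_def[abs_def]
  by (intro holomorphic_intros u_factor_nonzero) auto

lemma boundary_fun_decay:
  assumes "t < n"
  shows "((\<lambda>z. z * boundary_fun t z) \<longlongrightarrow> 0) at_infinity"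
proof -
  have u: "of_real (u j) \<noteq> (0::complex)" if "j \<in> {1..Suc t}" for j
    using u_pos[of j] that assms by auto
  have "((\<lambda>z :: complex. (\<Prod>j=1..t. (1 - of_real (q * u j) * z) / (1 - of_real (u j) * z)) *
      ((1 - of_real q) / (1 - of_real (u (Suc t)) * z))) \<longlongrightarrow>
      (\<Prod>j=1..t. - of_real (q * u j) / - of_real (u j)) * (0 / - of_real (u (Suc t)))) at_infinity"
  proof (intro tendsto_mult tendsto_prod)
    show "((\<lambda>z :: complex. (1 - of_real (q * u j) * z) / (1 - of_real (u j) * z)) \<longlongrightarrow>
        - of_real (q * u j) / - of_real (u j)) at_infinity" if "j \<in> {1..t}" for j
      using tendsto_moebius_at_infinity[of "- of_real (u j)" 1 "- of_real (q * u j)" 1] u[of j] that by simp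
    show "((\<lambda>z :: complex. (1 - of_real q) / (1 - of_real (u (Suc t)) * z)) \<longlongrightarrow> 0 / - of_real (u (Suc t))) at_infinity"
      using tendsto_moebius_at_infinity[of "- of_real (u (Suc t))" "1 - of_real q" 0 1] u[of "Suc t"] by simp
  qed
  moreover have "\<forall>\<^sub>F z in at_infinity. (\<Prod>j=1..t. (1 - of_real (q * u j) * z) / (1 - of_real (u j) * z)) *
      ((1 - of_real q) / (1 - of_real (u (Suc t)) * z)) = z * boundary_fun t z"
  proof -
    have "\<forall>\<^sub>F z :: complex in at_infinity. z \<noteq> 0"
      by (auto simp: eventually_at_infinity intro!: exI[of _ 1])
    then show ?thesis by (rule eventually_mono) (simp add: boundary_fun_def)
  qed
  ultimately show ?thesis by (simp add: tendsto_cong)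
qed

lemma boundary_fun_eq:
  assumes "t < n" "z \<notin> P"
  shows "boundary_fun t z = point_fun q s u 1 (Suc t) z - of_real q * point_fun q s u 1 t z"
proof -
  have "1 - of_real (u (Suc t)) * z \<noteq> 0" using u_factor_nonzero[of "Suc t" z] assms by simp
  then have "(1 - of_real q) / (1 - of_real (u (Suc t)) * z) =
      (1 - of_real (q * u (Suc t)) * z) / (1 - of_real (u (Suc t)) * z) - of_real q"
    by (simp add: divide_simps) (simp add: algebra_simps)
  note eq = this
  show ?thesis unfolding boundary_fun_def eq by (simp add: point_fun_def right_diff_distrib)
qed

text \<open>The numerators of \<open>boundary_fun\<close> at \<open>z / q\<close> cancel the denominators of \<open>point_fun\<close> at \<open>z\<close>, that is, all
  poles at the points \<open>1 / u\<^sub>j\<close>.\<close>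

lemma point_fun_times_boundary_fun:
  assumes "t < n" "z \<notin> P"
  shows "point_fun q s u x t z * boundary_fun t (z / of_real q) = inverse z *
     ((1 - of_real s * z) / (1 - inverse (of_real s) * z)) ^ (x - 1) * inverse (z / of_real q) *
     (\<Prod>j=1..t. (1 - of_real (q * u j) * z) / (1 - of_real (u j) * (z / of_real q))) *
     ((1 - of_real q) / (1 - of_real (u (Suc t)) * (z / of_real q)))"
proof -
  have "(\<Prod>j=1..t. (1 - of_real (q * u j) * z) / (1 - of_real (u j) * z)) *
      (\<Prod>j=1..t. (1 - of_real (q * u j) * (z / of_real q)) / (1 - of_real (u j) * (z / of_real q))) =
      (\<Prod>j=1..t. (1 - of_real (q * u j) * z) / (1 - of_real (u j) * (z / of_real q)))"
    unfolding prod.distrib[symmetric]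
  proof (rule prod.cong[OF refl])
    fix j assume "j \<in> {1..t}"
    then have "1 - of_real (u j) * z \<noteq> 0" using u_factor_nonzero[of j z] assms by simp
    moreover have "1 - of_real (q * u j) * (z / of_real q) = 1 - of_real (u j) * z" using q by simp
    ultimately show "(1 - of_real (q * u j) * z) / (1 - of_real (u j) * z) *
        ((1 - of_real (q * u j) * (z / of_real q)) / (1 - of_real (u j) * (z / of_real q))) =
        (1 - of_real (q * u j) * z) / (1 - of_real (u j) * (z / of_real q))"
      by simp
  qed
  then show ?thesis unfolding point_fun_def boundary_fun_def by (simp only: mult_ac)
qed

lemma K_div_q_notin:
  assumes "a \<in> K \<alpha>" "\<alpha> < l"
  shows "a / of_real q \<notin> {0} \<union> P"
proof -
  have "a \<in> T \<alpha>" using assms(1) K_subset_T by blast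
  then have "a / of_real q \<notin> H" "a \<noteq> 0"
    using div_q_T_cases(1)[OF _ assms(2) order_refl] T_nonzero by blast+
  then show ?thesis using P_subset_H q by auto
qed

lemma continuous_on_last_residue:
  assumes h: "h holomorphic_on - ({0} \<union> P)" and \<alpha>: "\<alpha> \<in> {1..<l}"
  shows "continuous_on (torus K {1..<l}) (last_residue h \<alpha>)"
  unfolding last_residue_def[abs_def] qkernel_def
proof (intro continuous_intros continuous_on_coord ballI)
  have q0: "of_real q \<noteq> (0::complex)" using q by simp
  have wa: "w \<alpha> \<in> K \<alpha>" if "w \<in> torus K {1..<l}" for w using torusD[OF that \<alpha>] .
  show "continuous_on (torus K {1..<l}) (\<lambda>w. h (w \<alpha> / of_real q))"
  proof (rule continuous_on_compose2[OF holomorphic_on_imp_continuous_on[OF h]])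
    show "continuous_on (torus K {1..<l}) (\<lambda>w. w \<alpha> / of_real q)"
      using q0 by (intro continuous_intros continuous_on_coord) auto
    show "(\<lambda>w. w \<alpha> / of_real q) ` torus K {1..<l} \<subseteq> - ({0} \<union> P)"
      using K_div_q_notin[OF wa] \<alpha> by (intro image_subsetI ComplI) simp
  qed
  show "of_real q \<noteq> (0::complex)" by (rule q0)
  fix \<beta> w assume \<beta>: "\<beta> \<in> {1..<l} - {\<alpha>}" and w: "w \<in> torus K {1..<l}"
  have sub: "{1..<l} \<subseteq> {1..l}" by auto
  have "w \<beta> \<noteq> w \<alpha>" using K_distinct'[OF w _ \<alpha> _ sub, of \<beta>] \<beta> by blast
  then show "w \<beta> - of_real q * (w \<alpha> / of_real q) \<noteq> 0" using q0 by simp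
qed (use q in auto)

text \<open>Taking the residue at \<open>w\<^sub>l = z / q\<close> creates denominators \<open>w\<^sub>\<beta> - z\<close>; the numerators of the kernel factors
  between \<open>w\<^sub>\<beta>\<close> and \<open>z\<close> cancel them.\<close>

lemma residue_integrand_cancel:
  assumes \<alpha>: "\<alpha> \<in> {1..<l}" and t: "t < n" and z: "z \<notin> P"
    and distinct: "\<And>\<beta>. \<beta> \<in> {1..<l} - {\<alpha>} \<Longrightarrow> w \<beta> \<noteq> z"
    and g: "g \<alpha> = point_fun q s u x t"
  shows "integrand {1..<l} g (w(\<alpha> := z)) * last_residue (boundary_fun t) \<alpha> (w(\<alpha> := z)) =
    integrand ({1..<l} - {\<alpha>}) g w * ((point_fun q s u x t z * boundary_fun t (z / of_real q)) *
      ((z - z / of_real q) / of_real q) *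
      (\<Prod>\<beta>\<in>{\<beta>\<in>{1..<l}. \<beta> < \<alpha>}. (w \<beta> - z / of_real q) / (w \<beta> - of_real q * z)) *
      (\<Prod>\<beta>\<in>{\<beta>\<in>{1..<l}. \<alpha> < \<beta>}. - ((w \<beta> - z / of_real q) / (z - of_real q * w \<beta>))))"
proof -
  let ?A = "{\<beta>\<in>{1..<l}. \<beta> < \<alpha>}" and ?B = "{\<beta>\<in>{1..<l}. \<alpha> < \<beta>}"
  have q0: "of_real q \<noteq> (0::complex)" using q by simp
  have AB: "{1..<l} - {\<alpha>} = ?A \<union> ?B" "?A \<inter> ?B = {}" by auto
  have "(\<Prod>\<beta>\<in>{1..<l} - {\<alpha>}. qkernel q ((w(\<alpha> := z)) \<beta>) (z / of_real q)) =
      (\<Prod>\<beta>\<in>{1..<l} - {\<alpha>}. qkernel q (w \<beta>) (z / of_real q))"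
    by (rule prod.cong) auto
  also have "\<dots> = (\<Prod>\<beta>\<in>?A. qkernel q (w \<beta>) (z / of_real q)) * (\<Prod>\<beta>\<in>?B. qkernel q (w \<beta>) (z / of_real q))"
    unfolding AB(1) by (rule prod.union_disjoint[OF _ _ AB(2)]) auto
  finally have res: "last_residue (boundary_fun t) \<alpha> (w(\<alpha> := z)) =
      boundary_fun t (z / of_real q) * ((z - z / of_real q) / of_real q) *
      ((\<Prod>\<beta>\<in>?A. qkernel q (w \<beta>) (z / of_real q)) * (\<Prod>\<beta>\<in>?B. qkernel q (w \<beta>) (z / of_real q)))"
    unfolding last_residue_def by (simp only: fun_upd_same)
  have A: "(\<Prod>\<beta>\<in>?A. qkernel q (w \<beta>) z) * (\<Prod>\<beta>\<in>?A. qkernel q (w \<beta>) (z / of_real q)) =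
      (\<Prod>\<beta>\<in>?A. (w \<beta> - z / of_real q) / (w \<beta> - of_real q * z))"
    unfolding prod.distrib[symmetric]
  proof (rule prod.cong[OF refl])
    fix \<beta> assume "\<beta> \<in> ?A"
    then have "w \<beta> - z \<noteq> 0" using distinct[of \<beta>] by auto
    then show "qkernel q (w \<beta>) z * qkernel q (w \<beta>) (z / of_real q) =
        (w \<beta> - z / of_real q) / (w \<beta> - of_real q * z)"
      using q0 by (simp add: qkernel_def)
  qed
  have cancel: "- d / e * (f / d) = - (f / e)" if "d \<noteq> 0" for d e f :: complex
    using that by simp
  have B: "(\<Prod>\<beta>\<in>?B. qkernel q z (w \<beta>)) * (\<Prod>\<beta>\<in>?B. qkernel q (w \<beta>) (z / of_real q)) =
      (\<Prod>\<beta>\<in>?B. - ((w \<beta> - z / of_real q) / (z - of_real q * w \<beta>)))"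
    unfolding prod.distrib[symmetric]
  proof (rule prod.cong[OF refl])
    fix \<beta> assume "\<beta> \<in> ?B"
    then have nz: "w \<beta> - z \<noteq> 0" using distinct[of \<beta>] by auto
    have "qkernel q z (w \<beta>) * qkernel q (w \<beta>) (z / of_real q) =
        - (w \<beta> - z) / (z - of_real q * w \<beta>) * ((w \<beta> - z / of_real q) / (w \<beta> - z))"
      using q0 by (simp add: qkernel_def)
    also have "\<dots> = - ((w \<beta> - z / of_real q) / (z - of_real q * w \<beta>))" by (rule cancel[OF nz])
    finally show "qkernel q z (w \<beta>) * qkernel q (w \<beta>) (z / of_real q) =
        - ((w \<beta> - z / of_real q) / (z - of_real q * w \<beta>))" .
  qed
  show ?thesis
    unfolding integrand_remove_coord[OF finite_atLeastLessThan \<alpha>] res g A[symmetric] B[symmetric]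
    by (simp only: mult_ac)
qed

text \<open>On the circles around the \<open>1 / u\<^sub>j\<close> the integrand agrees with a function \<open>\<Psi>\<close> that is holomorphic in the
  discs; on the circle around the origin it vanishes because of the indicator.\<close>

lemma oint_residue_integrand_eq_0:
  assumes \<alpha>: "\<alpha> \<in> {1..<l}" and t: "t < n" and g: "g \<alpha> = point_fun q s u x t"
    and w: "w \<in> torus K {1..<l}"
  shows "oint (circles_at \<theta> \<alpha>) (\<lambda>z. on_u_circle z *
    (integrand {1..<l} g (w(\<alpha> := z)) * last_residue (boundary_fun t) \<alpha> (w(\<alpha> := z)))) = 0"
proof -
  let ?S = "{1..<l}"
  let ?F = "\<lambda>z. on_u_circle z * (integrand ?S g (w(\<alpha> := z)) * last_residue (boundary_fun t) \<alpha> (w(\<alpha> := z)))"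
  have q0: "of_real q \<noteq> (0::complex)" using q by simp
  have cl: "radius0 \<alpha> \<le> radius0 l" using \<alpha> radius0_le by auto
  have "circ 0 (radius0 \<alpha>) ?F = circ 0 (radius0 \<alpha>) (\<lambda>_. 0)"
    using radius0_pos[of \<alpha>] cl by (intro circ_cong) (auto simp: on_u_circle_def)
  then have c0: "circ 0 (radius0 \<alpha>) ?F = 0" by (simp add: circ_def)
  define e where "e z = inverse z * ((1 - of_real s * z) / (1 - inverse (of_real s) * z)) ^ (x - 1) * inverse (z / of_real q) *
     (\<Prod>j=1..t. (1 - of_real (q * u j) * z) / (1 - of_real (u j) * (z / of_real q))) *
     ((1 - of_real q) / (1 - of_real (u (Suc t)) * (z / of_real q)))" for z :: complex
  define \<Psi> where "\<Psi> z = integrand (?S - {\<alpha>}) g w * (e z * ((z - z / of_real q) / of_real q) *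
      (\<Prod>\<beta>\<in>{\<beta>\<in>?S. \<beta> < \<alpha>}. (w \<beta> - z / of_real q) / (w \<beta> - of_real q * z)) *
      (\<Prod>\<beta>\<in>{\<beta>\<in>?S. \<alpha> < \<beta>}. - ((w \<beta> - z / of_real q) / (z - of_real q * w \<beta>))))" for z
  define Z where "Z = {0, of_real s} \<union> (\<lambda>p. of_real q * p) ` P \<union> poles ?S w \<alpha>"
  have finZ: "finite Z" using finite_P finite_poles[of ?S] by (simp add: Z_def)
  have wT: "w \<beta> \<in> T \<beta>" if "\<beta> \<in> ?S" for \<beta> using torusD[OF w that] K_subset_T by blast
  have holo: "\<Psi> holomorphic_on - Z"
  proof -
    have uq: "1 - of_real (u j) * (z / of_real q) \<noteq> 0" if "z \<in> - Z" "j \<in> {1..n}" for z j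
    proof (rule u_factor_nonzero[OF that(2)])
      show "z / of_real q \<notin> P"
      proof
        assume "z / of_real q \<in> P"
        then have "of_real q * (z / of_real q) \<in> (\<lambda>p. of_real q * p) ` P" by blast
        then show False using that(1) q0 by (simp add: Z_def)
      qed
    qed
    have pl: "w \<beta> - of_real q * z \<noteq> 0" if "z \<in> - Z" "\<beta> \<in> ?S" "\<beta> < \<alpha>" for z \<beta>
    proof
      assume "w \<beta> - of_real q * z = 0"
      then have "z = w \<beta> / of_real q" using q0 by (simp add: field_simps)
      then show False using that by (auto simp: Z_def poles_def)
    qed
    have pr: "z - of_real q * w \<beta> \<noteq> 0" if "z \<in> - Z" "\<beta> \<in> ?S" "\<alpha> < \<beta>" for z \<beta>
      using that by (auto simp: Z_def poles_def)
    have "e holomorphic_on - Z"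
      unfolding e_def[abs_def]
    proof (intro holomorphic_intros)
      fix z assume "z \<in> - Z"
      then show "1 - inverse (of_real s) * z \<noteq> 0" by (intro s_factor_nonzero) (auto simp: Z_def)
    qed (use uq t q0 in \<open>auto simp: Z_def\<close>)
    then show ?thesis
      unfolding \<Psi>_def[abs_def] using q0 pl pr by (intro holomorphic_intros) auto
  qed
  have "circ p (\<theta> \<alpha> * \<rho> p) ?F = 0" if p: "p \<in> P" for p
  proof -
    note sub = scaled_cball_subset[OF p \<theta>, of \<alpha>]
    have "circ p (\<theta> \<alpha> * \<rho> p) ?F = circ p (\<theta> \<alpha> * \<rho> p) \<Psi>"
    proof (rule circ_cong)
      show "0 \<le> \<theta> \<alpha> * \<rho> p" using sub(3) by simp
      fix z assume z: "z \<in> sphere p (\<theta> \<alpha> * \<rho> p)"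
      then have zK: "z \<in> K \<alpha>" and zH: "z \<in> H" using p sphere_subset_H unfolding K_eq by blast+
      have zP: "z \<notin> P" using zK K_subset_T T_notin_P[of \<alpha> z] \<alpha> by auto
      have on: "on_u_circle z = 1" using H_outside[OF zH] by (simp add: on_u_circle_def)
      have wz: "w \<beta> \<noteq> z" if "\<beta> \<in> ?S - {\<alpha>}" for \<beta>
      proof -
        have wK: "w \<beta> \<in> K \<beta>" using torusD[OF w] that by blast
        show ?thesis
        proof (cases "\<beta> < \<alpha>")
          case True
          then show ?thesis using K_distinct[OF wK zK] \<alpha> by auto
        next
          case False
          then show ?thesis using K_distinct[OF zK wK] that by auto
        qed
      qed
      have e: "point_fun q s u x t z * boundary_fun t (z / of_real q) = e z"
        unfolding e_def by (rule point_fun_times_boundary_fun[OF t zP])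
      show "?F z = \<Psi> z"
        unfolding on mult_1 \<Psi>_def e[symmetric] by (rule residue_integrand_cancel[where g=g and x=x, OF \<alpha> t zP wz g])
    qed
    also have "\<dots> = 0"
    proof (rule circ_P_eq_0[OF finZ holo p \<theta>])
      have "z \<notin> H" if "z \<in> Z" for z
      proof -
        consider "z = 0 \<or> z = of_real s" | p where "p \<in> P" "z = of_real q * p"
          | \<beta> where "\<beta> \<in> ?S" "\<beta> < \<alpha>" "z = w \<beta> / of_real q" | \<beta> where "\<beta> \<in> ?S" "\<alpha> < \<beta>" "z = of_real q * w \<beta>"
          using \<open>z \<in> Z\<close> unfolding Z_def poles_def by blast
        then show ?thesis
        proof cases
          case 1
          then show ?thesis using zero_notin_H s_outside(1) by blast
        next
          case 2
          then show ?thesis using q_mult_notin_H P_subset_H by blast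
        next
          case 3
          then show ?thesis using div_q_T_cases(1)[OF wT[OF 3(1)] 3(2)] \<alpha> by simp
        next
          case 4
          then show ?thesis using mult_q_T_cases(1)[OF wT[OF 4(1)] 4(2)] by simp
        qed
      qed
      then show "Z \<inter> H = {}" by blast
    qed
    finally show ?thesis .
  qed
  then show ?thesis unfolding oint_circles_at c0 by simp
qed

lemma nested_integral_boundary_eq_0:
  assumes l: "1 \<le> l" and t: "t < n" and reg: "regular g"
    and g: "\<And>i. i \<in> {1..<l} \<Longrightarrow> g i = point_fun q s u (x i) t" and gl: "g l = boundary_fun t"
  shows "nested_integral g = 0"
proof -
  let ?S = "{1..<l}"
  interpret KF: contour_family "circles_at \<theta>" K by (rule contour_family_K)
  have sub: "?S \<subseteq> {1..l}" and lS: "l \<in> {1..l}" using l by auto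
  have sets: "{1..l} - {l} = ?S" "{\<alpha>\<in>{1..l}. \<alpha> < l} = ?S" "{\<beta>\<in>{1..l}. l < \<beta>} = {}" by auto
  define F where "F \<alpha> w = on_u_circle (w \<alpha>) * (integrand ?S g w * last_residue (boundary_fun t) \<alpha> w)" for \<alpha> w
  have contF: "continuous_on (torus K ?S) (F \<alpha>)" if \<alpha>: "\<alpha> \<in> ?S" for \<alpha>
    unfolding F_def[abs_def]
  proof (intro continuous_on_mult continuous_on_last_residue boundary_fun_holomorphic t \<alpha>)
    show "continuous_on (torus K ?S) (\<lambda>w. on_u_circle (w \<alpha>))"
      by (rule continuous_on_compose2[OF continuous_on_on_u_circle[of \<alpha>] continuous_on_coord])
         (use \<alpha> torusD in \<open>auto simp: image_subset_iff\<close>)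
    show "continuous_on (torus K ?S) (integrand ?S g)"
      using continuous_on_integrand_regular[OF reg sub] by (rule continuous_on_subset) (use torus_K_T in blast)
  qed
  have inner: "oint (circles_at \<theta> l) (\<lambda>z. integrand {1..l} g (w(l := z))) = (\<Sum>\<alpha>\<in>?S. F \<alpha> w)"
    if w: "w \<in> torus K ?S" for w
  proof -
    define C where "C = integrand ?S g w"
    have "((\<lambda>z. C * (z * boundary_fun t z)) \<longlongrightarrow> C * 0) at_infinity"
      by (intro tendsto_intros boundary_fun_decay[OF t])
    then have lim: "((\<lambda>z. z * (C * boundary_fun t z)) \<longlongrightarrow> 0) at_infinity"
      by (simp add: mult.left_commute)
    have "(\<lambda>z. integrand {1..l} g (w(l := z))) = (\<lambda>z. (C * boundary_fun t z) * (\<Prod>\<alpha>\<in>?S. qkernel q (w \<alpha>) z))"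
      unfolding integrand_remove_coord[OF finite_atLeastAtMost lS] sets gl C_def by (simp add: mult_ac)
    then have "oint (circles_at \<theta> l) (\<lambda>z. integrand {1..l} g (w(l := z))) =
        (\<Sum>\<alpha>\<in>?S. on_u_circle (w \<alpha>) * last_residue (\<lambda>z. C * boundary_fun t z) \<alpha> w)"
      using oint_last_coord[OF w _ lim] boundary_fun_holomorphic[OF t] by (simp add: holomorphic_on_mult)
    also have "\<dots> = (\<Sum>\<alpha>\<in>?S. F \<alpha> w)"
      by (rule sum.cong[OF refl]) (simp add: F_def last_residue_def C_def mult_ac)
    finally show ?thesis .
  qed
  have upt: "[1..<Suc l] = [1..<l] @ [l]" using l by simp
  have tor: "(\<lambda>_. 0) \<in> torus K (?S - set [1..<l])" by (simp add: torus_def)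
  have "nested_integral g = iterated_oint (circles_at \<theta>) [1..<l] (\<lambda>w. oint (circles_at \<theta> l) (\<lambda>z. integrand {1..l} g (w(l := z)))) (\<lambda>_. 0)"
  proof -
    have "iterated_oint (circles_at \<theta>) [l] (integrand {1..l} g) =
        (\<lambda>w. oint (circles_at \<theta> l) (\<lambda>z. integrand {1..l} g (w(l := z))))"
      by (rule ext) simp
    then show ?thesis unfolding nested_integral_def upt iterated_oint_append by simp
  qed
  also have "\<dots> = iterated_oint (circles_at \<theta>) [1..<l] (\<lambda>w. \<Sum>\<alpha>\<in>?S. F \<alpha> w) (\<lambda>_. 0)"
    using inner tor by (rule KF.iterated_cong)
  also have "\<dots> = 0"
  proof (rule KF.iterated_sum_eq_0[OF _ contF _ tor])
    fix \<alpha> assume \<alpha>: "\<alpha> \<in> ?S"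
    show "iterated_oint (circles_at \<theta>) [1..<l] (F \<alpha>) (\<lambda>_. 0) = 0"
    proof (rule KF.iterated_zero_coord[OF contF[OF \<alpha>] _ _ _ tor, of \<alpha>])
      show "K \<alpha> \<noteq> {}" using radius0_pos[of \<alpha>] unfolding K_eq by (auto intro!: exI[of _ "of_real (radius0 \<alpha>)"])
      show "oint (circles_at \<theta> \<alpha>) (\<lambda>z. F \<alpha> (w(\<alpha> := z))) = 0" if "w \<in> torus K ?S" for w
        unfolding F_def fun_upd_same by (rule oint_residue_integrand_eq_0[where g=g, OF \<alpha> t g[OF \<alpha>] that])
    qed (use \<alpha> in auto)
  qed simp_all
  finally show ?thesis .
qed

lemma nested_integral_boundary:
  assumes l: "1 \<le> l" and t: "t < n" and g: "\<And>i. i \<in> {1..<l} \<Longrightarrow> g i = point_fun q s u (x i) t"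
  shows "nested_integral (g(l := point_fun q s u 1 (Suc t))) = of_real q * nested_integral (g(l := point_fun q s u 1 t))"
proof -
  have lS: "l \<in> {1..l}" using l by simp
  have reg: "regular (g(l := f))" if "f holomorphic_on - ({0, of_real s} \<union> P)" for f
  proof -
    have "(g(l := f)) i holomorphic_on - ({0, of_real s} \<union> P)" if "i \<in> {1..l}" for i
    proof (cases "i = l")
      case False
      then have "i \<in> {1..<l}" using that by auto
      with False show ?thesis using point_fun_holomorphic[of t "x i"] t by (simp add: g)
    qed (use \<open>f holomorphic_on _\<close> in simp)
    then show ?thesis unfolding regular_def by blast
  qed
  have pf: "regular (g(l := point_fun q s u 1 (Suc t)))" "regular (g(l := point_fun q s u 1 t))"
    using t by (intro reg point_fun_holomorphic; simp)+
  have "nested_integral (g(l := boundary_fun t)) = nested_integral (g(l := \<lambda>z. 1 * point_fun q s u 1 (Suc t) z + - of_real q * point_fun q s u 1 t z))"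
    using boundary_fun_eq[OF t T_notin_P] by (intro nested_integral_cong) auto
  also have "\<dots> = 1 * nested_integral (g(l := point_fun q s u 1 (Suc t))) + - of_real q * nested_integral (g(l := point_fun q s u 1 t))"
    by (rule nested_integral_linear[OF lS pf])
  also have "nested_integral (g(l := boundary_fun t)) = 0"
  proof (rule nested_integral_boundary_eq_0[OF l t reg, where x=x])
    show "boundary_fun t holomorphic_on - ({0, of_real s} \<union> P)"
      by (rule holomorphic_on_subset[OF boundary_fun_holomorphic[OF t]]) auto
  qed (auto simp: g)
  finally have eq: "0 = 1 * nested_integral (g(l := point_fun q s u 1 (Suc t))) + - of_real q * nested_integral (g(l := point_fun q s u 1 t))" .
  have "a = c * b" if "0 = 1 * a + - c * b" for a b c :: complex using that by simp
  from this[OF eq] show ?thesis .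
qed

section \<open>The moment formula\<close>

definition "chain X \<longleftrightarrow> (\<forall>i\<in>{1..l}. \<forall>j\<in>{1..l}. i \<le> j \<longrightarrow> X j \<le> X i) \<and> (\<forall>i\<in>{1..l}. 1 \<le> X i)"

definition "two_time_funs X t k i = point_fun q s u (X i) (if i \<le> k then t else Suc t)"

lemma point_fun_regular: "(\<And>i. i \<in> {1..l} \<Longrightarrow> \<tau> i \<le> n) \<Longrightarrow> regular (\<lambda>i. point_fun q s u (X i) (\<tau> i))"
  unfolding regular_def by (intro ballI point_fun_holomorphic)

lemma regular_upd: "regular g \<Longrightarrow> f holomorphic_on - ({0, of_real s} \<union> P) \<Longrightarrow> regular (g(i := f))"
  by (simp add: regular_def)

lemma two_time_funs_regular: "t < n \<Longrightarrow> regular (two_time_funs X t k)"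
  unfolding two_time_funs_def[abs_def] by (rule point_fun_regular) simp

text \<open>Induction on the sum of the positions at time \<open>t + 1\<close>. The relation to be used depends on the first
  point \<open>x\<close> at that time: if the next one has the same position, the relation for equal points; else the
  vertex relation if \<open>x \<ge> 2\<close>; else \<open>x = 1\<close>, and it is the last point. In the second case, all later points are to the left of \<open>x\<close>, so replacing \<open>x\<close> by
  \<open>x - 1\<close> keeps the chain weakly decreasing.\<close>

lemma two_time_moment_eq:
  assumes s1: "-1 < s" and t: "t < n"
    and IH: "\<And>X. chain X \<Longrightarrow>
      complex_of_real (\<integral>m. (\<Prod>i=1..l. q ^ height m (X i)) \<partial>measure_spmf (dynamics q s u t)) =
        D * nested_integral (\<lambda>i. point_fun q s u (X i) t)"
  shows "k \<le> l \<Longrightarrow> chain X \<Longrightarrow>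
    complex_of_real (two_time_moment q s u t l X k) = D * nested_integral (two_time_funs X t k)"
proof (induction "\<Sum>i=Suc k..l. X i" arbitrary: k X rule: less_induct)
  case less
  have par: "vertex_params q s (u (Suc t))"
    using q s s1 u_pos[of "Suc t"] t by unfold_locales auto
  show ?case
  proof (cases "k = l")
    case True
    have "nested_integral (two_time_funs X t k) = nested_integral (\<lambda>i. point_fun q s u (X i) t)"
      by (rule nested_integral_cong) (simp add: two_time_funs_def True)
    then show ?thesis using IH[OF less.prems(2)] two_time_moment_top[where u=u and t=t and l=l and X=X, OF par] True by simp
  next
    case False
    then have kl: "Suc k \<le> l" "Suc k \<in> {1..l}" using less.prems(1) by auto
    have ge1: "1 \<le> X i" if "i \<in> {1..l}" for i using less.prems(2) that by (simp add: chain_def)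
    have anti: "X j \<le> X i" if "i \<in> {1..l}" "j \<in> {1..l}" "i \<le> j" for i j
      using less.prems(2) that by (simp add: chain_def)
    have sum: "(\<Sum>i=Suc k..l. X i) = X (Suc k) + (\<Sum>i=Suc (Suc k)..l. X i)"
      using kl(1) by (simp add: sum.atLeast_Suc_atMost)
    have IH1: "complex_of_real (two_time_moment q s u t l X (Suc k)) = D * nested_integral (two_time_funs X t (Suc k))"
      using sum ge1[OF kl(2)] kl less.prems(2) by (intro less.hyps) auto
    define x where "x = X (Suc k)"
    let ?g = "two_time_funs X t k"
    have reg: "regular (?g(i := f))" if "f holomorphic_on - ({0, of_real s} \<union> P)" for f i
      using two_time_funs_regular[OF t] that by (rule regular_upd)
    consider (equal) "Suc (Suc k) \<le> l" "X (Suc (Suc k)) = x"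
      | (vertex) "2 \<le> x" "Suc (Suc k) \<le> l \<longrightarrow> X (Suc (Suc k)) < x"
      | (boundary) "Suc k = l" "x = 1"
    proof -
      have "1 \<le> x" using ge1[OF kl(2)] by (simp add: x_def)
      moreover have "X (Suc (Suc k)) \<le> x" "1 \<le> X (Suc (Suc k))" if "Suc (Suc k) \<le> l"
        using anti[OF kl(2), of "Suc (Suc k)"] ge1[of "Suc (Suc k)"] that by (auto simp: x_def)
      ultimately show thesis using that kl by (metis One_nat_def Suc_1 le_antisym le_neq_implies_less not_less_eq_eq)
    qed
    then show ?thesis
    proof cases
      case equal
      have IH2: "complex_of_real (two_time_moment q s u t l X (Suc (Suc k))) = D * nested_integral (two_time_funs X t (Suc (Suc k)))"
      proof (rule less.hyps)
        have "(\<Sum>i=Suc (Suc k)..l. X i) = X (Suc (Suc k)) + (\<Sum>i=Suc (Suc (Suc k))..l. X i)"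
          using equal(1) by (simp add: sum.atLeast_Suc_atMost)
        then show "(\<Sum>i=Suc (Suc (Suc k))..l. X i) < (\<Sum>i=Suc k..l. X i)"
          using sum ge1[OF kl(2)] by simp
      qed (use equal(1) less.prems(2) in auto)
      have funs: "two_time_funs X t k = ?g(Suc k := point_fun q s u x (Suc t), Suc (Suc k) := point_fun q s u x (Suc t))"
        "two_time_funs X t (Suc k) = ?g(Suc k := point_fun q s u x t, Suc (Suc k) := point_fun q s u x (Suc t))"
        "two_time_funs X t (Suc (Suc k)) = ?g(Suc k := point_fun q s u x t, Suc (Suc k) := point_fun q s u x t)"
        using equal(2) by (auto simp: two_time_funs_def fun_eq_iff x_def le_Suc_eq)
      have "nested_integral (two_time_funs X t k) =
          (1 + of_real q) * nested_integral (two_time_funs X t (Suc k)) - of_real q * nested_integral (two_time_funs X t (Suc (Suc k)))"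
        unfolding funs(2,3) by (subst funs(1), rule nested_integral_equal_points[OF kl(2) _ t regular_upd[OF reg]])
          (use equal(1) in simp_all)
      moreover have "two_time_moment q s u t l X k =
          (1 + q) * two_time_moment q s u t l X (Suc k) - q * two_time_moment q s u t l X (Suc (Suc k))"
        by (rule two_time_moment_equal_points[where u=u and t=t, OF par equal(1)])
           (use equal(2) ge1[OF kl(2)] in \<open>auto simp: x_def\<close>)
      ultimately show ?thesis
        by (simp only: of_real_diff of_real_mult of_real_add of_real_1 IH1 IH2 right_diff_distrib mult_ac)
    next
      case vertex
      define y where "y = x - 1"
      have y: "x = Suc y" "1 \<le> y" using vertex(1) by (auto simp: y_def)
      define Y where "Y = X(Suc k := y)"
      define v where "v = u (Suc t)"
      have after: "X i \<le> y" if "Suc k < i" "i \<le> l" for i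
        using anti[of "Suc (Suc k)" i] vertex(2) y(1) that by force
      have chainY: "chain Y"
        unfolding chain_def
      proof (intro conjI ballI impI)
        fix i j assume ij: "i \<in> {1..l}" "j \<in> {1..l}" "i \<le> j"
        show "Y j \<le> Y i"
          using anti[OF ij] after[of j] y(1) ij by (auto simp: Y_def x_def)
      next
        fix i assume "i \<in> {1..l}"
        then show "1 \<le> Y i" using ge1[of i] y(2) by (auto simp: Y_def)
      qed
      have sumY: "(\<Sum>i=Suc (Suc k)..l. Y i) = (\<Sum>i=Suc (Suc k)..l. X i)"
        by (rule sum.cong) (auto simp: Y_def)
      have "(\<Sum>i=Suc k..l. Y i) = y + (\<Sum>i=Suc (Suc k)..l. Y i)"
        using kl(1) by (simp add: sum.atLeast_Suc_atMost Y_def)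
      then have IHY: "complex_of_real (two_time_moment q s u t l Y k) = D * nested_integral (two_time_funs Y t k)"
        using sumY sum y(1) kl chainY by (intro less.hyps) (auto simp: x_def)
      have IHY1: "complex_of_real (two_time_moment q s u t l Y (Suc k)) = D * nested_integral (two_time_funs Y t (Suc k))"
        using sumY sum ge1[OF kl(2)] kl chainY by (intro less.hyps) auto
      have funs: "two_time_funs X t k = ?g(Suc k := point_fun q s u (Suc y) (Suc t))"
        "two_time_funs Y t k = ?g(Suc k := point_fun q s u y (Suc t))"
        "two_time_funs X t (Suc k) = ?g(Suc k := point_fun q s u (Suc y) t)"
        "two_time_funs Y t (Suc k) = ?g(Suc k := point_fun q s u y t)"
        using y(1) by (auto simp: two_time_funs_def fun_eq_iff x_def Y_def le_Suc_eq)
      have "of_real (1 - s * v) * nested_integral (two_time_funs X t k) + of_real (s * v - s\<^sup>2) * nested_integral (two_time_funs Y t k) =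
          of_real (1 - q * s * v) * nested_integral (two_time_funs X t (Suc k)) +
          of_real (q * s * v - s\<^sup>2) * nested_integral (two_time_funs Y t (Suc k))"
        unfolding funs(2-4) v_def by (subst funs(1), rule nested_integral_vertex[OF t kl(2) y(2) reg])
      from arg_cong[OF this, of "\<lambda>z. D * z"]
      have 1: "of_real (1 - s * v) * (D * nested_integral (two_time_funs X t k)) + of_real (s * v - s\<^sup>2) * (D * nested_integral (two_time_funs Y t k)) =
          of_real (1 - q * s * v) * (D * nested_integral (two_time_funs X t (Suc k))) +
          of_real (q * s * v - s\<^sup>2) * (D * nested_integral (two_time_funs Y t (Suc k)))"
        by (simp only: distrib_left mult_ac)
      have "(1 - s * v) * two_time_moment q s u t l X k + (s * v - s\<^sup>2) * two_time_moment q s u t l Y k =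
          (1 - q * s * v) * two_time_moment q s u t l X (Suc k) + (q * s * v - s\<^sup>2) * two_time_moment q s u t l Y (Suc k)"
        unfolding Y_def v_def
        by (rule two_time_moment_vertex[where u=u and t=t, OF par kl(1) _ y(2) after]) (use y(1) in \<open>simp_all add: x_def\<close>)
      from arg_cong[OF this, of complex_of_real]
      have 2: "of_real (1 - s * v) * complex_of_real (two_time_moment q s u t l X k) +
          of_real (s * v - s\<^sup>2) * (D * nested_integral (two_time_funs Y t k)) =
          of_real (1 - q * s * v) * (D * nested_integral (two_time_funs X t (Suc k))) +
          of_real (q * s * v - s\<^sup>2) * (D * nested_integral (two_time_funs Y t (Suc k)))"
        unfolding of_real_add of_real_mult[of _ "two_time_moment _ _ _ _ _ _ _"] IHY IHY1 IH1 .
      have "0 < 1 - s * v" using vertex_params.su_neg[OF par] by (simp add: v_def)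
      then have "complex_of_real (1 - s * v) \<noteq> 0" by (simp only: of_real_eq_0_iff)
      moreover have "of_real (1 - s * v) * complex_of_real (two_time_moment q s u t l X k) =
          of_real (1 - s * v) * (D * nested_integral (two_time_funs X t k))"
        using 1 2 by (metis add_right_cancel)
      ultimately show ?thesis by (metis mult_left_cancel)
    next
      case boundary
      have funs: "two_time_funs X t k = ?g(l := point_fun q s u 1 (Suc t))"
        using boundary by (auto simp: two_time_funs_def fun_eq_iff x_def)
      have "nested_integral (two_time_funs X t l) = nested_integral (?g(l := point_fun q s u 1 t))"
        using boundary by (intro nested_integral_cong) (auto simp: two_time_funs_def x_def)
      moreover have "nested_integral (two_time_funs X t k) = of_real q * nested_integral (?g(l := point_fun q s u 1 t))"
        by (subst funs, rule nested_integral_boundary[where x=X]) (use boundary t in \<open>auto simp: two_time_funs_def\<close>)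
      moreover have "two_time_moment q s u t l X k = q * two_time_moment q s u t l X l"
        using two_time_moment_boundary[where u=u and t=t and X=X and k=k, OF par] boundary by (simp add: x_def)
      ultimately show ?thesis using IH1 boundary(1) by simp
    qed
  qed
qed

lemma moment_eq:
  assumes s1: "-1 < s"
  shows "t \<le> n \<Longrightarrow> chain X \<Longrightarrow>
    complex_of_real (\<integral>m. (\<Prod>i=1..l. q ^ height m (X i)) \<partial>measure_spmf (dynamics q s u t)) =
      of_real q ^ (l * (l - 1) div 2) * nested_integral (\<lambda>i. point_fun q s u (X i) t)"
proof (induction t arbitrary: X)
  case 0
  have "of_real q \<noteq> (0::complex)" using q by simp
  then show ?case
    by (simp add: nested_integral_time_0 height_def measure_spmf_return_spmf integral_return power_inverse)
next
  case (Suc t)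
  then have t: "t < n" by simp
  have par: "vertex_params q s (u (Suc t))"
    using q s s1 u_pos[of "Suc t"] t by unfold_locales auto
  have "complex_of_real (two_time_moment q s u t l X 0) =
      of_real q ^ (l * (l - 1) div 2) * nested_integral (two_time_funs X t 0)"
    by (rule two_time_moment_eq[OF s1 t]) (use Suc t in auto)
  also have "nested_integral (two_time_funs X t 0) = nested_integral (\<lambda>i. point_fun q s u (X i) (Suc t))"
    by (rule nested_integral_cong) (simp add: two_time_funs_def)
  finally show ?case unfolding two_time_moment_0[where u=u and t=t, OF par] .
qed

end

theorem theorem9p8:
  fixes q s c r :: real and n l :: nat and u :: "nat \<Rightarrow> real" and x :: "nat \<Rightarrow> nat"
    and \<rho> :: "complex \<Rightarrow> real"
  assumes "0 < q" "q < 1" and "-1 < s" "s < 0" and "1 \<le> n"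
    and "\<forall>i\<in>{1..n}. 0 < u i"
    and "\<forall>i\<in>{1..n}. \<forall>j\<in>{1..n}. u i \<noteq> q * u j"
    and "1 \<le> l"
    and "\<forall>i\<in>{1..l}. \<forall>j\<in>{1..l}. i \<le> j \<longrightarrow> x j \<le> x i"
    and "\<forall>i\<in>{1..l}. 1 \<le> x i"
    and "admissible_contours q s n u l \<rho> c r"
  shows "complex_of_real
           (\<integral>m. (\<Prod>i=1..l. q ^ height m (x i)) \<partial>measure_spmf (dynamics q s u n)) =
         of_real q ^ (l * (l - 1) div 2) *
         iterated_oint (u_contour_ext n u \<rho> c r) [1..<Suc l]
           (\<lambda>w. (\<Prod>\<beta>=1..l. \<Prod>\<alpha>=1..<\<beta>. (w \<alpha> - w \<beta>) / (w \<alpha> - of_real q * w \<beta>)) *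
                (\<Prod>i=1..l. inverse (w i) *
                   ((1 - of_real s * w i) / (1 - inverse (of_real s) * w i)) ^ (x i - 1) *
                   (\<Prod>j=1..n. (1 - of_real (q * u j) * w i) / (1 - of_real (u j) * w i))))
           (\<lambda>_. 0)"
proof -
  \<comment> \<open>any strictly increasing sequence in the unit interval would do\<close>
  define \<theta> where "\<theta> j = 1 - 1 / real (j + 2)" for j
  have \<theta>: "0 < \<theta> j" "\<theta> j \<le> 1" for j by (simp_all add: \<theta>_def field_simps)
  have mono: "strict_mono \<theta>"
    by (rule strict_monoI) (simp add: \<theta>_def frac_less2)
  interpret nested_contours q s n l u \<rho> c r \<theta>
    by unfold_locales (use assms \<theta> mono in auto)
  let ?g = "\<lambda>i. point_fun q s u (x i) n"
  have chain: "chain x" using assms(9,10) by (simp add: chain_def)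
  have reg: "?g i holomorphic_on - ({0, of_real s} \<union> P)" for i by (rule point_fun_holomorphic) simp
  have "nested_integral ?g = iterated_oint (circles_at (\<lambda>_. 1)) [1..<Suc l] (integrand {1..l} ?g) (\<lambda>_. 0)"
    unfolding nested_integral_def by (rule iterated_integrand_radius_independent[OF \<theta>]) (use reg in auto)
  moreover have "circles_at (\<lambda>_. 1) = u_contour_ext n u \<rho> c r"
    by (rule ext) (simp add: circles_at_def)
  moreover have "integrand {1..l} ?g = (\<lambda>w. (\<Prod>\<beta>=1..l. \<Prod>\<alpha>=1..<\<beta>. (w \<alpha> - w \<beta>) / (w \<alpha> - of_real q * w \<beta>)) *
                (\<Prod>i=1..l. inverse (w i) *
                   ((1 - of_real s * w i) / (1 - inverse (of_real s) * w i)) ^ (x i - 1) *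
                   (\<Prod>j=1..n. (1 - of_real (q * u j) * w i) / (1 - of_real (u j) * w i))))"
    unfolding integrand_def[abs_def] qkernel_prod_atLeastAtMost point_fun_def qkernel_def ..
  ultimately show ?thesis using moment_eq[OF assms(3) order_refl chain] by simp
qed

end
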